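(* Let $\Omega\subset\mathbb{R}^N$, $N\ge 2$, be a bounded $C^2$ domain whose anisotropic mean curvature satisfies $\mathcal H_F\ge 0$ on $\partial\Omega$. Then the following anisotropic Hersch inequality holds: $$\lambda_F(p,\Omega)\ge\left(\frac{\pi_p}{2}\right)^p\frac{1}{R_F(\Omega)^p}.$$
   Context: Let $1<p<+\infty$ and let $F:\mathbb{R}^N\to[0,+\infty)$ be a convex function with $F(t\xi)=|t|F(\xi)$ for all $t\in\mathbb R$, $\xi\in\mathbb{R}^N$, with $a|\xi|\le F(\xi)$ for some constant $a>0$, with $F\in C^{3,\beta}(\mathbb{R}^N\setminus\{0\})$, and such that the Hessian $[F^p]_{\xi\xi}(\xi)$ is positive definite for every $\xi\neq0$. The polar function is $F^o(v)=\sup_{\xi\ne0}\frac{\langle\xi,v\rangle}{F(\xi)}$. A domain is a connected open set. First Dirichlet eigenvalue of the anisotropic $p$-Laplacian: $\lambda_F(p,\Omega)=\min_{\varphi\in W_0^{1,p}(\Omega)\setminus\{0\}}\frac{\int_\Omega F^p(\nabla\varphi)\,dx}{\int_\Omega|\varphi|^p\,dx}$. Anisotropic distance to the boundary and anisotropic inradius: $d_F(x)=\inf_{y\in\partial\Omega}F^o(x-y)$ for $x\in\overline\Omega$, and $R_F(\Omega)=\sup_{x\in\Omega}d_F(x)$. $\pi_p:=2\int_0^{(p-1)^{1/p}}\frac{dt}{[1-t^p/(p-1)]^{1/p}}=2\pi\frac{(p-1)^{1/p}}{p\sin(\pi/p)}$. Anisotropic mean curvature: for a bounded $C^2$ domain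 $\Omega$ with Euclidean unit outer normal $n_{\mathcal E}$, the anisotropic outer normal is $n_F=F_\xi(n_{\mathcal E})$ and $\mathcal H_F=\operatorname{div}(n_F)$ on $\partial\Omega$; equivalently, $\mathcal H_F(x)=\operatorname{div}\left[\nabla_\xi F(-\nabla g(x))\right]$ for $x\in\partial\Omega$, for any $g\in C^2(\overline\Omega)$ with $\Omega=\{g>0\}$, $\partial\Omega=\{g=0\}$ and $\nabla g\ne0$ on $\partial\Omega$. *)

theory Defs
  imports "HOL-Analysis.Analysis"
begin

section \<open>Differential operators and classes of differentiable functions\<close>

definition partial :: "'n \<Rightarrow> (real^'n \<Rightarrow> real) \<Rightarrow> real^'n \<Rightarrow> real" where
  "partial i f x = frechet_derivative f (at x) (axis i 1)"

definition grad :: "(real^'n \<Rightarrow> real) \<Rightarrow> real^'n \<Rightarrow> real^'n" where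
  "grad f x = (\<chi> i. partial i f x)"

definition hessian :: "(real^'n \<Rightarrow> real) \<Rightarrow> real^'n \<Rightarrow> real^'n^'n" where
  "hessian f x = jacobian (grad f) (at x)"

definition divergence :: "(real^'n \<Rightarrow> real^'n) \<Rightarrow> real^'n \<Rightarrow> real" where
  "divergence X x = trace (jacobian X (at x))"

definition pos_def :: "real^'n^'n \<Rightarrow> bool" where
  "pos_def A \<longleftrightarrow> (\<forall>v. v \<noteq> 0 \<longrightarrow> 0 < v \<bullet> (A *v v))"

text \<open>The class \<open>C\<^sup>k(S)\<close>; only used for open \<open>S\<close>.\<close>

fun C_k_on :: "nat \<Rightarrow> (real^'n) set \<Rightarrow> (real^'n \<Rightarrow> real) \<Rightarrow> bool" where
  "C_k_on 0 S f \<longleftrightarrow> continuous_on S f"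
| "C_k_on (Suc k) S f \<longleftrightarrow>
     (\<forall>x\<in>S. f differentiable (at x)) \<and> (\<forall>i. C_k_on k S (partial i f))"

text \<open>The class \<open>C\<^sup>k\<^sup>,\<^sup>\<beta>(S)\<close> for open \<open>S\<close>, with the usual local convention: the derivatives of
  order \<open>k\<close> are \<open>\<beta>\<close>-Hoelder on every compact subset of \<open>S\<close>. (A global Hoelder condition on
  the complement of the origin is not meant: the third derivatives of a 1-homogeneous function
  are homogeneous of degree -2.)\<close>

fun C_k_holder_on :: "nat \<Rightarrow> real \<Rightarrow> (real^'n) set \<Rightarrow> (real^'n \<Rightarrow> real) \<Rightarrow> bool" where
  "C_k_holder_on 0 \<beta> S f \<longleftrightarrow>
     (\<forall>K. compact K \<and> K \<subseteq> S \<longrightarrow>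
        (\<exists>C. \<forall>x\<in>K. \<forall>y\<in>K. \<bar>f x - f y\<bar> \<le> C * dist x y powr \<beta>))"
| "C_k_holder_on (Suc k) \<beta> S f \<longleftrightarrow>
     (\<forall>x\<in>S. f differentiable (at x)) \<and> (\<forall>i. C_k_holder_on k \<beta> S (partial i f))"

text \<open>\<open>C\<^sup>k\<close> boundary: near each boundary point the set lies above a \<open>C\<^sup>k\<close> graph in suitable
  orthonormal coordinates. The unit vector \<open>e\<close> is the vertical direction; \<open>\<gamma>\<close> is only
  evaluated on the hyperplane orthogonal to \<open>e\<close>, i.e. it is a function of the other
  \<open>N - 1\<close> coordinates.\<close>

definition C_k_boundary :: "nat \<Rightarrow> (real^'n) set \<Rightarrow> bool" where
  "C_k_boundary k \<Omega> \<longleftrightarrow>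
     (\<forall>x\<in>frontier \<Omega>. \<exists>r>0. \<exists>e \<gamma>. norm e = 1 \<and> C_k_on k UNIV \<gamma> \<and>
        \<Omega> \<inter> ball x r = {y \<in> ball x r. y \<bullet> e > \<gamma> (y - (y \<bullet> e) *\<^sub>R e)})"

section \<open>Sobolev spaces\<close>

definition in_Lp :: "real \<Rightarrow> (real^'n) set \<Rightarrow> (real^'n \<Rightarrow> 'b::euclidean_space) \<Rightarrow> bool" where
  "in_Lp p \<Omega> f \<longleftrightarrow>
     set_borel_measurable lebesgue \<Omega> f \<and> set_integrable lebesgue \<Omega> (\<lambda>x. norm (f x) powr p)"

definition test_function :: "(real^'n) set \<Rightarrow> (real^'n \<Rightarrow> real) \<Rightarrow> bool" where
  "test_function \<Omega> \<psi> \<longleftrightarrow>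
     (\<forall>k. C_k_on k UNIV \<psi>) \<and> (\<exists>K. compact K \<and> K \<subseteq> \<Omega> \<and> (\<forall>x. x \<notin> K \<longrightarrow> \<psi> x = 0))"

definition has_weak_gradient ::
  "(real^'n) set \<Rightarrow> (real^'n \<Rightarrow> real) \<Rightarrow> (real^'n \<Rightarrow> real^'n) \<Rightarrow> bool" where
  "has_weak_gradient \<Omega> u G \<longleftrightarrow>
     (\<forall>K. compact K \<and> K \<subseteq> \<Omega> \<longrightarrow> set_integrable lebesgue K u \<and> set_integrable lebesgue K G) \<and>
     (\<forall>\<psi> i. test_function \<Omega> \<psi> \<longrightarrow>
        (LINT x:\<Omega>|lebesgue. u x * partial i \<psi> x) = - (LINT x:\<Omega>|lebesgue. G x $ i * \<psi> x))"

text \<open>\<open>W\<^sub>0\<^sup>1\<^sup>,\<^sup>p(\<Omega>)\<close>: closure of the test functions in the norm of \<open>W\<^sup>1\<^sup>,\<^sup>p(\<Omega>)\<close>. Elements are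
  functions rather than classes modulo equality almost everywhere on \<open>\<Omega>\<close>.\<close>

definition W0_1p :: "real \<Rightarrow> (real^'n) set \<Rightarrow> (real^'n \<Rightarrow> real) set" where
  "W0_1p p \<Omega> = {u. in_Lp p \<Omega> u \<and>
     (\<exists>G. has_weak_gradient \<Omega> u G \<and> in_Lp p \<Omega> G \<and>
       (\<exists>\<phi> :: nat \<Rightarrow> real^'n \<Rightarrow> real. (\<forall>n. test_function \<Omega> (\<phi> n)) \<and>
          (\<lambda>n. LINT x:\<Omega>|lebesgue. \<bar>\<phi> n x - u x\<bar> powr p) \<longlonglongrightarrow> 0 \<and>
          (\<lambda>n. LINT x:\<Omega>|lebesgue. norm (grad (\<phi> n) x - G x) powr p) \<longlonglongrightarrow> 0))}"

section \<open>Anisotropic quantities\<close>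

text \<open>The minimum of the Rayleigh quotient, written as an infimum, which has the same value.
  The weak gradient \<open>G\<close> is unique almost everywhere on \<open>\<Omega>\<close>, so the quotient depends on
  \<open>u\<close> only.\<close>

definition first_eigenvalue ::
  "(real^'n \<Rightarrow> real) \<Rightarrow> real \<Rightarrow> (real^'n) set \<Rightarrow> real" where
  "first_eigenvalue F p \<Omega> =
     Inf {(LINT x:\<Omega>|lebesgue. F (G x) powr p) / (LINT x:\<Omega>|lebesgue. \<bar>u x\<bar> powr p) | u G.
            u \<in> W0_1p p \<Omega> \<and> has_weak_gradient \<Omega> u G \<and>
            \<not> (AE x in lebesgue. x \<in> \<Omega> \<longrightarrow> u x = 0)}"

definition polar :: "(real^'n \<Rightarrow> real) \<Rightarrow> real^'n \<Rightarrow> real" where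
  "polar F v = (SUP \<xi>\<in>UNIV - {0}. (\<xi> \<bullet> v) / F \<xi>)"

definition aniso_dist :: "(real^'n \<Rightarrow> real) \<Rightarrow> (real^'n) set \<Rightarrow> real^'n \<Rightarrow> real" where
  "aniso_dist F \<Omega> x = (INF y\<in>frontier \<Omega>. polar F (x - y))"

definition aniso_inradius :: "(real^'n \<Rightarrow> real) \<Rightarrow> (real^'n) set \<Rightarrow> real" where
  "aniso_inradius F \<Omega> = (SUP x\<in>\<Omega>. aniso_dist F \<Omega> x)"

definition pi_p :: "real \<Rightarrow> real" where
  "pi_p p = 2 * (LINT t:{0..(p - 1) powr (1 / p)}|lborel.
                   1 / (1 - t powr p / (p - 1)) powr (1 / p))"

text \<open>Defining functions of class \<open>C\<^sup>2\<close> up to the boundary. For a bounded \<open>C\<^sup>2\<close> domain these are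
  the restrictions of functions that are \<open>C\<^sup>2\<close> on a neighbourhood of the closure, which is how
  they are encoded, so that the derivatives at boundary points are ordinary ones.\<close>

definition C2_defining_function :: "(real^'n) set \<Rightarrow> (real^'n \<Rightarrow> real) \<Rightarrow> bool" where
  "C2_defining_function \<Omega> g \<longleftrightarrow>
     (\<exists>V. open V \<and> closure \<Omega> \<subseteq> V \<and> C_k_on 2 V g) \<and>
     \<Omega> = {x \<in> closure \<Omega>. g x > 0} \<and>
     frontier \<Omega> = {x \<in> closure \<Omega>. g x = 0} \<and>
     (\<forall>x\<in>frontier \<Omega>. grad g x \<noteq> 0)"

text \<open>The divergence of the anisotropic outer normal \<open>F\<^sub>\<xi>(n)\<close>, where the Euclidean outer normal
  is \<open>n = - grad g / norm (grad g)\<close> and the normalisation drops out because \<open>F\<^sub>\<xi>\<close> is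
  0-homogeneous. A bounded \<open>C\<^sup>2\<close> domain has a \<open>C\<^sup>2\<close> defining function, and for \<open>x\<close> on the boundary
  the value does not depend on which one is chosen.\<close>

definition aniso_mean_curvature ::
  "(real^'n \<Rightarrow> real) \<Rightarrow> (real^'n) set \<Rightarrow> real^'n \<Rightarrow> real" where
  "aniso_mean_curvature F \<Omega> x =
     (let g = (SOME g. C2_defining_function \<Omega> g) in divergence (\<lambda>y. grad F (- grad g y)) x)"

end

theory Submission
  imports Defs "HOL-Computational_Algebra.Polynomial"
begin

text \<open>
  Let \<open>d\<close> be the anisotropic distance to the boundary. Every point of \<open>\<Omega>\<close> lies on a ray
  \<open>y + t \<nu>(y)\<close> that issues from a nearest boundary point \<open>y\<close> in the direction \<open>\<nu> = F\<^sub>\<xi>(n)\<close> and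
  along which \<open>d = t\<close>. In a boundary chart the map \<open>(y, t) \<mapsto> y + t \<nu>(y)\<close> is injective before the
  cut points, the cut points form a null set, and the Jacobian is a positive multiple of
  \<open>det (1 - t M K)\<close>, with \<open>M = F\<^sub>\<xi>\<^sub>\<xi>(n)\<close> and \<open>K\<close> the Hessian of the graph. The polar ball that
  touches the boundary from inside bounds the eigenvalues of \<open>M K\<close> by the reciprocal of its radius,
  and their sum is the mean curvature, so the Jacobian is nonincreasing in \<open>t\<close>. On the rays the
  claim reduces to a one-dimensional inequality with a nonincreasing weight, which follows
  from a Picone-type argument with \<open>h = (w'/w)\<^sup>p\<^sup>-\<^sup>1\<close>, where \<open>w\<close> is the first \<open>p\<close>-sine function
  on an interval slightly longer than the inradius. No regularity of \<open>d\<close> or of the cut locus is used.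
\<close>

section \<open>Functions of class \<open>C\<^sup>k\<close>\<close>

text \<open>In a chart the graph function is extended to be constant in the vertical direction
  \<open>e\<close>, so the component \<open>w \<bullet> e\<close> of a vector \<open>w\<close> is
  free and serves as the time t: a pair (y, t) is one vector of R^N, the ray map sends R^N to
  itself, and moving along a ray is translation by a multiple of \<open>e\<close>. The function
  studied on a ray is f = |\<phi>|^p h(d). Its derivative is at most F(\<nabla>\<phi>)^p - c^p
  |\<phi>|^p: the polar value of \<nu> is at most 1, which bounds |\<nabla>\<phi> . \<nu>| by
  F(\<nabla>\<phi>), and Young's inequality absorbs the nonlinear term of the Riccati equation h' =
  -c^p - (p-1) h^(p/(p-1)). The singularity of h at t = 0 does no harm because \<phi> vanishes near
  the boundary. At the far end h must still be positive where d equals the inradius R, so c = pi_p /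
  (2 R') with R' > R, and R' tends to R only in the end.\<close>

lemma partial_eqI:
  assumes "(f has_derivative f') (at x)"
  shows "partial i f x = f' (axis i 1)"
  using frechet_derivative_at[OF assms] by (simp add: partial_def)

lemma has_derivative_grad:
  assumes "f differentiable (at x)"
  shows "(f has_derivative (\<lambda>h. grad f x \<bullet> h)) (at x)"
proof -
  define D where "D = frechet_derivative f (at x)"
  have d: "(f has_derivative D) (at x)"
    using assms unfolding D_def by (simp add: frechet_derivative_works)
  have "D h = grad f x \<bullet> h" for h
  proof -
    interpret linear D by (rule has_derivative_linear[OF d])
    have "D h = D (\<Sum>i\<in>UNIV. h $ i *\<^sub>R axis i 1)"
      by (simp add: basis_expansion flip: scalar_mult_eq_scaleR)
    also have "\<dots> = (\<Sum>i\<in>UNIV. h $ i * partial i f x)"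
      by (simp add: sum scaleR partial_def flip: D_def)
    also have "\<dots> = grad f x \<bullet> h"
      by (simp add: grad_def inner_vec_def mult.commute)
    finally show ?thesis .
  qed
  then have "D = (\<lambda>h. grad f x \<bullet> h)" by auto
  with d show ?thesis by simp
qed

lemma grad_eqI:
  assumes "(f has_derivative (\<lambda>h. v \<bullet> h)) (at x)"
  shows "grad f x = v"
  by (simp add: vec_eq_iff grad_def partial_eqI[OF assms] inner_axis)

lemma partial_cong_open:
  assumes "open S" "x \<in> S" "\<And>y. y \<in> S \<Longrightarrow> f y = g y"
  shows "partial i f x = partial i g x"
proof -
  have "(f has_derivative D) (at x) \<longleftrightarrow> (g has_derivative D) (at x)" for D
    using has_derivative_transform_within_open[of f D x UNIV S g]
      has_derivative_transform_within_open[of g D x UNIV S f] assms by auto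
  then show ?thesis by (simp add: partial_def frechet_derivative_def)
qed

lemma differentiable_cong_open:
  assumes "open S" "x \<in> S" "\<And>y. y \<in> S \<Longrightarrow> f y = g y" "f differentiable (at x)"
  shows "g differentiable (at x)"
  using has_derivative_transform_within_open[of f _ x UNIV S g] assms
  unfolding differentiable_def by auto

text \<open>The recursion of \<open>C_k_on\<close> is over functions on the whole space, while
  formulas for partial derivatives are proved on S only; this lemma transports the class along such
  formulas.\<close>

lemma C_k_on_cong:
  assumes "open S" "\<And>x. x \<in> S \<Longrightarrow> f x = g x" "C_k_on k S f"
  shows "C_k_on k S g"
  using assms(2,3)
proof (induction k arbitrary: f g)
  case 0
  then show ?case by (simp cong: continuous_on_cong)
next
  case (Suc k)
  have "C_k_on k S (partial i g)" for i
  proof (rule Suc.IH[of "partial i f"])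
    show "partial i f x = partial i g x" if "x \<in> S" for x
      by (rule partial_cong_open[OF assms(1) that]) (rule Suc.prems(1))
  qed (use Suc.prems(2) in simp)
  moreover have "g differentiable (at x)" if "x \<in> S" for x
    using differentiable_cong_open[OF assms(1) that, of f g] Suc.prems that by auto
  ultimately show ?case by simp
qed

lemma C_k_on_imp_continuous_on: "C_k_on k S f \<Longrightarrow> continuous_on S f"
  by (cases k) (auto simp: continuous_at_imp_continuous_on differentiable_imp_continuous_within)

lemma C_k_on_Suc_imp: "C_k_on (Suc k) S f \<Longrightarrow> C_k_on k S f"
proof (induction k arbitrary: f)
  case 0
  then show ?case using C_k_on_imp_continuous_on[of "Suc 0" S f] by simp
next
  case (Suc k)
  have "C_k_on k S (partial i f)" for i
    by (rule Suc.IH) (use Suc.prems in simp)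
  then show ?case using Suc.prems by simp
qed

lemma C_k_on_const: "C_k_on k S (\<lambda>x. c)"
proof (induction k arbitrary: c)
  case (Suc k)
  have "partial i (\<lambda>x. c) = (\<lambda>x::real^'a. 0)" for i :: 'a
    by (rule ext) (rule partial_eqI[OF has_derivative_const])
  then show ?case using Suc by simp
qed simp

lemma partial_inner: "partial i (\<lambda>x. x \<bullet> a) = (\<lambda>x. axis i 1 \<bullet> a)"
  by (rule ext, rule partial_eqI) (rule bounded_linear_imp_has_derivative[OF bounded_linear_inner_left])

lemma C_k_on_inner: "C_k_on k S (\<lambda>x. x \<bullet> a)"
proof (cases k)
  case 0
  then show ?thesis by (auto intro!: continuous_intros)
next
  case (Suc k')
  have "(\<lambda>x. x \<bullet> a) differentiable (at x)" for x
    by (rule bounded_linear_imp_differentiable[OF bounded_linear_inner_left])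
  then show ?thesis using Suc by (simp add: partial_inner C_k_on_const)
qed

lemma C_k_on_add:
  assumes "open S"
  shows "C_k_on k S f \<Longrightarrow> C_k_on k S g \<Longrightarrow> C_k_on k S (\<lambda>x. f x + g x)"
proof (induction k arbitrary: f g)
  case 0
  then show ?case by (auto intro!: continuous_intros)
next
  case (Suc k)
  have "C_k_on k S (partial i (\<lambda>x. f x + g x))" for i
  proof (rule C_k_on_cong[OF assms, of "\<lambda>x. partial i f x + partial i g x"])
    fix x assume x: "x \<in> S"
    have "((\<lambda>x. f x + g x) has_derivative (\<lambda>h. grad f x \<bullet> h + grad g x \<bullet> h)) (at x)"
      using Suc.prems x by (intro has_derivative_add has_derivative_grad) auto
    from partial_eqI[OF this, of i]
    show "partial i f x + partial i g x = partial i (\<lambda>x. f x + g x) x"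
      by (simp add: inner_axis grad_def)
  next
    show "C_k_on k S (\<lambda>x. partial i f x + partial i g x)"
      using Suc.prems by (intro Suc.IH) simp_all
  qed
  moreover have "(\<lambda>x. f x + g x) differentiable (at x)" if "x \<in> S" for x
    using Suc.prems that by (intro differentiable_add) simp_all
  ultimately show ?case by simp
qed

lemma C_k_on_mult:
  assumes "open S"
  shows "C_k_on k S f \<Longrightarrow> C_k_on k S g \<Longrightarrow> C_k_on k S (\<lambda>x. f x * g x)"
proof (induction k arbitrary: f g)
  case 0
  then show ?case by (auto intro!: continuous_intros)
next
  case (Suc k)
  have "C_k_on k S (partial i (\<lambda>x. f x * g x))" for i
  proof (rule C_k_on_cong[OF assms, of "\<lambda>x. f x * partial i g x + partial i f x * g x"])
    fix x assume x: "x \<in> S"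
    have "((\<lambda>x. f x * g x) has_derivative (\<lambda>h. f x * (grad g x \<bullet> h) + (grad f x \<bullet> h) * g x)) (at x)"
      using Suc.prems x by (intro has_derivative_mult has_derivative_grad) auto
    from partial_eqI[OF this, of i] 
    show "f x * partial i g x + partial i f x * g x = partial i (\<lambda>x. f x * g x) x"
      by (simp add: inner_axis grad_def)
  next
    show "C_k_on k S (\<lambda>x. f x * partial i g x + partial i f x * g x)"
      using Suc.prems C_k_on_Suc_imp[OF Suc.prems(1)] C_k_on_Suc_imp[OF Suc.prems(2)]
      by (intro C_k_on_add[OF assms] Suc.IH) simp_all
  qed
  moreover have "(\<lambda>x. f x * g x) differentiable (at x)" if "x \<in> S" for x
    using Suc.prems that by (intro differentiable_mult) simp_all
  ultimately show ?case by simp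
qed

lemma C_k_on_sum:
  assumes "open S"
  shows "(\<And>i. i \<in> I \<Longrightarrow> C_k_on k S (f i)) \<Longrightarrow> C_k_on k S (\<lambda>x. \<Sum>i\<in>I. f i x)"
proof (induction I rule: infinite_finite_induct)
  case (insert j I)
  show ?case unfolding sum.insert[OF insert.hyps]
    by (intro C_k_on_add[OF assms] insert.IH) (simp_all add: insert.prems)
qed (simp_all add: C_k_on_const)

lemma C_k_on_prod:
  assumes "open S"
  shows "(\<And>i. i \<in> I \<Longrightarrow> C_k_on k S (f i)) \<Longrightarrow> C_k_on k S (\<lambda>x. \<Prod>i\<in>I. f i x)"
proof (induction I rule: infinite_finite_induct)
  case (insert j I)
  show ?case unfolding prod.insert[OF insert.hyps]
    by (intro C_k_on_mult[OF assms] insert.IH) (simp_all add: insert.prems)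
qed (simp_all add: C_k_on_const)

text \<open>The outer function comes with the sequence \<open>\<theta>\<close> of all its
  derivatives, so that the induction on k can be carried out for all j at once: differentiating
  \<open>\<theta> j\<close> after u produces \<open>\<theta> (Suc j)\<close> after u times a partial
  derivative of u.\<close>

lemma C_k_on_compose_real:
  fixes \<theta> :: "nat \<Rightarrow> real \<Rightarrow> real"
  assumes "open S" and \<theta>: "\<And>j t. (\<theta> j has_real_derivative \<theta> (Suc j) t) (at t)"
    and "\<And>k. C_k_on k S u"
  shows "C_k_on k S (\<lambda>x. \<theta> j (u x))"
proof (induction k arbitrary: j)
  case 0
  have "continuous_on UNIV (\<theta> j)"
    using DERIV_isCont[OF \<theta>] by (simp add: continuous_at_imp_continuous_on)
  then show ?case using assms(3)[of 0]
    by (auto intro: continuous_on_compose2)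
next
  case (Suc k)
  have u: "u differentiable (at x)" if "x \<in> S" for x using assms(3)[of "Suc 0"] that by auto
  have der: "((\<lambda>x. \<theta> j (u x)) has_derivative (\<lambda>h. \<theta> (Suc j) (u x) * (grad u x \<bullet> h))) (at x)"
    if "x \<in> S" for x
    using has_derivative_compose[OF has_derivative_grad[OF u[OF that]]
        \<theta>[of j "u x", unfolded has_field_derivative_def]] by simp
  have "C_k_on k S (partial i (\<lambda>x. \<theta> j (u x)))" for i
  proof (rule C_k_on_cong[OF assms(1), of "\<lambda>x. \<theta> (Suc j) (u x) * partial i u x"])
    fix x assume "x \<in> S"
    from partial_eqI[OF der[OF this], of i]
    show "\<theta> (Suc j) (u x) * partial i u x = partial i (\<lambda>x. \<theta> j (u x)) x"
      by (simp add: inner_axis grad_def)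
  next
    show "C_k_on k S (\<lambda>x. \<theta> (Suc j) (u x) * partial i u x)"
      using assms(3)[of "Suc k"] by (intro C_k_on_mult[OF assms(1)] Suc.IH) simp_all
  qed
  then show ?case using differentiableI[OF der] by simp
qed

lemma C_k_on_compose_linear:
  fixes L :: "real^'n \<Rightarrow> real^'m"
  assumes "linear L"
  shows "C_k_on k UNIV f \<Longrightarrow> C_k_on k UNIV (\<lambda>x. f (L x))"
proof (induction k arbitrary: f)
  case 0
  have "continuous_on UNIV L" by (simp add: assms linear_continuous_on linear_linear)
  then show ?case using 0 by (auto intro: continuous_on_compose2)
next
  case (Suc k)
  have bl: "bounded_linear L" by (simp add: assms linear_linear)
  have der: "((\<lambda>x. f (L x)) has_derivative (\<lambda>h. grad f (L x) \<bullet> L h)) (at x)" for x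
    by (rule has_derivative_compose[OF bounded_linear_imp_has_derivative[OF bl]])
       (use Suc.prems in \<open>auto intro: has_derivative_grad\<close>)
  have "partial i (\<lambda>x. f (L x)) = (\<lambda>x. \<Sum>j\<in>UNIV. partial j f (L x) * (L (axis i 1) $ j))" for i
    by (rule ext, subst partial_eqI[OF der]) (simp add: grad_def inner_vec_def)
  moreover have "C_k_on k UNIV (\<lambda>x. \<Sum>j\<in>UNIV. partial j f (L x) * (L (axis i 1) $ j))" for i
    using Suc.prems by (intro C_k_on_sum C_k_on_mult C_k_on_const Suc.IH) simp_all
  ultimately show ?case using differentiableI[OF der] by simp
qed

lemma has_derivative_vec:
  fixes f :: "real^'n \<Rightarrow> real^'m"
  assumes "\<And>i. ((\<lambda>x. f x $ i) has_derivative (\<lambda>h. A $ i \<bullet> h)) (at x)"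
  shows "(f has_derivative (\<lambda>h. A *v h)) (at x)"
proof -
  have "(f has_derivative (\<lambda>h. A *v h)) (at x within UNIV) \<longleftrightarrow> 
    (\<forall>b\<in>Basis. ((\<lambda>x. f x \<bullet> b) has_derivative (\<lambda>h. (A *v h) \<bullet> b)) (at x))"
    by (rule has_derivative_componentwise_within)
  moreover have "((\<lambda>x. f x \<bullet> b) has_derivative (\<lambda>h. (A *v h) \<bullet> b)) (at x)" if "b \<in> Basis" for b
  proof -
    from that obtain i where "b = axis i 1" by (auto simp: Basis_vec_def)
    then show ?thesis using assms[of i] by (simp add: inner_axis matrix_vector_mul_component)
  qed
  ultimately show ?thesis by simp
qed

lemma jacobian_eqI:
  fixes f :: "real^'n \<Rightarrow> real^'m"
  assumes "(f has_derivative (\<lambda>h. A *v h)) (at x)"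
  shows "jacobian f (at x) = A"
  using frechet_derivative_at[OF assms] by (simp add: jacobian_def flip: frechet_derivative_at[OF assms])

section \<open>Second derivatives and symmetry of the Hessian\<close>

lemma C2_derivatives:
  fixes f :: "real^'n \<Rightarrow> real"
  assumes "open S" "C_k_on 2 S f" "x \<in> S"
  shows "(f has_derivative (\<lambda>h. grad f x \<bullet> h)) (at x)"
    and "(grad f has_derivative (\<lambda>h. hessian f x *v h)) (at x)"
    and "hessian f x = (\<chi> i. grad (partial i f) x)"
proof -
  have 1: "\<And>y. y \<in> S \<Longrightarrow> f differentiable (at y)" 
    and 2: "\<And>y i. y \<in> S \<Longrightarrow> partial i f differentiable (at y)"
    using assms(2) by (auto simp: numeral_2_eq_2)
  show "(f has_derivative (\<lambda>h. grad f x \<bullet> h)) (at x)"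
    using 1 assms(3) by (simp add: has_derivative_grad)
  have *: "(grad f has_derivative (\<lambda>h. (\<chi> i. grad (partial i f) x) *v h)) (at x)"
    by (rule has_derivative_vec)
       (use has_derivative_grad[OF 2[OF assms(3)]] in \<open>simp add: grad_def[of f]\<close>)
  from jacobian_eqI[OF *] show eq: "hessian f x = (\<chi> i. grad (partial i f) x)"
    by (simp add: hessian_def)
  show "(grad f has_derivative (\<lambda>h. hessian f x *v h)) (at x)" using * eq by simp
qed

lemma C2_continuous:
  fixes f :: "real^'n \<Rightarrow> real"
  assumes "open S" "C_k_on 2 S f"
  shows "continuous_on S (grad f)" "continuous_on S (hessian f)"
proof -
  show "continuous_on S (grad f)"
    using C2_derivatives(2)[OF assms] 
    by (auto intro!: continuous_at_imp_continuous_on has_derivative_continuous)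
  have c: "continuous_on S (partial j (partial i f))" for i j
    using assms(2) by (auto simp: numeral_2_eq_2)
  have "continuous_on S (\<lambda>x. (\<chi> i. grad (partial i f) x))"
    unfolding grad_def by (intro continuous_on_vec_lambda c)
  then show "continuous_on S (hessian f)"
    using C2_derivatives(3)[OF assms] by (simp cong: continuous_on_cong)
qed

text \<open>The mixed second difference is unchanged when u and v are exchanged, so its limit gives
  the symmetry of the Hessian. One mean value step in the direction u turns it into a difference of
  gradients, to which the first-order expansion of the gradient at x applies twice.\<close>

lemma second_difference_limit:
  fixes f :: "real^'n \<Rightarrow> real"
  assumes "open S" "C_k_on 2 S f" "x \<in> S"
  shows "((\<lambda>s. (f (x + s *\<^sub>R u + s *\<^sub>R v) - f (x + s *\<^sub>R u) - f (x + s *\<^sub>R v) + f x) / s\<^sup>2)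
           \<longlongrightarrow> (hessian f x *v v) \<bullet> u) (at_right 0)"
proof (rule tendstoI)
  fix e :: real assume "0 < e"
  define H where "H = hessian f x"
  \<comment> \<open>The remainders of the two gradient expansions add up to at most
    \<open>e' * (C - 1)\<close> after division by s; the summand 1 keeps C positive when u =
    0.\<close>
  define C where "C = (2 * norm u + norm v) * norm u + 1"
  have C: "C > 0" unfolding C_def by (intro add_nonneg_pos mult_nonneg_nonneg) auto
  define e' where "e' = e / (2 * C)"
  have e': "e' > 0" using \<open>0 < e\<close> C by (simp add: e'_def)
  obtain d0 where d0: "d0 > 0" "ball x d0 \<subseteq> S" using assms(1,3) openE by blast
  have "(grad f has_derivative (\<lambda>h. H *v h)) (at x)"
    unfolding H_def by (rule C2_derivatives(2)[OF assms])
  then obtain d1 where d1: "d1 > 0"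
    "\<And>y. norm (y - x) < d1 \<Longrightarrow> norm (grad f y - grad f x - H *v (y - x)) \<le> e' * norm (y - x)"
    using e' unfolding has_derivative_at_alt by blast
  define d where "d = min d0 d1 / (norm u + norm v + 1)"
  have d: "d > 0" unfolding d_def using d0 d1 
    by (intro divide_pos_pos) (auto intro: add_nonneg_pos)
  have "dist ((f (x + s *\<^sub>R u + s *\<^sub>R v) - f (x + s *\<^sub>R u) - f (x + s *\<^sub>R v) + f x) / s\<^sup>2)
     ((hessian f x *v v) \<bullet> u) < e" if s: "0 < s" "s < d" for s
  proof -
    have small: "norm (t *\<^sub>R u + r *\<^sub>R v) < min d0 d1" if "0 \<le> t" "t \<le> s" "0 \<le> r" "r \<le> s" for t r
    proof -
      have "norm (t *\<^sub>R u + r *\<^sub>R v) \<le> t * norm u + r * norm v"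
        using norm_triangle_ineq[of "t *\<^sub>R u" "r *\<^sub>R v"] that by simp
      also have "\<dots> \<le> s * norm u + s * norm v"
        using that by (intro add_mono mult_right_mono) auto
      also have "\<dots> \<le> s * (norm u + norm v + 1)" using s by (simp add: algebra_simps)
      also have "\<dots> < d * (norm u + norm v + 1)"
        using s by (intro mult_strict_right_mono) (auto intro: add_nonneg_pos)
      also have "\<dots> = min d0 d1" unfolding d_def
        using add_nonneg_pos[of "norm u + norm v" 1] by simp
      finally show ?thesis .
    qed
    have inS: "x + t *\<^sub>R u + r *\<^sub>R v \<in> S" if "0 \<le> t" "t \<le> s" "0 \<le> r" "r \<le> s" for t r
    proof -
      have "dist x (x + t *\<^sub>R u + r *\<^sub>R v) = norm (t *\<^sub>R u + r *\<^sub>R v)"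
        by (metis add_diff_cancel_left' dist_commute dist_norm add.assoc)
      then show ?thesis using small[OF that] d0 by (auto simp: subset_iff)
    qed
    define R where "R y = grad f y - grad f x - H *v (y - x)" for y
    have R: "norm (R (x + t *\<^sub>R u + r *\<^sub>R v)) \<le> e' * (s * norm u + r * norm v)"
      if "0 \<le> t" "t \<le> s" "0 \<le> r" "r \<le> s" for t r
    proof -
      have "norm (R (x + t *\<^sub>R u + r *\<^sub>R v)) \<le> e' * norm (t *\<^sub>R u + r *\<^sub>R v)"
        using d1(2)[of "x + t *\<^sub>R u + r *\<^sub>R v"] small[OF that] 
        unfolding R_def by (simp add: add.assoc)
      also have "norm (t *\<^sub>R u + r *\<^sub>R v) \<le> t * norm u + r * norm v"
        using norm_triangle_ineq[of "t *\<^sub>R u" "r *\<^sub>R v"] that by simp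
      also have "\<dots> \<le> s * norm u + r * norm v"
        using that by (intro add_mono mult_right_mono) auto
      finally show ?thesis using e' by simp
    qed
    \<comment> \<open>The vanishing term \<open>0 *\<^sub>R v\<close> is kept so that both summands
      are instances of the facts \<open>inS\<close> and \<open>R\<close>, with r = s and r =
      0.\<close>
    define \<phi> where "\<phi> t = f (x + t *\<^sub>R u + s *\<^sub>R v) - f (x + t *\<^sub>R u + 0 *\<^sub>R v)" for t
    have der: "(\<phi> has_real_derivative 
        (grad f (x + t *\<^sub>R u + s *\<^sub>R v) \<bullet> u - grad f (x + t *\<^sub>R u + 0 *\<^sub>R v) \<bullet> u)) (at t)"
      if "0 \<le> t" "t \<le> s" for t
    proof -
      have "((\<lambda>t. f (x + t *\<^sub>R u + r *\<^sub>R v)) has_derivative 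
             (\<lambda>h. grad f (x + t *\<^sub>R u + r *\<^sub>R v) \<bullet> (h *\<^sub>R u))) (at t)" if "0 \<le> r" "r \<le> s" for r
        by (rule has_derivative_compose[where g=f, OF _ C2_derivatives(1)[OF assms(1,2)]])
           (auto intro!: derivative_eq_intros inS that \<open>0 \<le> t\<close> \<open>t \<le> s\<close>)
      from has_derivative_diff[OF this[of s] this[of 0]] s
      have "(\<phi> has_derivative (\<lambda>h. grad f (x + t *\<^sub>R u + s *\<^sub>R v) \<bullet> (h *\<^sub>R u) 
          - grad f (x + t *\<^sub>R u + 0 *\<^sub>R v) \<bullet> (h *\<^sub>R u))) (at t)"
        unfolding \<phi>_def by simp
      then show ?thesis unfolding has_field_derivative_def
        by (rule has_derivative_eq_rhs) (simp add: fun_eq_iff algebra_simps)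
    qed
    obtain t where t: "0 < t" "t < s" and
      mv: "\<phi> s - \<phi> 0 = (s - 0) * (grad f (x + t *\<^sub>R u + s *\<^sub>R v) \<bullet> u - grad f (x + t *\<^sub>R u + 0 *\<^sub>R v) \<bullet> u)"
      using MVT2[OF s(1) der] by blast
    have gr: "grad f (x + t *\<^sub>R u + s *\<^sub>R v) - grad f (x + t *\<^sub>R u + 0 *\<^sub>R v)
      = s *\<^sub>R (H *v v) + R (x + t *\<^sub>R u + s *\<^sub>R v) - R (x + t *\<^sub>R u + 0 *\<^sub>R v)"
      unfolding R_def by (simp add: matrix_vector_right_distrib matrix_vector_mult_scaleR algebra_simps)
    have "f (x + s *\<^sub>R u + s *\<^sub>R v) - f (x + s *\<^sub>R u) - f (x + s *\<^sub>R v) + f x = \<phi> s - \<phi> 0"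
      by (simp add: \<phi>_def)
    also have "\<dots> = s * ((grad f (x + t *\<^sub>R u + s *\<^sub>R v) - grad f (x + t *\<^sub>R u + 0 *\<^sub>R v)) \<bullet> u)"
      using mv by (simp add: inner_diff_left)
    also have "\<dots> = s * (s * ((H *v v) \<bullet> u) + (R (x + t *\<^sub>R u + s *\<^sub>R v) - R (x + t *\<^sub>R u + 0 *\<^sub>R v)) \<bullet> u)"
      unfolding gr by (simp add: inner_add_left inner_diff_left)
    finally have eq: "(f (x + s *\<^sub>R u + s *\<^sub>R v) - f (x + s *\<^sub>R u) - f (x + s *\<^sub>R v) + f x) / s\<^sup>2 - (H *v v) \<bullet> u
       = ((R (x + t *\<^sub>R u + s *\<^sub>R v) - R (x + t *\<^sub>R u + 0 *\<^sub>R v)) \<bullet> u) / s"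
      using s by (simp add: field_simps power2_eq_square)
    have "\<bar>(R (x + t *\<^sub>R u + s *\<^sub>R v) - R (x + t *\<^sub>R u + 0 *\<^sub>R v)) \<bullet> u\<bar>
       \<le> norm (R (x + t *\<^sub>R u + s *\<^sub>R v) - R (x + t *\<^sub>R u + 0 *\<^sub>R v)) * norm u"
      by (rule Cauchy_Schwarz_ineq2)
    also have "\<dots> \<le> (e' * (s * norm u + s * norm v) + e' * (s * norm u + 0 * norm v)) * norm u"
      using t s by (intro mult_right_mono order_trans[OF norm_triangle_ineq4] add_mono R) auto
    also have "\<dots> = s * (e' * (C - 1))" by (simp add: C_def algebra_simps)
    finally have "\<bar>((R (x + t *\<^sub>R u + s *\<^sub>R v) - R (x + t *\<^sub>R u + 0 *\<^sub>R v)) \<bullet> u) / s\<bar> \<le> e' * (C - 1)"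
      using s by (simp add: field_simps)
    also have "\<dots> < e' * (2 * C)" using e' C by simp
    also have "\<dots> = e" using C by (simp add: e'_def)
    finally show ?thesis unfolding dist_real_def H_def[symmetric] eq .
  qed
  then show "\<forall>\<^sub>F s in at_right 0. dist ((f (x + s *\<^sub>R u + s *\<^sub>R v) - f (x + s *\<^sub>R u) - f (x + s *\<^sub>R v) + f x) / s\<^sup>2)
     ((hessian f x *v v) \<bullet> u) < e"
    unfolding eventually_at_right_field using d by blast
qed

lemma hessian_symmetric:
  fixes f :: "real^'n \<Rightarrow> real"
  assumes "open S" "C_k_on 2 S f" "x \<in> S"
  shows "(hessian f x *v v) \<bullet> u = (hessian f x *v u) \<bullet> v"
    and "transpose (hessian f x) = hessian f x"
proof -
  have *: "(hessian f x *v v) \<bullet> u = (hessian f x *v u) \<bullet> v" for u v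
  proof (rule tendsto_unique[OF _ second_difference_limit[OF assms, of u v]])
    show "((\<lambda>s. (f (x + s *\<^sub>R u + s *\<^sub>R v) - f (x + s *\<^sub>R u) - f (x + s *\<^sub>R v) + f x) / s\<^sup>2)
           \<longlongrightarrow> (hessian f x *v u) \<bullet> v) (at_right 0)"
      using second_difference_limit[OF assms, of v u] by (simp add: algebra_simps)
  qed simp
  show "(hessian f x *v v) \<bullet> u = (hessian f x *v u) \<bullet> v" by (rule *)
  show "transpose (hessian f x) = hessian f x"
    unfolding transpose_def vec_eq_iff
    using *[of "axis _ 1" "axis _ 1"] by (simp add: inner_axis matrix_vector_mul_component)
qed

section \<open>Smooth bump functions on boxes\<close>

definition flat_exp :: "real poly \<Rightarrow> real \<Rightarrow> real" where
  "flat_exp P t = (if t \<le> 0 then 0 else poly P (inverse t) * exp (- inverse t))"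

lemma poly_times_exp_tendsto_0: "((\<lambda>x. poly P x * exp (- x)) \<longlongrightarrow> (0::real)) at_top"
proof -
  have "((\<lambda>x. \<Sum>i\<le>degree P. coeff P i * (x ^ i / exp x)) \<longlongrightarrow> (\<Sum>i\<le>degree P. coeff P i * 0)) at_top"
    by (intro tendsto_intros tendsto_power_div_exp_0)
  then show ?thesis by (simp add: poly_altdef sum_distrib_right exp_minus divide_inverse mult.assoc)
qed

text \<open>In the variable s = 1/t the chain rule turns P into s^2 (P - P'), and
  \<open>[:0,0,1:]\<close> is the polynomial s^2. The family is thus closed under differentiation,
  which makes exp(-1/t), extended by 0, infinitely differentiable at 0 as well.\<close>

lemma DERIV_flat_exp:
  "(flat_exp P has_real_derivative flat_exp ([:0,0,1:] * (P - pderiv P)) t) (at t)"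
proof -
  let ?Q = "[:0,0,1:] * (P - pderiv P)"
  consider "t < 0" | "t = 0" | "t > 0" by linarith
  then show ?thesis
  proof cases
    case 1
    have "((\<lambda>_. 0::real) has_real_derivative flat_exp ?Q t) (at t)"
      using 1 by (simp add: flat_exp_def)
    then show ?thesis
      by (rule has_field_derivative_transform_within_open[where S="{..<0}"])
         (use 1 in \<open>simp_all add: flat_exp_def\<close>)
  next
    case 3
    have "((\<lambda>t. poly P (inverse t) * exp (- inverse t)) has_real_derivative flat_exp ?Q t) (at t)"
    proof -
      have i: "(inverse has_real_derivative - (inverse t * 1 * inverse t)) (at t)"
        using 3 by (intro DERIV_inverse') auto
      have "((\<lambda>t. poly P (inverse t) * exp (- inverse t)) has_real_derivative
          poly P (inverse t) * (exp (- inverse t) * (- (- (inverse t * 1 * inverse t))))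
          + poly (pderiv P) (inverse t) * (- (inverse t * 1 * inverse t)) * exp (- inverse t)) (at t)"
        by (intro DERIV_mult' DERIV_chain2[OF poly_DERIV i] DERIV_chain2[OF DERIV_exp] DERIV_minus i)
      moreover have "poly P (inverse t) * (exp (- inverse t) * (- (- (inverse t * 1 * inverse t))))
          + poly (pderiv P) (inverse t) * (- (inverse t * 1 * inverse t)) * exp (- inverse t) = flat_exp ?Q t"
        using 3 by (simp add: flat_exp_def right_diff_distrib left_diff_distrib)
      ultimately show ?thesis by simp
    qed
    then show ?thesis
      by (rule has_field_derivative_transform_within_open[where S="{0<..}"])
         (use 3 in \<open>simp_all add: flat_exp_def\<close>)
  next
    case 2
    have r: "((\<lambda>h. flat_exp P h / h) \<longlongrightarrow> 0) (at_right 0)"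
    proof -
      \<comment> \<open>\<open>pCons 0 P\<close> is s P(s): the difference quotient at 0 is again a
        polynomial in 1/h times exp(-1/h).\<close>
      have "((\<lambda>h. poly (pCons 0 P) (inverse h) * exp (- inverse h)) \<longlongrightarrow> 0) (at_right 0)"
        by (rule filterlim_compose[OF poly_times_exp_tendsto_0 filterlim_inverse_at_top_right])
      then show ?thesis
      proof (rule Lim_transform_eventually)
        show "\<forall>\<^sub>F h in at_right 0. poly (pCons 0 P) (inverse h) * exp (- inverse h) = flat_exp P h / h"
          using eventually_at_right_less[of 0]
          by eventually_elim (simp add: flat_exp_def divide_inverse)
      qed
    qed
    have l: "((\<lambda>h. flat_exp P h / h) \<longlongrightarrow> 0) (at_left 0)"
    proof (rule Lim_transform_eventually[OF tendsto_const])
      show "\<forall>\<^sub>F h in at_left 0. 0 = flat_exp P h / h"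
        using eventually_at_left_field[of "\<lambda>h. h < 0" "0::real"]
        by (auto simp: flat_exp_def elim: eventually_mono intro: lt_ex)
    qed
    have "((\<lambda>h. flat_exp P h / h) \<longlongrightarrow> 0) (at 0)"
      by (rule filterlim_split_at[OF l r])
    then show ?thesis using 2 by (simp add: DERIV_def flat_exp_def)
  qed
qed

definition bump1 :: "real \<Rightarrow> real" where "bump1 t = flat_exp 1 t"

lemma bump1_simps: "t \<le> 0 \<Longrightarrow> bump1 t = 0" "t > 0 \<Longrightarrow> bump1 t = exp (- inverse t)"
  by (auto simp: bump1_def flat_exp_def)

lemma bump1_bounds: "0 \<le> bump1 t" "bump1 t \<le> 1" 
  by (cases "t \<le> 0"; simp add: bump1_simps)+

lemma bump1_pos_iff: "0 < bump1 t \<longleftrightarrow> 0 < t"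
  by (cases "t \<le> 0"; simp add: bump1_simps)

lemma bump1_scaled_tendsto: "(\<lambda>m. bump1 (real m * t)) \<longlonglongrightarrow> (if t > 0 then 1 else 0)"
proof (cases "t > 0")
  case True
  have "(\<lambda>m. exp (- (inverse (real m) * inverse t))) \<longlonglongrightarrow> exp (- (0 * inverse t))"
    by (intro tendsto_intros lim_inverse_n)
  moreover have "\<forall>\<^sub>F m in sequentially. exp (- (inverse (real m) * inverse t)) = bump1 (real m * t)"
    using eventually_gt_at_top[of 0] by eventually_elim (use True in \<open>simp add: bump1_simps\<close>)
  ultimately show ?thesis using True by (simp add: Lim_transform_eventually)
next
  case False
  then have "bump1 (real m * t) = 0" for m by (intro bump1_simps mult_nonneg_nonpos) auto
  then show ?thesis using False by simp
qed

lemma C_k_on_bump1: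
  assumes "open S" "\<And>k. C_k_on k S u"
  shows "C_k_on k S (\<lambda>x. bump1 (u x))"
proof -
  define P :: "nat \<Rightarrow> real poly" where "P = rec_nat 1 (\<lambda>_ P. [:0,0,1:] * (P - pderiv P))"
  have "C_k_on k S (\<lambda>x. flat_exp (P 0) (u x))"
    by (rule C_k_on_compose_real[where \<theta>="\<lambda>j. flat_exp (P j)", OF assms(1) _ assms(2)])
       (simp only: P_def nat.rec DERIV_flat_exp)
  then show ?thesis by (simp add: P_def bump1_def)
qed

text \<open>Positive exactly on the open box for m > 0, and converging pointwise to its indicator as
  m grows: the first property serves for gluing, the second for testing integrals over
  boxes.\<close>

definition box_bump :: "real \<Rightarrow> real^'n \<Rightarrow> real^'n \<Rightarrow> real^'n \<Rightarrow> real" where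
  "box_bump m a b x = (\<Prod>i\<in>UNIV. bump1 (m * (x $ i - a $ i)) * bump1 (m * (b $ i - x $ i)))"

lemma C_k_on_box_bump: "C_k_on k UNIV (box_bump m a b)"
proof -
  have *: "C_k_on k UNIV (\<lambda>x::real^'n. m * (x \<bullet> axis i 1) + c)" for k i and m c :: real
    by (intro C_k_on_add C_k_on_mult C_k_on_const C_k_on_inner open_UNIV)
  have "C_k_on k UNIV (\<lambda>x. bump1 (m * (x $ i - a $ i)))" "C_k_on k UNIV (\<lambda>x. bump1 (m * (b $ i - x $ i)))" 
    for i k
    using C_k_on_bump1[OF open_UNIV *[of _ m i "- m * a $ i"], of k]
      C_k_on_bump1[OF open_UNIV *[of _ "-m" i "m * b $ i"], of k]
    by (simp_all add: inner_axis algebra_simps)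
  then show ?thesis
    unfolding box_bump_def[abs_def] by (intro C_k_on_prod C_k_on_mult open_UNIV)
qed

lemma box_bump_bounds: "0 \<le> box_bump m a b x" "box_bump m a b x \<le> 1"
  unfolding box_bump_def 
  by (intro prod_nonneg prod_le_1 conjI mult_nonneg_nonneg mult_le_one bump1_bounds)+

lemma box_bump_pos_iff: 
  assumes "m > 0" shows "0 < box_bump m a b x \<longleftrightarrow> x \<in> box a b"
proof -
  define c where "c i = bump1 (m * (x $ i - a $ i)) * bump1 (m * (b $ i - x $ i))" for i
  have nn: "0 \<le> c i" for i unfolding c_def by (intro mult_nonneg_nonneg bump1_bounds)
  have "0 < c i \<longleftrightarrow> a $ i < x $ i \<and> x $ i < b $ i" for i
  proof -
    have "0 < c i \<longleftrightarrow> 0 < bump1 (m * (x $ i - a $ i)) \<and> 0 < bump1 (m * (b $ i - x $ i))"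
      using bump1_bounds(1)[of "m * (x $ i - a $ i)"] bump1_bounds(1)[of "m * (b $ i - x $ i)"]
      unfolding c_def zero_less_mult_iff by linarith
    then show ?thesis using assms by (simp add: bump1_pos_iff zero_less_mult_iff)
  qed
  moreover have "0 < (\<Prod>i\<in>UNIV. c i) \<longleftrightarrow> (\<forall>i. 0 < c i)"
  proof
    assume pos: "0 < (\<Prod>i\<in>UNIV. c i)"
    have "c i \<noteq> 0" for i
    proof
      assume "c i = 0"
      then have "(\<Prod>i\<in>UNIV. c i) = 0" by (intro prod_zero) auto
      with pos show False by simp
    qed
    with nn show "\<forall>i. 0 < c i" by (simp add: less_le)
  qed (simp add: prod_pos)
  ultimately show ?thesis by (simp add: box_bump_def c_def[symmetric] mem_box_cart)
qed

lemma box_bump_outside: "m > 0 \<Longrightarrow> x \<notin> box a b \<Longrightarrow> box_bump m a b x = 0"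
  using box_bump_pos_iff[of m a b x] box_bump_bounds(1)[of m a b x] by simp

lemma test_function_box_bump:
  assumes "m > 0" "cbox a b \<subseteq> \<Omega>"
  shows "test_function \<Omega> (box_bump m a b)"
  unfolding test_function_def
proof (intro conjI allI exI impI)
  show "box_bump m a b x = 0" if "x \<notin> cbox a b" for x
    using that box_subset_cbox[of a b] by (intro box_bump_outside[OF assms(1)]) auto
qed (simp_all add: assms C_k_on_box_bump)

lemma box_bump_tendsto: "(\<lambda>m. box_bump (real m) a b x) \<longlonglongrightarrow> indicator (box a b) x"
proof -
  have "(\<lambda>m. box_bump (real m) a b x) \<longlonglongrightarrow> 
     (\<Prod>i\<in>UNIV. (if x $ i - a $ i > 0 then 1 else 0) * (if b $ i - x $ i > 0 then 1 else 0))"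
    unfolding box_bump_def by (intro tendsto_intros bump1_scaled_tendsto)
  also have "(\<Prod>i\<in>UNIV. (if x $ i - a $ i > 0 then 1 else 0) * (if b $ i - x $ i > 0 then 1 else 0)) 
     = (indicator (box a b) x :: real)"
    by (auto simp: indicator_def mem_box_cart intro!: prod.neutral prod_zero)
  finally show ?thesis .
qed

section \<open>Sobolev functions and integration by parts\<close>

text \<open>Convexity of x^p at a/(1-\<theta>) and b/\<theta> with weights 1-\<theta> and \<theta>.
  As \<theta> tends to 0 the factor of a^p tends to 1, so a perturbation b that is small in L^p
  costs nothing in the limit; this does the work of Minkowski's inequality.\<close>

lemma powr_add_le_convex:
  fixes a b :: real
  assumes "1 < p" "0 \<le> a" "0 \<le> b" "0 < \<theta>" "\<theta> < 1"
  shows "(a + b) powr p \<le> (1 - \<theta>) powr (1 - p) * a powr p + \<theta> powr (1 - p) * b powr p"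
proof -
  \<comment> \<open>Convexity is used on the open half-line only; if a or b vanishes, it is enough
    that both coefficients are at least 1.\<close>
  have ge1: "1 \<le> r powr (1 - p)" if "0 < r" "r < 1" for r :: real
    using powr_mono2'[of "1 - p" r 1] that assms(1) by simp
  consider "a = 0" | "b = 0" | "0 < a" "0 < b" using assms by linarith
  then show ?thesis
  proof cases
    case 1
    then show ?thesis using mult_right_mono[OF ge1[of \<theta>], of "b powr p"] assms by simp
  next
    case 2
    then show ?thesis using mult_right_mono[OF ge1[of "1 - \<theta>"], of "a powr p"] assms by simp
  next
    case 3
    have c: "convex_on {0<..} (\<lambda>x. x powr p)" using assms by (intro powr_convex) auto
    have "((1 - \<theta>) *\<^sub>R (a / (1 - \<theta>)) + \<theta> *\<^sub>R (b / \<theta>)) powr p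
      \<le> (1 - \<theta>) * (a / (1 - \<theta>)) powr p + \<theta> * (b / \<theta>) powr p"
      using assms 3 by (intro convex_onD[OF c]) auto
    moreover have "(1 - \<theta>) *\<^sub>R (a / (1 - \<theta>)) + \<theta> *\<^sub>R (b / \<theta>) = a + b" using assms by simp
    moreover have "(1 - \<theta>) * (a / (1 - \<theta>)) powr p = (1 - \<theta>) powr (1 - p) * a powr p"
      using assms by (simp add: powr_divide powr_diff)
    moreover have "\<theta> * (b / \<theta>) powr p = \<theta> powr (1 - p) * b powr p"
      using assms by (simp add: powr_divide powr_diff)
    ultimately show ?thesis by simp
  qed
qed

text \<open>Carries the Poincare-type inequality from the approximating functions to the limit.
  \<open>powr_add_le_convex\<close> is used twice with the same \<theta>, once to replace u by
  \<open>\<phi> n\<close> and once to replace \<open>D n\<close> by G; the errors vanish as n grows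
  with \<theta> fixed, and then \<theta> tends to 0.\<close>

lemma Lp_limit_inequality:
  fixes u :: "'a \<Rightarrow> real" and G :: "'a \<Rightarrow> 'b::euclidean_space"
    and F :: "'b \<Rightarrow> real"
  assumes p: "1 < p" and L: "0 \<le> L" and "0 \<le> C"
    and F: "continuous_on UNIV F" "\<And>x. 0 \<le> F x" "\<And>x y. F (x + y) \<le> F x + F y" "\<And>x. F x \<le> C * norm x"
    and meas: "u \<in> borel_measurable M" "G \<in> borel_measurable M"
      "\<And>n. \<phi> n \<in> borel_measurable M" "\<And>n. D n \<in> borel_measurable M"
    and int: "integrable M (\<lambda>x. \<bar>u x\<bar> powr p)" "integrable M (\<lambda>x. norm (G x) powr p)"
      "\<And>n. integrable M (\<lambda>x. \<bar>\<phi> n x\<bar> powr p)" "\<And>n. integrable M (\<lambda>x. norm (D n x) powr p)"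
    and conv: "(\<lambda>n. LINT x|M. \<bar>\<phi> n x - u x\<bar> powr p) \<longlonglongrightarrow> 0"
      "(\<lambda>n. LINT x|M. norm (D n x - G x) powr p) \<longlonglongrightarrow> 0"
    and ineq: "\<And>n. L * (LINT x|M. \<bar>\<phi> n x\<bar> powr p) \<le> (LINT x|M. F (D n x) powr p)"
  shows "L * (LINT x|M. \<bar>u x\<bar> powr p) \<le> (LINT x|M. F (G x) powr p)"
proof -
  have FM[measurable]: "F \<in> borel_measurable borel"
    using F(1) by (rule borel_measurable_continuous_onI)
  note [measurable] = meas
  have idiff: "integrable M (\<lambda>x. norm (f x - g x) powr p)"
    if "f \<in> borel_measurable M" "g \<in> borel_measurable M"
      "integrable M (\<lambda>x. norm (f x) powr p)" "integrable M (\<lambda>x. norm (g x) powr p)"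
    for f g :: "'a \<Rightarrow> 'c::euclidean_space"
  proof (rule Bochner_Integration.integrable_bound)
    show "integrable M (\<lambda>x. (1 - 1/2) powr (1 - p) * norm (f x) powr p + (1/2) powr (1 - p) * norm (g x) powr p)"
      using that by (intro Bochner_Integration.integrable_add integrable_mult_right)
    show "AE x in M. norm (norm (f x - g x) powr p) \<le>
        norm ((1 - 1/2) powr (1 - p) * norm (f x) powr p + (1/2) powr (1 - p) * norm (g x) powr p)"
    proof (rule AE_I2)
      fix x
      have "norm (f x - g x) powr p \<le> (norm (f x) + norm (g x)) powr p"
        using p by (intro powr_mono2 norm_triangle_ineq4) auto
      also have "\<dots> \<le> (1 - 1/2) powr (1 - p) * norm (f x) powr p + (1/2) powr (1 - p) * norm (g x) powr p"
        using p by (intro powr_add_le_convex) auto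
      finally show "norm (norm (f x - g x) powr p) \<le>
        norm ((1 - 1/2) powr (1 - p) * norm (f x) powr p + (1/2) powr (1 - p) * norm (g x) powr p)" by simp
    qed
    show "(\<lambda>x. norm (f x - g x) powr p) \<in> borel_measurable M" using that(1,2) by measurable
  qed
  have iF: "integrable M (\<lambda>x. F (f x) powr p)"
    if [measurable]: "f \<in> borel_measurable M" and "integrable M (\<lambda>x. norm (f x) powr p)" for f
  proof (rule Bochner_Integration.integrable_bound)
    show "integrable M (\<lambda>x. C powr p * norm (f x) powr p)" using that by (intro integrable_mult_right)
    have "F (f x) powr p \<le> C powr p * norm (f x) powr p" for x
      using powr_mono2[of p "F (f x)" "C * norm (f x)"] F p assms(3) by (simp add: powr_mult)
    then show "AE x in M. norm (F (f x) powr p) \<le> norm (C powr p * norm (f x) powr p)" by simp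
  qed measurable
  have id1: "integrable M (\<lambda>x. \<bar>\<phi> n x - u x\<bar> powr p)" for n
    using idiff[of "\<phi> n" u] meas int by simp
  have id2: "integrable M (\<lambda>x. norm (D n x - G x) powr p)" for n
    using idiff[of "D n" G] meas int by simp
  define A where "A = (LINT x|M. \<bar>u x\<bar> powr p)"
  define B where "B = (LINT x|M. F (G x) powr p)"
  define e1 where "e1 n = (LINT x|M. \<bar>\<phi> n x - u x\<bar> powr p)" for n
  define e2 where "e2 n = (LINT x|M. norm (D n x - G x) powr p)" for n
  have step: "L * A \<le> (1 - \<theta>) powr (1 - p) * ((1 - \<theta>) powr (1 - p) * B + \<theta> powr (1 - p) * C powr p * e2 n)
      + L * (\<theta> powr (1 - p) * e1 n)" if \<theta>: "0 < \<theta>" "\<theta> < 1" for \<theta> n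
  proof -
    let ?a = "(1 - \<theta>) powr (1 - p)" and ?b = "\<theta> powr (1 - p)"
    have "A \<le> (LINT x|M. ?a * \<bar>\<phi> n x\<bar> powr p + ?b * \<bar>\<phi> n x - u x\<bar> powr p)"
      unfolding A_def
    proof (rule integral_mono)
      fix x
      have "\<bar>u x\<bar> powr p \<le> (\<bar>\<phi> n x\<bar> + \<bar>\<phi> n x - u x\<bar>) powr p"
        using p by (intro powr_mono2) auto
      also have "\<dots> \<le> ?a * \<bar>\<phi> n x\<bar> powr p + ?b * \<bar>\<phi> n x - u x\<bar> powr p"
        using p \<theta> by (intro powr_add_le_convex) auto
      finally show "\<bar>u x\<bar> powr p \<le> ?a * \<bar>\<phi> n x\<bar> powr p + ?b * \<bar>\<phi> n x - u x\<bar> powr p" .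
    qed (use int id1 in \<open>auto intro!: Bochner_Integration.integrable_add integrable_mult_right\<close>)
    also have "\<dots> = ?a * (LINT x|M. \<bar>\<phi> n x\<bar> powr p) + ?b * e1 n"
      unfolding e1_def using int id1 by simp
    finally have "L * A \<le> L * (?a * (LINT x|M. \<bar>\<phi> n x\<bar> powr p) + ?b * e1 n)"
      using L by (rule mult_left_mono)
    also have "\<dots> = ?a * (L * (LINT x|M. \<bar>\<phi> n x\<bar> powr p)) + L * (?b * e1 n)" by (simp add: algebra_simps)
    also have "\<dots> \<le> ?a * (LINT x|M. F (D n x) powr p) + L * (?b * e1 n)"
      by (intro add_right_mono mult_left_mono ineq) auto
    also have "(LINT x|M. F (D n x) powr p) \<le> (LINT x|M. ?a * F (G x) powr p + ?b * C powr p * norm (D n x - G x) powr p)"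
    proof (rule integral_mono)
      fix x
      have "F (D n x) \<le> F (G x) + C * norm (D n x - G x)"
        using F(3)[of "G x" "D n x - G x"] F(4)[of "D n x - G x"] by simp
      then have "F (D n x) powr p \<le> (F (G x) + C * norm (D n x - G x)) powr p"
        using p F by (intro powr_mono2) auto
      also have "\<dots> \<le> ?a * F (G x) powr p + ?b * (C * norm (D n x - G x)) powr p"
        using p \<theta> F(2) assms(3) by (intro powr_add_le_convex) auto
      finally show "F (D n x) powr p \<le> ?a * F (G x) powr p + ?b * C powr p * norm (D n x - G x) powr p"
        using assms(3) by (simp add: powr_mult)
    qed (use int id2 iF meas in \<open>auto intro!: Bochner_Integration.integrable_add integrable_mult_right\<close>)
    also have "\<dots> = ?a * B + ?b * C powr p * e2 n"
      unfolding e2_def B_def using iF[of G] meas int id2 by simp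
    finally show ?thesis by (simp add: mult_left_mono)
  qed
  have lim\<theta>: "L * A \<le> (1 - \<theta>) powr (1 - p) * ((1 - \<theta>) powr (1 - p) * B)" if \<theta>: "0 < \<theta>" "\<theta> < 1" for \<theta>
  proof (rule LIMSEQ_le_const)
    have "(\<lambda>n. (1 - \<theta>) powr (1 - p) * ((1 - \<theta>) powr (1 - p) * B + \<theta> powr (1 - p) * C powr p * e2 n)
      + L * (\<theta> powr (1 - p) * e1 n)) \<longlonglongrightarrow> (1 - \<theta>) powr (1 - p) * ((1 - \<theta>) powr (1 - p) * B + \<theta> powr (1 - p) * C powr p * 0)
      + L * (\<theta> powr (1 - p) * 0)"
      using conv unfolding e1_def e2_def by (intro tendsto_intros)
    then show "(\<lambda>n. (1 - \<theta>) powr (1 - p) * ((1 - \<theta>) powr (1 - p) * B + \<theta> powr (1 - p) * C powr p * e2 n)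
      + L * (\<theta> powr (1 - p) * e1 n)) \<longlonglongrightarrow> (1 - \<theta>) powr (1 - p) * ((1 - \<theta>) powr (1 - p) * B)" by simp
  qed (use step[OF \<theta>] in blast)
  have "((\<lambda>\<theta>. (1 - \<theta>) powr (1 - p) * ((1 - \<theta>) powr (1 - p) * B)) \<longlongrightarrow> (1 - 0) powr (1 - p) * ((1 - 0) powr (1 - p) * B)) (at_right 0)"
    by (intro tendsto_intros) auto
  then have "((\<lambda>\<theta>. (1 - \<theta>) powr (1 - p) * ((1 - \<theta>) powr (1 - p) * B)) \<longlongrightarrow> B) (at_right 0)" by simp
  moreover have "\<forall>\<^sub>F \<theta> in at_right 0. L * A \<le> (1 - \<theta>) powr (1 - p) * ((1 - \<theta>) powr (1 - p) * B)"
    unfolding eventually_at_right_field using lim\<theta> by (intro exI[of _ 1]) auto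
  ultimately have "L * A \<le> B" by (intro tendsto_lowerbound) auto
  then show ?thesis by (simp add: A_def B_def)
qed

section \<open>Translation invariance and weak gradients of test functions\<close>

lemma integrable_continuous_compact_support:
  fixes f :: "'a::euclidean_space \<Rightarrow> 'b::euclidean_space"
  assumes "continuous_on UNIV f" "compact K" "\<And>x. x \<notin> K \<Longrightarrow> f x = 0"
  shows "integrable lebesgue f"
proof -
  have "integrable lborel (\<lambda>x. indicat_real K x *\<^sub>R f x)"
    using assms(1,2) by (intro borel_integrable_compact) (auto intro: continuous_on_subset)
  moreover have "(\<lambda>x. indicat_real K x *\<^sub>R f x) = f" using assms(3) by (auto simp: indicator_def fun_eq_iff)
  ultimately have "integrable lborel f" by simp
  then show ?thesis by (simp add: integrable_completion)
qed

lemma integral_lebesgue_translation: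
  fixes f :: "'a::euclidean_space \<Rightarrow> real"
  assumes "integrable lebesgue f"
  shows "integrable lebesgue (\<lambda>x. f (a + x))" "(LINT x|lebesgue. f (a + x)) = (LINT x|lebesgue. f x)"
proof -
  have eq: "(\<lambda>x::'a. a + (\<Sum>j\<in>Basis. (1 * (x \<bullet> j)) *\<^sub>R j)) = (+) a"
    by (simp add: euclidean_representation)
  have m: "(+) a \<in> measurable lebesgue lebesgue"
    using lebesgue_affine_measurable[of "\<lambda>_::'a. 1" a] unfolding eq by simp
  have d: "distr lebesgue lebesgue ((+) a) = lebesgue"
    using lebesgue_affine_euclidean[of "\<lambda>_::'a. 1" a] unfolding eq by (simp add: density_1)
  show "integrable lebesgue (\<lambda>x. f (a + x))"
    using integrable_distr_eq[OF m, of f] assms unfolding d by simp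
  show "(LINT x|lebesgue. f (a + x)) = (LINT x|lebesgue. f x)"
    using integral_distr[OF m, of f] assms unfolding d by simp
qed

lemma integrable_indicator_bounded:
  fixes S :: "'a::euclidean_space set"
  assumes "S \<in> sets lebesgue" "bounded S"
  shows "integrable lebesgue (indicator S :: 'a \<Rightarrow> real)"
  using bounded_set_imp_lmeasurable[OF assms(2,1)] assms(1)
  by (intro integrable_real_indicator) (auto simp: fmeasurable_def)

lemma C1_facts:
  fixes f :: "real^'n \<Rightarrow> real"
  assumes "C_k_on (Suc 0) UNIV f"
  shows "continuous_on UNIV f" "continuous_on UNIV (grad f)"
    "(f has_derivative (\<lambda>h. grad f x \<bullet> h)) (at x)"
  using assms C_k_on_imp_continuous_on[OF assms]
  by (auto simp: grad_def intro!: has_derivative_grad[unfolded grad_def] continuous_on_vec_lambda)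

lemma grad_zero_outside:
  fixes f :: "real^'n \<Rightarrow> real"
  assumes "compact K" "\<And>x. x \<notin> K \<Longrightarrow> f x = 0" "x \<notin> K"
  shows "grad f x = 0"
proof -
  have "partial i f x = partial i (\<lambda>_. 0) x" for i
    by (rule partial_cong_open[of "- K"]) (use assms compact_imp_closed in auto)
  moreover have "partial i (\<lambda>_. 0) x = 0" for i by (rule partial_eqI[OF has_derivative_const])
  ultimately show ?thesis by (simp add: grad_def vec_eq_iff)
qed

text \<open>By translation invariance every difference quotient in direction v has integral 0, and
  dominated convergence carries this to the derivative.\<close>

lemma integral_directional_derivative_zero:
  fixes f :: "real^'n \<Rightarrow> real"
  assumes f: "C_k_on (Suc 0) UNIV f" and K: "compact K" "\<And>x. x \<notin> K \<Longrightarrow> f x = 0"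
  shows "(LINT x|lebesgue. grad f x \<bullet> v) = 0"
proof -
  note C1 = C1_facts[OF f]
  have fi: "integrable lebesgue f"
    by (rule integrable_continuous_compact_support[OF C1(1) K])
  have gi: "integrable lebesgue (\<lambda>x. grad f x \<bullet> v)"
    using C1(2) grad_zero_outside[of K f] K
    by (intro integrable_continuous_compact_support[where K=K] continuous_intros) auto
  obtain r where r: "K \<subseteq> cball 0 r" using compact_imp_bounded[OF K(1)] by (auto simp: bounded_iff subset_iff)
  have "bounded ((\<lambda>x. grad f x \<bullet> v) ` K)"
    by (intro compact_imp_bounded compact_continuous_image K(1) continuous_intros)
       (rule continuous_on_subset[OF C1(2)], simp)
  then obtain C0 where C0: "\<And>x. x \<in> K \<Longrightarrow> \<bar>grad f x \<bullet> v\<bar> \<le> C0" by (auto simp: bounded_iff)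
  define C where "C = max C0 0"
  have C: "\<bar>grad f x \<bullet> v\<bar> \<le> C" for x
    using C0[of x] grad_zero_outside[of K f x] K by (cases "x \<in> K") (auto simp: C_def)
  define s where "s k x = real (Suc k) * (f (inverse (real (Suc k)) *\<^sub>R v + x) - f x)" for k x
  have ray: "((\<lambda>t. f (x + t *\<^sub>R v)) has_real_derivative (grad f (x + t *\<^sub>R v) \<bullet> v)) (at t)" for x t
  proof -
    have "((\<lambda>t. f (x + t *\<^sub>R v)) has_derivative (\<lambda>h. grad f (x + t *\<^sub>R v) \<bullet> (h *\<^sub>R v))) (at t)"
      by (rule has_derivative_compose[where g=f, OF _ C1(3)]) (auto intro!: derivative_eq_intros)
    then show ?thesis unfolding has_field_derivative_def
      by (rule has_derivative_eq_rhs) (simp add: fun_eq_iff mult.commute)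
  qed
  have "(\<lambda>k. LINT x|lebesgue. s k x) \<longlonglongrightarrow> (LINT x|lebesgue. grad f x \<bullet> v)"
  \<comment> \<open>The steps have length at most \<open>norm v\<close>, so all quotients live in
    the enlarged ball; there the mean value theorem bounds them by the bound C of the
    derivative.\<close>
  proof (rule integral_dominated_convergence[where w="\<lambda>x. indicator (cball 0 (r + norm v)) x * C"])
    show "(\<lambda>x. grad f x \<bullet> v) \<in> borel_measurable lebesgue" using gi by simp
    show "s k \<in> borel_measurable lebesgue" for k
      using fi integral_lebesgue_translation(1)[OF fi] unfolding s_def by measurable
    have "integrable lebesgue (indicat_real (cball (0::real^'n) (r + norm v)))"
      by (rule integrable_indicator_bounded) auto
    then show "integrable lebesgue (\<lambda>x. indicator (cball (0::real^'n) (r + norm v)) x * C)" by simp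
    show "AE x in lebesgue. (\<lambda>k. s k x) \<longlonglongrightarrow> grad f x \<bullet> v"
    proof (rule AE_I2)
      fix x
      have "((\<lambda>h. (f (x + h *\<^sub>R v) - f x) / h) \<longlongrightarrow> grad f x \<bullet> v) (at 0)"
        using ray[of x 0] by (simp add: has_field_derivative_iff)
      from filterlim_compose[OF this, of "\<lambda>k. inverse (real (Suc k))" sequentially]
      have "(\<lambda>k. (f (x + inverse (real (Suc k)) *\<^sub>R v) - f x) / inverse (real (Suc k))) \<longlonglongrightarrow> grad f x \<bullet> v"
        using LIMSEQ_inverse_real_of_nat by (auto simp: filterlim_at)
      then show "(\<lambda>k. s k x) \<longlonglongrightarrow> grad f x \<bullet> v"
        by (simp add: s_def divide_inverse mult.commute add.commute)
    qed
    show "AE x in lebesgue. norm (s k x) \<le> indicator (cball 0 (r + norm v)) x * C" for k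
    proof (rule AE_I2)
      fix x
      let ?h = "inverse (real (Suc k))"
      show "norm (s k x) \<le> indicator (cball 0 (r + norm v)) x * C"
      proof (cases "x \<in> cball 0 (r + norm v)")
        case True
        obtain z where "f (x + ?h *\<^sub>R v) - f (x + 0 *\<^sub>R v) = (?h - 0) * (grad f (x + z *\<^sub>R v) \<bullet> v)"
          using MVT2[of 0 ?h "\<lambda>t. f (x + t *\<^sub>R v)" "\<lambda>t. grad f (x + t *\<^sub>R v) \<bullet> v"] ray by auto
        then have "s k x = grad f (x + z *\<^sub>R v) \<bullet> v" by (simp add: s_def add.commute)
        then show ?thesis using C True by simp
      next
        case False
        have "norm (?h *\<^sub>R v) \<le> 1 * norm v"
          unfolding norm_scaleR by (intro mult_right_mono) (auto simp: inverse_le_1_iff)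
        moreover have "norm x \<le> norm (?h *\<^sub>R v + x) + norm (?h *\<^sub>R v)"
          using norm_triangle_ineq4[of "?h *\<^sub>R v + x" "?h *\<^sub>R v"] by simp
        moreover have "norm x > r + norm v" using False by simp
        ultimately have "?h *\<^sub>R v + x \<notin> cball 0 r" "x \<notin> cball 0 r"
          using norm_ge_zero[of v] by (simp_all del: norm_ge_zero)
        then have "f (?h *\<^sub>R v + x) = 0" "f x = 0" using K(2) r by blast+
        then show ?thesis using False by (simp add: s_def)
      qed
    qed
  qed
  moreover have "(LINT x|lebesgue. s k x) = 0" for k
    unfolding s_def using integral_lebesgue_translation[OF fi] fi by simp
  ultimately show ?thesis by (simp add: LIMSEQ_const_iff)
qed


lemma test_function_facts:
  assumes "test_function \<Omega> \<psi>"
  shows "C_k_on k UNIV \<psi>" "continuous_on UNIV \<psi>" "continuous_on UNIV (grad \<psi>)"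
    and "\<exists>K. compact K \<and> K \<subseteq> \<Omega> \<and> (\<forall>x. x \<notin> K \<longrightarrow> \<psi> x = 0 \<and> grad \<psi> x = 0)"
proof -
  show C: "C_k_on k UNIV \<psi>" for k using assms by (simp add: test_function_def)
  show "continuous_on UNIV \<psi>" "continuous_on UNIV (grad \<psi>)" by (rule C1_facts[OF C])+
  obtain K where K: "compact K" "K \<subseteq> \<Omega>" "\<And>x. x \<notin> K \<Longrightarrow> \<psi> x = 0"
    using assms by (auto simp: test_function_def)
  then show "\<exists>K. compact K \<and> K \<subseteq> \<Omega> \<and> (\<forall>x. x \<notin> K \<longrightarrow> \<psi> x = 0 \<and> grad \<psi> x = 0)"
    using grad_zero_outside[of K \<psi>] by blast
qed

lemma set_integral_eq_integral_support:
  fixes f :: "'a::euclidean_space \<Rightarrow> real"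
  assumes "\<And>x. x \<notin> S \<Longrightarrow> f x = 0"
  shows "(LINT x:S|lebesgue. f x) = (LINT x|lebesgue. f x)"
  unfolding set_lebesgue_integral_def
  by (rule Bochner_Integration.integral_cong) (auto simp: indicator_def assms)

text \<open>The product of u and \<psi> has compact support, so its partial derivatives have
  integral 0; the product rule makes this integration by parts.\<close>

lemma has_weak_gradient_test_function:
  assumes "test_function \<Omega> u"
  shows "has_weak_gradient \<Omega> u (grad u)"
  unfolding has_weak_gradient_def
proof (intro conjI allI impI)
  note tu = test_function_facts[OF assms]
  fix K assume "compact K \<and> K \<subseteq> \<Omega>"
  then have K: "compact K" by simp
  have *: "set_integrable lebesgue K f" if "continuous_on UNIV f" for f :: "real^'a \<Rightarrow> 'b::euclidean_space"
  proof -
    have "integrable lborel (\<lambda>x. indicat_real K x *\<^sub>R f x)"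
      using K that by (intro borel_integrable_compact) (auto intro: continuous_on_subset)
    then show ?thesis by (simp add: integrable_completion set_integrable_def)
  qed
  show "set_integrable lebesgue K u" "set_integrable lebesgue K (grad u)"
    using *[OF tu(2)] *[OF tu(3)] by auto
next
  fix \<psi> i assume \<psi>: "test_function \<Omega> \<psi>"
  note tu = test_function_facts[OF assms]
  note tp = test_function_facts[OF \<psi>]
  obtain K where K: "compact K" "K \<subseteq> \<Omega>" "\<And>x. x \<notin> K \<Longrightarrow> \<psi> x = 0 \<and> grad \<psi> x = 0"
    using tp(4) by blast
  have d: "((\<lambda>x. u x * \<psi> x) has_derivative (\<lambda>h. u x * (grad \<psi> x \<bullet> h) + (grad u x \<bullet> h) * \<psi> x)) (at x)" for x
    by (intro has_derivative_mult C1_facts(3)[OF tu(1)] C1_facts(3)[OF tp(1)])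
  have g: "grad (\<lambda>x. u x * \<psi> x) x \<bullet> axis i 1 = u x * partial i \<psi> x + grad u x $ i * \<psi> x" for x
    using partial_eqI[OF d, of i x] by (simp add: grad_def inner_axis)
  have 0: "(LINT x|lebesgue. grad (\<lambda>x. u x * \<psi> x) x \<bullet> axis i 1) = 0"
    by (rule integral_directional_derivative_zero[OF _ K(1)])
       (rule C_k_on_mult[OF open_UNIV tu(1) tp(1)], use K(3) in simp)
  have pz: "partial i \<psi> x = 0" if "x \<notin> K" for x using K(3)[OF that] by (simp add: grad_def vec_eq_iff)
  have ci: "continuous_on UNIV (\<lambda>x. partial i \<psi> x)" "continuous_on UNIV (\<lambda>x. grad u x $ i)"
    using tp(1)[of "Suc 0"] tu(3) by (auto intro: continuous_intros)
  have i1: "integrable lebesgue (\<lambda>x. u x * partial i \<psi> x)"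
    by (rule integrable_continuous_compact_support[OF _ K(1)])
       (use pz in \<open>auto intro!: continuous_on_mult tu(2) ci\<close>)
  have i2: "integrable lebesgue (\<lambda>x. grad u x $ i * \<psi> x)"
    by (rule integrable_continuous_compact_support[OF _ K(1)])
       (use K(3) in \<open>auto intro!: continuous_on_mult tp(2) ci\<close>)
  have "(LINT x|lebesgue. u x * partial i \<psi> x) + (LINT x|lebesgue. grad u x $ i * \<psi> x) = 0"
    using 0 i1 i2 by (simp add: g)
  moreover have "(LINT x:\<Omega>|lebesgue. u x * partial i \<psi> x) = (LINT x|lebesgue. u x * partial i \<psi> x)"
    by (rule set_integral_eq_integral_support) (use K(2) pz in auto)
  moreover have "(LINT x:\<Omega>|lebesgue. grad u x $ i * \<psi> x) = (LINT x|lebesgue. grad u x $ i * \<psi> x)"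
    by (rule set_integral_eq_integral_support) (use K(2,3) in auto)
  ultimately show "(LINT x:\<Omega>|lebesgue. u x * partial i \<psi> x) = - (LINT x:\<Omega>|lebesgue. grad u x $ i * \<psi> x)"
    by simp
qed

lemma in_Lp_continuous_compact_support:
  fixes f :: "real^'n \<Rightarrow> 'b::euclidean_space"
  assumes "continuous_on UNIV f" "compact K" "\<And>x. x \<notin> K \<Longrightarrow> f x = 0" "0 < p" "open \<Omega>"
  shows "in_Lp p \<Omega> f"
proof -
  have "f \<in> borel_measurable borel" using assms(1) by (rule borel_measurable_continuous_onI)
  then have "f \<in> borel_measurable lebesgue" by (simp add: measurable_completion)
  then have "set_borel_measurable lebesgue \<Omega> f"
    using assms(5) unfolding set_borel_measurable_def by (intro borel_measurable_scaleR borel_measurable_indicator) auto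
  moreover have "integrable lebesgue (\<lambda>x. norm (f x) powr p)"
    using assms by (intro integrable_continuous_compact_support[OF _ assms(2)] continuous_on_powr' continuous_on_norm) auto
  then have "set_integrable lebesgue \<Omega> (\<lambda>x. norm (f x) powr p)"
    unfolding set_integrable_def using assms(5) by (intro integrable_mult_indicator) auto
  ultimately show ?thesis by (simp add: in_Lp_def)
qed

lemma test_function_in_Lp:
  assumes "test_function \<Omega> \<psi>" "0 < p" "open \<Omega>"
  shows "in_Lp p \<Omega> \<psi>" "in_Lp p \<Omega> (grad \<psi>)"
proof -
  note t = test_function_facts[OF assms(1)]
  obtain K where K: "compact K" "\<And>x. x \<notin> K \<Longrightarrow> \<psi> x = 0" "\<And>x. x \<notin> K \<Longrightarrow> grad \<psi> x = 0"
    using t(4) by blast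
  show "in_Lp p \<Omega> \<psi>" by (rule in_Lp_continuous_compact_support[OF t(2) K(1,2) assms(2,3)])
  show "in_Lp p \<Omega> (grad \<psi>)" by (rule in_Lp_continuous_compact_support[OF t(3) K(1,3) assms(2,3)])
qed

lemma test_function_in_W0:
  assumes "test_function \<Omega> \<psi>" "0 < p" "open \<Omega>"
  shows "\<psi> \<in> W0_1p p \<Omega>"
  unfolding W0_1p_def mem_Collect_eq
  using assms test_function_in_Lp[OF assms] has_weak_gradient_test_function[OF assms(1)]
  by (intro conjI exI[of _ "grad \<psi>"] exI[of _ "\<lambda>_. \<psi>"]) (simp_all add: set_lebesgue_integral_def)

text \<open>The eigenvalue is an infimum of a set of reals, and a lower bound of the set passes to
  its infimum only if the set is nonempty; a bump on a box inside \<open>\<Omega>\<close> is a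
  competitor.\<close>

lemma rayleigh_set_nonempty:
  fixes \<Omega> :: "(real^'n) set"
  assumes "open \<Omega>" "\<Omega> \<noteq> {}" "0 < p"
  shows "\<exists>u G. u \<in> W0_1p p \<Omega> \<and> has_weak_gradient \<Omega> u G \<and> \<not> (AE x in lebesgue. x \<in> \<Omega> \<longrightarrow> u x = 0)"
proof -
  obtain x where x: "x \<in> \<Omega>" using assms(2) by blast
  obtain a b where ab: "x \<in> box a b" "cbox a b \<subseteq> \<Omega>"
    using open_contains_cbox[OF assms(1) x] by metis
  define u :: "real^'n \<Rightarrow> real" where "u = box_bump 1 a b"
  have t: "test_function \<Omega> u" unfolding u_def by (rule test_function_box_bump[OF _ ab(2)]) simp
  have "\<not> (AE x in lebesgue. x \<in> \<Omega> \<longrightarrow> u x = 0)"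
  proof
    assume "AE x in lebesgue. x \<in> \<Omega> \<longrightarrow> u x = 0"
    then have "AE x in lebesgue. x \<notin> box a b"
    proof (eventually_elim)
      case (elim y)
      then show ?case using box_bump_pos_iff[of 1 a b y] ab(2) box_subset_cbox[of a b] by (auto simp: u_def)
    qed
    then have "box a b \<in> null_sets lebesgue" by (simp add: AE_iff_null_sets[of "box a b" lebesgue])
    then have "negligible (box a b)" by (simp add: negligible_iff_null_sets)
    then show False using ab(1) open_not_negligible[OF open_box, of a b] by blast
  qed
  then show ?thesis using test_function_in_W0[OF t assms(3,1)] has_weak_gradient_test_function[OF t] by blast
qed

text \<open>The positive and the negative part of f are densities of two measures that agree on all
  boxes. Boxes are stable under intersection and generate the Borel sets, so the measures coincide
  and with them, almost everywhere, the densities.\<close>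

lemma AE_zero_of_box_integrals:
  fixes f :: "'a::euclidean_space \<Rightarrow> real"
  assumes f: "integrable lebesgue f" and box: "\<And>a b. (LINT x:box a b|lebesgue. f x) = 0"
  shows "AE x in lebesgue. f x = 0"
proof -
  \<comment> \<open>The comparison of the two measures takes place on \<open>lborel\<close>, hence
    the Borel representative g.\<close>
  obtain g where g[measurable]: "g \<in> borel_measurable lborel" and fg: "AE x in lborel. f x = g x"
    using completion_ex_borel_measurable_real[of f lborel] f by auto
  have fg': "AE x in lebesgue. f x = g x" by (rule AE_completion[OF fg])
  have gm: "g \<in> borel_measurable lebesgue" using g by (rule measurable_completion)
  have "integrable lebesgue g" using integrable_cong_AE[of f lebesgue g] f fg' gm by simp
  then have gi: "integrable lborel g" by (simp add: integrable_completion)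
  have eq: "(\<integral>\<^sup>+x. ennreal (g x) * indicator (box a b) x \<partial>lborel) = (\<integral>\<^sup>+x. ennreal (- g x) * indicator (box a b) x \<partial>lborel)"
    and fin: "(\<integral>\<^sup>+x. ennreal (g x) * indicator (box a b) x \<partial>lborel) \<noteq> \<infinity>" for a b
  proof -
    define k where "k x = indicator (box a b) x * g x" for x
    have ki: "integrable lborel k"
      unfolding k_def using integrable_mult_indicator[OF _ gi, of "box a b"] by simp
    have "(LINT x|lebesgue. k x) = (LINT x:box a b|lebesgue. f x)"
      unfolding set_lebesgue_integral_def k_def
    proof (rule integral_cong_AE)
      show "AE x in lebesgue. indicator (box a b) x * g x = indicator (box a b) x *\<^sub>R f x"
        using fg' by eventually_elim simp
    qed (intro borel_measurable_times borel_measurable_scaleR borel_measurable_indicator gm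
          borel_measurable_integrable[OF f]; simp)+
    then have "(LINT x|lborel. k x) = 0" using box ki by (simp add: integral_completion)
    then have e: "enn2real (\<integral>\<^sup>+x. ennreal (k x) \<partial>lborel) = enn2real (\<integral>\<^sup>+x. ennreal (- k x) \<partial>lborel)"
      using real_lebesgue_integral_def[OF ki] by simp
    have n: "(\<integral>\<^sup>+x. ennreal (k x) \<partial>lborel) \<noteq> \<infinity>" "(\<integral>\<^sup>+x. ennreal (- k x) \<partial>lborel) \<noteq> \<infinity>"
      using ki by (auto simp: real_integrable_def)
    have r: "(\<integral>\<^sup>+x. ennreal (g x) * indicator (box a b) x \<partial>lborel) = (\<integral>\<^sup>+x. ennreal (k x) \<partial>lborel)"
      "(\<integral>\<^sup>+x. ennreal (- g x) * indicator (box a b) x \<partial>lborel) = (\<integral>\<^sup>+x. ennreal (- k x) \<partial>lborel)"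
      by (auto intro!: nn_integral_cong simp: k_def indicator_def)
    show "(\<integral>\<^sup>+x. ennreal (g x) * indicator (box a b) x \<partial>lborel) = (\<integral>\<^sup>+x. ennreal (- g x) * indicator (box a b) x \<partial>lborel)"
      unfolding r using e n by (metis ennreal_enn2real_if infinity_ennreal_def)
    show "(\<integral>\<^sup>+x. ennreal (g x) * indicator (box a b) x \<partial>lborel) \<noteq> \<infinity>" unfolding r by (rule n)
  qed
  have "density lborel (\<lambda>x. ennreal (g x)) = density lborel (\<lambda>x. ennreal (- g x))"
  proof (rule measure_eqI_generator_eq[where E="range (\<lambda>(a, b). box a b)" and \<Omega>=UNIV
        and A="\<lambda>i::nat. box (- (real i *\<^sub>R One)) (real i *\<^sub>R One)"])
    show "Int_stable (range (\<lambda>(a, b). box a b :: 'a set))"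
      by (auto simp: Int_stable_def box_Int_box)
    show "sets (density lborel (\<lambda>x. ennreal (g x))) = sigma_sets UNIV (range (\<lambda>(a, b). box a b))"
      "sets (density lborel (\<lambda>x. ennreal (- g x))) = sigma_sets UNIV (range (\<lambda>(a, b). box a b))"
      by (simp_all add: borel_eq_box)
    show "(\<Union>i::nat. box (- (real i *\<^sub>R One)) (real i *\<^sub>R One)) = (UNIV :: 'a set)"
      by (rule UN_box_eq_UNIV)
    fix X assume "X \<in> range (\<lambda>(a, b). box a b :: 'a set)"
    then obtain a b where X: "X = box a b" by auto
    show "emeasure (density lborel (\<lambda>x. ennreal (g x))) X = emeasure (density lborel (\<lambda>x. ennreal (- g x))) X"
      unfolding X using eq[of a b] by (simp add: emeasure_density)
  next
    fix i :: nat
    show "emeasure (density lborel (\<lambda>x. ennreal (g x))) (box (- (real i *\<^sub>R One)) (real i *\<^sub>R One)) \<noteq> \<infinity>"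
      using fin by (simp add: emeasure_density)
  qed auto
  moreover have "(\<integral>\<^sup>+x. ennreal (g x) \<partial>lborel) \<noteq> \<infinity>" using gi by (auto simp: real_integrable_def)
  \<comment> \<open>\<open>ennreal\<close> cuts negative values off to 0, so the two sides are the
    positive and the negative part of g; they are never both nonzero, and equality forces both to
    vanish.\<close>
  ultimately have "AE x in lborel. ennreal (g x) = ennreal (- g x)"
    using finite_density_unique[of "\<lambda>x. ennreal (g x)" lborel "\<lambda>x. ennreal (- g x)"] by simp
  then have "AE x in lborel. g x = 0"
  proof eventually_elim
    case (elim x)
    then show ?case by (cases "g x" "0::real" rule: linorder_cases) (auto simp: ennreal_neg)
  qed
  then have "AE x in lebesgue. g x = 0" by (rule AE_completion)
  with fg' show ?thesis by eventually_elim simp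
qed

text \<open>Fundamental lemma of the calculus of variations. Bumps converge to the indicator of a
  box while |f| on the closed box dominates, which gives vanishing integrals over boxes; a countable
  cover of \<open>\<Omega>\<close> by closed boxes reduces the claim to
  \<open>AE_zero_of_box_integrals\<close>.\<close>

lemma AE_zero_of_test_functions:
  fixes f :: "real^'n \<Rightarrow> real"
  assumes "open \<Omega>" and loc: "\<And>K. compact K \<Longrightarrow> K \<subseteq> \<Omega> \<Longrightarrow> set_integrable lebesgue K f"
    and test: "\<And>\<psi>. test_function \<Omega> \<psi> \<Longrightarrow> (LINT x:\<Omega>|lebesgue. f x * \<psi> x) = 0"
  shows "AE x in lebesgue. x \<in> \<Omega> \<longrightarrow> f x = 0"
proof -
  have box0: "(LINT x:box a b|lebesgue. f x) = 0" if sub: "cbox a b \<subseteq> \<Omega>" for a b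
  proof -
    have fi: "integrable lebesgue (\<lambda>x. indicator (cbox a b) x * f x)"
      using loc[OF compact_cbox sub] by (simp add: set_integrable_def)
    define s where "s m x = indicator (cbox a b) x * f x * box_bump (real (Suc m)) a b x" for m x
    have bm: "box_bump m a b \<in> borel_measurable lebesgue" for m
    proof -
      have "box_bump m a b \<in> borel_measurable borel"
        using C_k_on_box_bump[of 0 m a b] by (intro borel_measurable_continuous_onI) simp
      then show ?thesis by (simp add: measurable_completion)
    qed
    have "(\<lambda>m. LINT x|lebesgue. s m x) \<longlonglongrightarrow> (LINT x|lebesgue. indicator (cbox a b) x * f x * indicator (box a b) x)"
    proof (rule integral_dominated_convergence[where w="\<lambda>x. norm (indicator (cbox a b) x * f x)"])
      show "(\<lambda>x. indicator (cbox a b) x * f x * indicator (box a b) x) \<in> borel_measurable lebesgue"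
        by (rule borel_measurable_times[OF borel_measurable_integrable[OF fi] borel_measurable_indicator]) simp
      show "s m \<in> borel_measurable lebesgue" for m
        unfolding s_def by (rule borel_measurable_times[OF borel_measurable_integrable[OF fi] bm])
      show "integrable lebesgue (\<lambda>x. norm (indicator (cbox a b) x * f x))" using fi by (rule integrable_norm)
      show "AE x in lebesgue. (\<lambda>m. s m x) \<longlonglongrightarrow> indicator (cbox a b) x * f x * indicator (box a b) x"
      proof (rule AE_I2)
        fix x
        have "(\<lambda>m. box_bump (real (Suc m)) a b x) \<longlonglongrightarrow> indicator (box a b) x"
          using LIMSEQ_Suc[OF box_bump_tendsto[of a b x]] .
        then show "(\<lambda>m. s m x) \<longlonglongrightarrow> indicator (cbox a b) x * f x * indicator (box a b) x"
          unfolding s_def by (intro tendsto_intros)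
      qed
      show "AE x in lebesgue. norm (s m x) \<le> norm (indicator (cbox a b) x * f x)" for m
      proof (rule AE_I2)
        fix x
        have "norm (s m x) = norm (indicator (cbox a b) x * f x) * box_bump (real (Suc m)) a b x"
          using box_bump_bounds(1)[of "real (Suc m)" a b x] by (simp only: s_def real_norm_def abs_mult[of _ "box_bump (real (Suc m)) a b x"] abs_of_nonneg)
        also have "\<dots> \<le> norm (indicator (cbox a b) x * f x) * 1"
          by (intro mult_left_mono box_bump_bounds) auto
        finally show "norm (s m x) \<le> norm (indicator (cbox a b) x * f x)" by simp
      qed
    qed
    moreover have "(LINT x|lebesgue. s m x) = 0" for m
    proof -
      have z: "box_bump (real (Suc m)) a b x = 0" if "x \<notin> box a b" for x
        using that by (intro box_bump_outside) auto
      have "(LINT x:\<Omega>|lebesgue. f x * box_bump (real (Suc m)) a b x) = 0"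
        by (intro test test_function_box_bump sub) auto
      moreover have "indicator \<Omega> x *\<^sub>R (f x * box_bump (real (Suc m)) a b x) = s m x" for x
        using z[of x] sub box_subset_cbox[of a b] by (auto simp: s_def indicator_def)
      ultimately show ?thesis by (simp add: set_lebesgue_integral_def)
    qed
    ultimately have "(LINT x|lebesgue. indicator (cbox a b) x * f x * indicator (box a b) x) = 0"
      by (simp add: LIMSEQ_const_iff)
    moreover have "indicator (cbox a b) x * f x * indicator (box a b) x = indicator (box a b) x *\<^sub>R f x" for x
      using box_subset_cbox[of a b] by (auto simp: indicator_def)
    ultimately show ?thesis by (simp add: set_lebesgue_integral_def)
  qed
  obtain D where D: "countable D" "D \<subseteq> Pow \<Omega>" "\<And>X. X \<in> D \<Longrightarrow> \<exists>a b. X = cbox a b" "\<Union> D = \<Omega>"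
    using open_countable_Union_open_cbox[OF assms(1)] by metis
  have "AE x in lebesgue. x \<in> X \<longrightarrow> f x = 0" if XD: "X \<in> D" for X
  proof -
    obtain c d where X: "X = cbox c d" using D(3)[OF XD] by blast
    have sub: "cbox c d \<subseteq> \<Omega>" using D(2) XD X by auto
    define k where "k x = indicator (box c d) x * f x" for x
    have fi: "integrable lebesgue (\<lambda>x. indicator (cbox c d) x * f x)"
      using loc[OF compact_cbox sub] by (simp add: set_integrable_def)
    have "integrable lebesgue (\<lambda>x. indicator (box c d) x *\<^sub>R (indicator (cbox c d) x * f x))"
      by (rule integrable_mult_indicator[OF _ fi]) simp
    moreover have "indicator (box c d) x *\<^sub>R (indicator (cbox c d) x * f x) = k x" for x
      using box_subset_cbox[of c d] by (auto simp: k_def indicator_def)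
    ultimately have ki: "integrable lebesgue k" by simp
    have "AE x in lebesgue. k x = 0"
    proof (rule AE_zero_of_box_integrals[OF ki])
      fix a b
      obtain a' b' where ab: "box a b \<inter> box c d = box a' b'" unfolding box_Int_box by blast
      have "(LINT x:box a b|lebesgue. k x) = (LINT x:box a' b'|lebesgue. f x)"
        unfolding set_lebesgue_integral_def ab[symmetric] k_def
        by (intro Bochner_Integration.integral_cong) (auto simp: indicator_def)
      also have "\<dots> = 0"
      \<comment> \<open>A nonempty open box has the closed box as its closure, which therefore stays
        inside \<open>cbox c d\<close>; for an empty one \<open>cbox a' b'\<close> could lie
        elsewhere.\<close>
      proof (cases "box a' b' = {}")
        case False
        then have "cbox a' b' = closure (box a b \<inter> box c d)" by (simp add: ab closure_box)
        also have "\<dots> \<subseteq> cbox c d"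
          using box_subset_cbox[of c d] by (intro closure_minimal) auto
        finally show ?thesis using box0 sub by auto
      qed (simp add: set_lebesgue_integral_def)
      finally show "(LINT x:box a b|lebesgue. k x) = 0" .
    qed
    moreover have "AE x in lebesgue. x \<notin> cbox c d - box c d"
      using negligible_frontier_interval[of c d] by (intro AE_not_in) (simp add: negligible_iff_null_sets)
    ultimately show ?thesis unfolding X
      by eventually_elim (auto simp: k_def indicator_def)
  qed
  then have "AE x in lebesgue. \<forall>X\<in>D. x \<in> X \<longrightarrow> f x = 0"
    by (intro AE_ball_countable[THEN iffD2] D(1)) auto
  then show ?thesis by eventually_elim (use D(4) in auto)
qed

text \<open>The Rayleigh quotient may be formed with any weak gradient of u, whereas membership in
  \<open>W0_1p\<close> supplies one of its own, approximated by gradients of test functions. The two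
  have to be identified.\<close>

lemma weak_gradient_unique:
  assumes "open \<Omega>" "has_weak_gradient \<Omega> u G" "has_weak_gradient \<Omega> u H"
  shows "AE x in lebesgue. x \<in> \<Omega> \<longrightarrow> G x = H x"
proof -
  have comp: "set_integrable lebesgue K (\<lambda>x. G x $ i)" if "set_integrable lebesgue K G" for K i and G :: "real^'a \<Rightarrow> real^'a"
    using integrable_inner_left[of "axis i 1" lebesgue "\<lambda>x. indicator K x *\<^sub>R G x"] that
    by (simp add: set_integrable_def inner_axis)
  note G1 = conjunct1[OF assms(2)[unfolded has_weak_gradient_def]]
    and G2 = conjunct2[OF assms(2)[unfolded has_weak_gradient_def]]
    and H1 = conjunct1[OF assms(3)[unfolded has_weak_gradient_def]]
    and H2 = conjunct2[OF assms(3)[unfolded has_weak_gradient_def]]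
  have loc: "set_integrable lebesgue K (\<lambda>x. G x $ i)" "set_integrable lebesgue K (\<lambda>x. H x $ i)"
    if "compact K" "K \<subseteq> \<Omega>" for K i
    by (rule comp, use G1 that in blast, rule comp, use H1 that in blast)
  have "AE x in lebesgue. x \<in> \<Omega> \<longrightarrow> G x $ i - H x $ i = 0" for i
  proof (rule AE_zero_of_test_functions[OF assms(1)])
    fix \<psi> assume \<psi>: "test_function \<Omega> \<psi>"
    obtain K where K: "compact K" "K \<subseteq> \<Omega>" "\<And>x. x \<notin> K \<Longrightarrow> \<psi> x = 0"
      using \<psi> by (auto simp: test_function_def)
    have c: "continuous_on UNIV \<psi>" by (rule test_function_facts(2)[OF \<psi>])
    have "bounded (\<psi> ` K)"
      by (intro compact_imp_bounded compact_continuous_image K(1) continuous_on_subset[OF c]) simp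
    then obtain B where B: "\<And>x. x \<in> K \<Longrightarrow> \<bar>\<psi> x\<bar> \<le> B" by (auto simp: bounded_iff)
    have pm: "\<psi> \<in> borel_measurable lebesgue"
      using c by (simp add: borel_measurable_continuous_onI measurable_completion)
    have int: "integrable lebesgue (\<lambda>x. indicator \<Omega> x * (k x * \<psi> x))"
      if k: "set_integrable lebesgue K k" for k :: "real^'a \<Rightarrow> real"
    proof -
      have k': "integrable lebesgue (\<lambda>x. indicator K x * k x)" using k by (simp add: set_integrable_def)
      have "integrable lebesgue (\<lambda>x. (indicator K x * k x) * \<psi> x)"
      proof (rule Bochner_Integration.integrable_bound)
        show "integrable lebesgue (\<lambda>x. (indicator K x * k x) * B)" using k' by simp
        show "(\<lambda>x. (indicator K x * k x) * \<psi> x) \<in> borel_measurable lebesgue"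
          using borel_measurable_integrable[OF k'] pm by (rule borel_measurable_times)
        show "AE x in lebesgue. norm ((indicator K x * k x) * \<psi> x) \<le> norm ((indicator K x * k x) * B)"
        proof (rule AE_I2)
          fix x show "norm ((indicator K x * k x) * \<psi> x) \<le> norm ((indicator K x * k x) * B)"
            using B[of x] by (cases "x \<in> K") (auto simp: abs_mult intro!: mult_left_mono)
        qed
      qed
      moreover have "(indicator K x * k x) * \<psi> x = indicator \<Omega> x * (k x * \<psi> x)" for x
        using K(2,3) by (auto simp: indicator_def)
      ultimately show ?thesis by simp
    qed
    have "(LINT x:\<Omega>|lebesgue. G x $ i * \<psi> x) = (LINT x:\<Omega>|lebesgue. H x $ i * \<psi> x)"
      using G2[rule_format, OF \<psi>, of i] H2[rule_format, OF \<psi>, of i] by linarith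
    then show "(LINT x:\<Omega>|lebesgue. (G x $ i - H x $ i) * \<psi> x) = 0"
      using int[OF loc(1)[OF K(1,2), of i]] int[OF loc(2)[OF K(1,2), of i]]
      by (simp add: set_lebesgue_integral_def left_diff_distrib right_diff_distrib)
  next
    show "set_integrable lebesgue K (\<lambda>x. G x $ i - H x $ i)" if "compact K" "K \<subseteq> \<Omega>" for K
      using loc[OF that] by (intro set_integral_diff)
  qed
  then have "AE x in lebesgue. \<forall>i\<in>UNIV. x \<in> \<Omega> \<longrightarrow> G x $ i - H x $ i = 0"
    by (intro AE_finite_allI) auto
  then show ?thesis by eventually_elim (auto simp: vec_eq_iff)
qed

lemma rayleigh_quotient_bound:
  fixes F :: "real^'n \<Rightarrow> real" and \<Omega> :: "(real^'n) set"
  assumes p: "1 < p" and \<Omega>: "open \<Omega>" and L: "0 \<le> L" and "0 \<le> C"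
    and F: "continuous_on UNIV F" "\<And>x. 0 \<le> F x" "\<And>x y. F (x + y) \<le> F x + F y" "\<And>x. F x \<le> C * norm x"
    and ineq: "\<And>\<phi>. test_function \<Omega> \<phi> \<Longrightarrow>
       L * (LINT x:\<Omega>|lebesgue. \<bar>\<phi> x\<bar> powr p) \<le> (LINT x:\<Omega>|lebesgue. F (grad \<phi> x) powr p)"
    and u: "u \<in> W0_1p p \<Omega>" "has_weak_gradient \<Omega> u G" "\<not> (AE x in lebesgue. x \<in> \<Omega> \<longrightarrow> u x = 0)"
  shows "L \<le> (LINT x:\<Omega>|lebesgue. F (G x) powr p) / (LINT x:\<Omega>|lebesgue. \<bar>u x\<bar> powr p)"
proof -
  define M where "M = lebesgue_on \<Omega>"
  have \<Omega>s: "\<Omega> \<inter> space lebesgue \<in> sets lebesgue" using \<Omega> by simp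
  have LI: "(LINT x:\<Omega>|lebesgue. f x) = (LINT x|M. f x)" for f :: "real^'n \<Rightarrow> real"
    unfolding M_def set_lebesgue_integral_def by (rule integral_restrict_space[OF \<Omega>s, symmetric])
  have II: "set_integrable lebesgue \<Omega> f \<longleftrightarrow> integrable M f" for f :: "real^'n \<Rightarrow> real"
    unfolding M_def set_integrable_def by (rule integrable_restrict_space[OF \<Omega>s, symmetric])
  have MI: "set_borel_measurable lebesgue \<Omega> f \<longleftrightarrow> f \<in> borel_measurable M" for f :: "real^'n \<Rightarrow> 'z::euclidean_space"
    unfolding M_def set_borel_measurable_def by (rule borel_measurable_restrict_space_iff[OF \<Omega>s, symmetric])
  obtain H \<phi> where H: "in_Lp p \<Omega> u" "has_weak_gradient \<Omega> u H" "in_Lp p \<Omega> H" "\<And>n. test_function \<Omega> (\<phi> n)"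
    "(\<lambda>n. LINT x|M. \<bar>\<phi> n x - u x\<bar> powr p) \<longlonglongrightarrow> 0"
    "(\<lambda>n. LINT x|M. norm (grad (\<phi> n) x - H x) powr p) \<longlonglongrightarrow> 0"
    using u(1) unfolding W0_1p_def LI by blast
  have p0: "0 < p" using p by simp
  note tl = test_function_in_Lp[OF H(4) p0 \<Omega>, unfolded in_Lp_def MI II]
  have main: "L * (LINT x|M. \<bar>u x\<bar> powr p) \<le> (LINT x|M. F (H x) powr p)"
  proof (rule Lp_limit_inequality[OF p L assms(4) F, where \<phi>=\<phi> and D="\<lambda>n. grad (\<phi> n)"])
    show "L * (LINT x|M. \<bar>\<phi> n x\<bar> powr p) \<le> (LINT x|M. F (grad (\<phi> n) x) powr p)" for n
      using ineq[OF H(4)[of n]] unfolding LI .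
  qed (use H tl in \<open>auto simp: in_Lp_def MI II\<close>)
  have "AE x in lebesgue. x \<in> \<Omega> \<longrightarrow> G x = H x" by (rule weak_gradient_unique[OF \<Omega> u(2) H(2)])
  then have "(LINT x:\<Omega>|lebesgue. F (G x) powr p) = (LINT x:\<Omega>|lebesgue. F (H x) powr p)"
  proof -
    have HM: "H \<in> borel_measurable M" using H(3) by (simp add: in_Lp_def MI)
    have FM: "F \<in> borel_measurable borel" using F(1) by (rule borel_measurable_continuous_onI)
    have "(\<lambda>x. F (H x) powr p) \<in> borel_measurable M"
      using HM FM by measurable
    then have m: "(\<lambda>x. indicator \<Omega> x *\<^sub>R (F (H x) powr p)) \<in> borel_measurable lebesgue"
      unfolding M_def by (simp only: borel_measurable_restrict_space_iff[OF \<Omega>s])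
    have ae: "AE x in lebesgue. indicator \<Omega> x *\<^sub>R (F (H x) powr p) = indicator \<Omega> x *\<^sub>R (F (G x) powr p)"
      using \<open>AE x in lebesgue. x \<in> \<Omega> \<longrightarrow> G x = H x\<close> by eventually_elim (auto simp: indicator_def)
    \<comment> \<open>G is given as integrable on compact subsets of \<open>\<Omega>\<close>;
      measurability on \<open>\<Omega>\<close> is inherited from H.\<close>
    have "(\<lambda>x. indicator \<Omega> x *\<^sub>R (F (G x) powr p)) \<in> borel_measurable lebesgue"
      by (rule borel_measurable_AE[OF m ae])
    then show ?thesis unfolding set_lebesgue_integral_def
      using m ae by (intro integral_cong_AE) auto
  qed
  moreover have "0 < (LINT x|M. \<bar>u x\<bar> powr p)"
  proof -
    have i: "integrable M (\<lambda>x. \<bar>u x\<bar> powr p)" using H(1) by (simp add: in_Lp_def II)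
    have "(LINT x|M. \<bar>u x\<bar> powr p) \<noteq> 0"
    proof
      assume "(LINT x|M. \<bar>u x\<bar> powr p) = 0"
      then have "AE x in M. \<bar>u x\<bar> powr p = 0"
        using integral_nonneg_eq_0_iff_AE[OF i] by simp
      then have "AE x in lebesgue. x \<in> \<Omega> \<longrightarrow> \<bar>u x\<bar> powr p = 0"
        unfolding M_def using \<Omega>s by (simp add: AE_restrict_space_iff)
      then have "AE x in lebesgue. x \<in> \<Omega> \<longrightarrow> u x = 0" by eventually_elim auto
      with u(3) show False by simp
    qed
    moreover have "0 \<le> (LINT x|M. \<bar>u x\<bar> powr p)" by (intro integral_nonneg_AE) simp
    ultimately show ?thesis by linarith
  qed
  ultimately show ?thesis using main by (simp add: LI field_simps)
qed

section \<open>Boundary charts and defining functions\<close>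

text \<open>In contrast to \<open>C_k_boundary\<close> the graph function is constant along
  \<open>e\<close> instead of being evaluated at the projected point. All calculus then takes place
  on the whole space, without splitting off a hyperplane.\<close>

definition boundary_chart :: "(real^'n) set \<Rightarrow> real^'n \<Rightarrow> real \<Rightarrow> real^'n \<Rightarrow> (real^'n \<Rightarrow> real) \<Rightarrow> bool" where
  "boundary_chart \<Omega> x r e \<gamma> \<longleftrightarrow> 0 < r \<and> norm e = 1 \<and> C_k_on 2 UNIV \<gamma> \<and>
     (\<forall>y t. \<gamma> (y + t *\<^sub>R e) = \<gamma> y) \<and> (\<forall>y\<in>ball x r. y \<in> \<Omega> \<longleftrightarrow> \<gamma> y < y \<bullet> e)"

lemma ex_boundary_chart:
  fixes \<Omega> :: "(real^'n) set"
  assumes "C_k_boundary 2 \<Omega>" "x \<in> frontier \<Omega>"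
  shows "\<exists>r e \<gamma>. boundary_chart \<Omega> x r e \<gamma>"
proof -
  obtain r e \<gamma> where *: "r > 0" "norm e = 1" "C_k_on 2 UNIV \<gamma>"
    "\<Omega> \<inter> ball x r = {y \<in> ball x r. y \<bullet> e > \<gamma> (y - (y \<bullet> e) *\<^sub>R e)}"
    using assms unfolding C_k_boundary_def by blast
  have ee: "e \<bullet> e = 1" using *(2) by (simp add: dot_square_norm)
  define \<gamma>' where "\<gamma>' y = \<gamma> (y - (y \<bullet> e) *\<^sub>R e)" for y
  have "linear (\<lambda>y. y - (y \<bullet> e) *\<^sub>R e)"
    by (auto simp: linear_iff inner_add_left algebra_simps)
  from C_k_on_compose_linear[OF this *(3)] have "C_k_on 2 UNIV \<gamma>'" by (simp add: \<gamma>'_def[abs_def])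
  moreover have "\<gamma>' (y + t *\<^sub>R e) = \<gamma>' y" for y t
    by (simp add: \<gamma>'_def inner_add_left ee algebra_simps)
  moreover have "y \<in> \<Omega> \<longleftrightarrow> \<gamma>' y < y \<bullet> e" if "y \<in> ball x r" for y
    using *(4) that unfolding \<gamma>'_def by blast
  ultimately have "boundary_chart \<Omega> x r e \<gamma>'" using *(1,2) by (simp add: boundary_chart_def)
  then show ?thesis by blast
qed

lemma boundary_chart_continuous: "boundary_chart \<Omega> x r e \<gamma> \<Longrightarrow> continuous_on UNIV \<gamma>"
  using C_k_on_imp_continuous_on unfolding boundary_chart_def by blast

lemma boundary_chart_frontier:
  assumes "boundary_chart \<Omega> x r e \<gamma>" "open \<Omega>" "y \<in> ball x r"
  shows "y \<in> frontier \<Omega> \<longleftrightarrow> \<gamma> y = y \<bullet> e" and "y \<in> closure \<Omega> \<Longrightarrow> \<gamma> y \<le> y \<bullet> e"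
proof -
  note c = assms(1)[unfolded boundary_chart_def]
  have cont: "continuous_on UNIV (\<lambda>z. z \<bullet> e - \<gamma> z)"
    by (intro continuous_intros boundary_chart_continuous[OF assms(1)])
  have ee: "e \<bullet> e = 1" using c by (simp add: dot_square_norm)
  show le: "\<gamma> y \<le> y \<bullet> e" if "y \<in> closure \<Omega>"
  proof (rule ccontr)
    assume "\<not> \<gamma> y \<le> y \<bullet> e"
    define U where "U = ball x r \<inter> {z. z \<bullet> e - \<gamma> z < 0}"
    have "open U" unfolding U_def
      by (intro open_Int open_ball open_Collect_less cont continuous_intros)
    moreover have "y \<in> U" using assms(3) \<open>\<not> \<gamma> y \<le> y \<bullet> e\<close> by (simp add: U_def)
    ultimately have "U \<inter> \<Omega> \<noteq> {}" using that by (metis closure_iff_nhds_not_empty IntI Int_commute order_refl)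
    then show False using c by (auto simp: U_def)
  qed
  show "y \<in> frontier \<Omega> \<longleftrightarrow> \<gamma> y = y \<bullet> e"
  proof
    assume "y \<in> frontier \<Omega>"
    then have "y \<in> closure \<Omega>" "y \<notin> \<Omega>" using assms(2) by (auto simp: frontier_def interior_open)
    with le c assms(3) show "\<gamma> y = y \<bullet> e" by force
  next
    assume eq: "\<gamma> y = y \<bullet> e"
    then have "y \<notin> \<Omega>" using c assms(3) by auto
    moreover have "y \<in> closure \<Omega>"
    proof -
      have lim: "(\<lambda>n. y + inverse (real (Suc n)) *\<^sub>R e) \<longlonglongrightarrow> y + 0 *\<^sub>R e"
        by (intro tendsto_intros LIMSEQ_inverse_real_of_nat)
      then have "\<forall>\<^sub>F n in sequentially. y + inverse (real (Suc n)) *\<^sub>R e \<in> ball x r"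
        using assms(3) by (intro topological_tendstoD) auto
      then have "\<forall>\<^sub>F n in sequentially. y + inverse (real (Suc n)) *\<^sub>R e \<in> \<Omega>"
      proof eventually_elim
        case (elim n)
        have "\<gamma> (y + inverse (real (Suc n)) *\<^sub>R e) < (y + inverse (real (Suc n)) *\<^sub>R e) \<bullet> e"
          using c eq ee by (simp add: inner_add_left)
        then show ?case using c elim by blast
      qed
      then have "\<forall>\<^sub>F n in sequentially. y + inverse (real (Suc n)) *\<^sub>R e \<in> closure \<Omega>"
        by eventually_elim (use closure_subset in blast)
      then show ?thesis using lim Lim_in_closed_set[OF closed_closure _ sequentially_bot] by simp
    qed
    ultimately show "y \<in> frontier \<Omega>" using assms(2) by (simp add: frontier_def interior_open)
  qed
qed

text \<open>\<open>aniso_mean_curvature\<close> uses a defining function picked by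
  \<open>SOME\<close>, so it has the intended meaning only if there is one. The heights
  \<open>y \<bullet> e - \<gamma> y\<close> of finitely many charts are cut off by bumps and added,
  together with bumps on boxes that cover the rest of \<open>\<Omega>\<close>; every summand is
  nonnegative in \<open>\<Omega>\<close> and zero on the boundary.\<close>

lemma ex_C2_defining_function:
  fixes \<Omega> :: "(real^'n) set"
  assumes "open \<Omega>" "bounded \<Omega>" "C_k_boundary 2 \<Omega>"
  shows "\<exists>g. C2_defining_function \<Omega> g"
proof -
  have "\<exists>r e \<gamma> a b. boundary_chart \<Omega> x r e \<gamma> \<and> x \<in> box a b \<and> cbox a b \<subseteq> ball x r" if xf: "x \<in> frontier \<Omega>" for x
  proof -
    obtain r e \<gamma> where c: "boundary_chart \<Omega> x r e \<gamma>" using ex_boundary_chart[OF assms(3) xf] by blast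
    then have "x \<in> ball x r" by (simp add: boundary_chart_def)
    then obtain a b where "cbox a b \<subseteq> ball x r" "x \<in> box a b" using open_contains_cbox[OF open_ball] by metis
    with c show ?thesis by blast
  qed
  then obtain r e \<gamma> a b where ch: "\<And>x. x \<in> frontier \<Omega> \<Longrightarrow> boundary_chart \<Omega> x (r x) (e x) (\<gamma> x)"
    and ab: "\<And>x. x \<in> frontier \<Omega> \<Longrightarrow> x \<in> box (a x) (b x)" "\<And>x. x \<in> frontier \<Omega> \<Longrightarrow> cbox (a x) (b x) \<subseteq> ball x (r x)"
    by metis
  have cl: "compact (closure \<Omega>)" using assms(2) by simp
  have fr: "compact (frontier \<Omega>)" using assms(2) by (rule compact_frontier_bounded)
  obtain D where D: "D \<subseteq> frontier \<Omega>" "finite D" "frontier \<Omega> \<subseteq> (\<Union>x\<in>D. box (a x) (b x))"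
    using compactE_image[OF fr, of "frontier \<Omega>" "\<lambda>x. box (a x) (b x)"] ab(1) open_box by blast
  define K where "K = closure \<Omega> - (\<Union>x\<in>D. box (a x) (b x))"
  have K: "compact K" unfolding K_def by (intro compact_diff cl open_UN) auto
  have K\<Omega>: "K \<subseteq> \<Omega>" using D(3) assms(1) by (auto simp: K_def frontier_def interior_open)
  have "\<exists>c d. x \<in> box c d \<and> cbox c d \<subseteq> \<Omega>" if "x \<in> K" for x
    using open_contains_cbox[OF assms(1), of x] that K\<Omega> by (metis subsetD)
  then obtain c d where cd: "\<And>x. x \<in> K \<Longrightarrow> x \<in> box (c x) (d x)" "\<And>x. x \<in> K \<Longrightarrow> cbox (c x) (d x) \<subseteq> \<Omega>"
    by metis
  obtain E where E: "E \<subseteq> K" "finite E" "K \<subseteq> (\<Union>x\<in>E. box (c x) (d x))"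
    using compactE_image[OF K, of K "\<lambda>x. box (c x) (d x)"] cd(1) open_box by blast
  define h where "h x y = box_bump 1 (a x) (b x) y * (y \<bullet> e x - \<gamma> x y)" for x y
  define k where "k x y = box_bump 1 (c x) (d x) y" for x y
  define g where "g y = (\<Sum>x\<in>D. h x y) + (\<Sum>x\<in>E. k x y)" for y
  have C\<gamma>: "C_k_on 2 UNIV (\<lambda>y. y \<bullet> e x - \<gamma> x y)" if "x \<in> D" for x
  proof -
    have "C_k_on 2 UNIV (\<gamma> x)" using ch[of x] that D(1) by (auto simp: boundary_chart_def)
    then have "C_k_on 2 UNIV (\<lambda>y. y \<bullet> e x + (-1) * \<gamma> x y)"
      by (intro C_k_on_add C_k_on_mult C_k_on_const C_k_on_inner open_UNIV)
    then show ?thesis by simp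
  qed
  have Cg: "C_k_on 2 UNIV g"
    unfolding g_def[abs_def] h_def k_def
    by (intro C_k_on_add C_k_on_sum C_k_on_mult C_k_on_box_bump C\<gamma> open_UNIV)
  have bz: "box_bump 1 a b y = 0" if "y \<notin> box a b" for a b y :: "real^'n"
    by (rule box_bump_outside[OF _ that]) simp
  have bp: "0 < box_bump 1 a b y" if "y \<in> box a b" for a b y :: "real^'n"
    using box_bump_pos_iff[of 1 a b y] that by simp
  have inball: "y \<in> ball x (r x)" if "x \<in> D" "y \<in> box (a x) (b x)" for x y
    using ab(2)[of x] that D(1) box_subset_cbox[of "a x" "b x"] by blast
  have hpos: "0 < h x y" if "x \<in> D" "y \<in> box (a x) (b x)" "y \<in> \<Omega>" for x y
    using ch[of x] inball[OF that(1,2)] that D(1) bp[OF that(2)] by (auto simp: boundary_chart_def h_def)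
  have hz: "h x y = 0" if "y \<notin> box (a x) (b x)" for x y using bz[OF that] by (simp add: h_def)
  have hnn: "0 \<le> h x y" if "x \<in> D" "y \<in> \<Omega>" for x y
    using hpos[OF that(1) _ that(2)] hz[of y x] by (cases "y \<in> box (a x) (b x)") auto
  have knn: "0 \<le> k x y" for x y by (simp add: k_def box_bump_bounds)
  have gpos: "0 < g y" if y: "y \<in> \<Omega>" for y
  proof (cases "\<exists>x\<in>D. y \<in> box (a x) (b x)")
    case True
    then obtain x where "x \<in> D" "y \<in> box (a x) (b x)" by blast
    then have "0 < (\<Sum>x\<in>D. h x y)" using hpos y hnn D(2) by (intro sum_pos2[where i=x]) auto
    then show ?thesis using sum_nonneg[of E "\<lambda>x. k x y"] knn by (simp add: g_def add_pos_nonneg)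
  next
    case False
    then have "y \<in> K" using y closure_subset by (auto simp: K_def)
    then obtain x where "x \<in> E" "y \<in> box (c x) (d x)" using E by blast
    then have "0 < (\<Sum>x\<in>E. k x y)" using bp knn E(2) by (intro sum_pos2[where i=x]) (auto simp: k_def)
    then show ?thesis using sum_nonneg[of D "\<lambda>x. h x y"] hnn y by (simp add: g_def add_nonneg_pos)
  qed
  have gz: "g y = 0" if y: "y \<in> frontier \<Omega>" for y
  proof -
    have "h x y = 0" if "x \<in> D" for x
    proof (cases "y \<in> box (a x) (b x)")
      case True
      have "x \<in> frontier \<Omega>" using that D(1) by blast
      then show ?thesis using boundary_chart_frontier(1)[OF ch assms(1) inball[OF that True]] y
        by (simp add: h_def)
    qed (rule hz)
    moreover have "k x y = 0" if "x \<in> E" for x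
    proof -
      have "y \<notin> \<Omega>" using y assms(1) by (auto simp: frontier_def interior_open)
      then have "y \<notin> box (c x) (d x)" using cd(2)[of x] that E(1) box_subset_cbox[of "c x" "d x"] by blast
      then show ?thesis by (simp add: k_def bz)
    qed
    ultimately show ?thesis by (simp add: g_def)
  qed
  have gg: "grad g y \<noteq> 0" if y: "y \<in> frontier \<Omega>" for y
  proof -
    obtain x where x: "x \<in> D" "y \<in> box (a x) (b x)" using D(3) y by blast
    have xf: "x \<in> frontier \<Omega>" using x D(1) by blast
    note cx = ch[OF xf, unfolded boundary_chart_def]
    have ee: "e x \<bullet> e x = 1" using cx by (simp add: dot_square_norm)
    have yx: "\<gamma> x y = y \<bullet> e x"
      using boundary_chart_frontier(1)[OF ch[OF xf] assms(1) inball[OF x]] y by simp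
    define q where "q = (\<lambda>t. y + t *\<^sub>R e x)"
    have lim: "((\<lambda>t. q t) \<longlongrightarrow> y) (at_right 0)"
      unfolding q_def by (auto intro!: tendsto_eq_intros)
    have "((\<lambda>t. g (q t)) has_derivative (\<lambda>h. grad g y \<bullet> (h *\<^sub>R e x))) (at 0)"
      unfolding q_def by (rule has_derivative_compose[where g=g])
        (use C2_derivatives(1)[OF open_UNIV Cg, of y] in \<open>auto intro!: derivative_eq_intros\<close>)
    then have "((\<lambda>t. g (q t)) has_real_derivative grad g y \<bullet> e x) (at 0)"
      unfolding has_field_derivative_def by (rule has_derivative_eq_rhs) (simp add: fun_eq_iff mult.commute)
    then have "((\<lambda>t. g (q t) / t) \<longlongrightarrow> grad g y \<bullet> e x) (at 0)"
      using gz[OF y] by (simp add: has_field_derivative_iff q_def)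
    then have l1: "((\<lambda>t. g (q t) / t) \<longlongrightarrow> grad g y \<bullet> e x) (at_right 0)"
      by (rule filterlim_mono) (auto simp: at_le)
    have cb: "continuous_on UNIV (box_bump 1 (a x) (b x))"
      using C_k_on_box_bump[of 0] by simp
    have l2: "((\<lambda>t. box_bump 1 (a x) (b x) (q t)) \<longlongrightarrow> box_bump 1 (a x) (b x) y) (at_right 0)"
      by (rule continuous_on_tendsto_compose[OF cb lim]) auto
    have "\<forall>\<^sub>F t in at_right 0. q t \<in> ball x (r x)"
      using lim inball[OF x] by (intro topological_tendstoD) auto
    \<comment> \<open>Above y the height over the graph is exactly t, and the other summands of g
      are nonnegative, so the slope of g in direction \<open>e x\<close> is at least the positive
      value of the bump at y.\<close>
    then have "\<forall>\<^sub>F t in at_right 0. box_bump 1 (a x) (b x) (q t) \<le> g (q t) / t"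
      using eventually_at_right_less[of "0::real"]
    proof eventually_elim
      case (elim t)
      have t: "q t \<bullet> e x - \<gamma> x (q t) = t" using cx yx ee by (simp add: q_def inner_add_left)
      then have q\<Omega>: "q t \<in> \<Omega>" using elim cx by auto
      have "h x (q t) \<le> (\<Sum>x\<in>D. h x (q t))"
        by (rule member_le_sum[OF x(1) _ D(2)]) (use hnn q\<Omega> in auto)
      also have "\<dots> \<le> g (q t)" using sum_nonneg[of E "\<lambda>x. k x (q t)"] knn by (simp add: g_def)
      finally show ?case using elim t by (simp add: h_def field_simps)
    qed
    then have "box_bump 1 (a x) (b x) y \<le> grad g y \<bullet> e x"
      by (rule tendsto_le[OF trivial_limit_at_right_real l1 l2])
    then show ?thesis using bp[OF x(2)] by auto
  qed
  have "closure \<Omega> = \<Omega> \<union> frontier \<Omega>" "\<Omega> \<inter> frontier \<Omega> = {}"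
    using assms(1) closure_subset[of \<Omega>] by (auto simp: frontier_def interior_open)
  then have "C2_defining_function \<Omega> g"
    unfolding C2_defining_function_def using Cg gpos gz gg
    by (intro conjI exI[of _ UNIV]) (auto, force+)
  then show ?thesis by blast
qed

section \<open>The Finsler norm and its polar\<close>

lemma C_k_holder_3_imp_C2:
  assumes "C_k_holder_on 3 \<beta> S f"
  shows "C_k_on 2 S f"
proof -
  have "continuous_on S (partial j (partial i f))" for i j
    using assms by (auto simp: numeral_3_eq_3 intro!: continuous_at_imp_continuous_on differentiable_imp_continuous_within)
  then show ?thesis using assms by (simp add: numeral_3_eq_3 numeral_2_eq_2)
qed

locale finsler_norm =
  fixes F :: "real^'n \<Rightarrow> real" and a :: real
  assumes F_nonneg: "\<And>\<xi>. 0 \<le> F \<xi>" and F_convex: "convex_on UNIV F"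
    and F_homogeneous: "\<And>t \<xi>. F (t *\<^sub>R \<xi>) = \<bar>t\<bar> * F \<xi>"
    and a_pos: "0 < a" and F_lower: "\<And>\<xi>. a * norm \<xi> \<le> F \<xi>"
    and F_C2: "C_k_on 2 (UNIV - {0}) F"
begin

lemma F_continuous: "continuous_on UNIV F"
  using convex_on_continuous[OF open_UNIV F_convex] .

lemma F_subadditive: "F (x + y) \<le> F x + F y"
proof -
  have "F ((1 - 1/2) *\<^sub>R (2 *\<^sub>R x) + (1/2) *\<^sub>R (2 *\<^sub>R y)) \<le> (1 - 1/2) * F (2 *\<^sub>R x) + (1/2) * F (2 *\<^sub>R y)"
    by (intro convex_onD[OF F_convex]) auto
  then show ?thesis by (simp add: F_homogeneous)
qed

lemma F_upper: "\<exists>C\<ge>0. \<forall>\<xi>. F \<xi> \<le> C * norm \<xi>"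
proof -
  have "bounded (F ` sphere 0 1)"
    by (intro compact_imp_bounded compact_continuous_image continuous_on_subset[OF F_continuous]) auto
  then obtain C where "\<forall>y\<in>F ` sphere 0 1. norm y \<le> C" unfolding bounded_iff by blast
  then have C: "\<And>\<xi>. norm \<xi> = 1 \<Longrightarrow> \<bar>F \<xi>\<bar> \<le> C" by auto
  have "F \<xi> \<le> max C 0 * norm \<xi>" for \<xi>
  proof (cases "\<xi> = 0")
    case True
    then show ?thesis using F_homogeneous[of 0 0] by simp
  next
    case False
    have "F \<xi> = F (norm \<xi> *\<^sub>R (\<xi> /\<^sub>R norm \<xi>))" using False by simp
    also have "\<dots> = norm \<xi> * F (\<xi> /\<^sub>R norm \<xi>)" unfolding F_homogeneous by simp
    also have "\<dots> \<le> norm \<xi> * max C 0" using C[of "\<xi> /\<^sub>R norm \<xi>"] False by (intro mult_left_mono) auto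
    finally show ?thesis by (simp add: mult.commute)
  qed
  then show ?thesis by (intro exI[of _ "max C 0"]) auto
qed

lemma F_pos: "\<xi> \<noteq> 0 \<Longrightarrow> 0 < F \<xi>"
  using F_lower[of \<xi>] a_pos by (smt (verit) mult_pos_pos zero_less_norm_iff)

lemma F_0: "F 0 = 0"
  using F_homogeneous[of 0 0] by simp

lemma open_punctured: "open (UNIV - {0 :: real^'n})" by (simp add: open_delete)

lemma F_derivatives:
  assumes "\<xi> \<noteq> 0"
  shows "(F has_derivative (\<lambda>h. grad F \<xi> \<bullet> h)) (at \<xi>)"
    "(grad F has_derivative (\<lambda>h. hessian F \<xi> *v h)) (at \<xi>)"
  using C2_derivatives[OF open_punctured F_C2, of \<xi>] assms by auto

lemma F_ray_derivative:
  assumes "\<xi> + s *\<^sub>R \<eta> \<noteq> 0"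
  shows "((\<lambda>s. F (\<xi> + s *\<^sub>R \<eta>)) has_real_derivative grad F (\<xi> + s *\<^sub>R \<eta>) \<bullet> \<eta>) (at s)"
    "((\<lambda>s. grad F (\<xi> + s *\<^sub>R \<eta>)) has_vector_derivative hessian F (\<xi> + s *\<^sub>R \<eta>) *v \<eta>) (at s)"
proof -
  have l: "((\<lambda>s. \<xi> + s *\<^sub>R \<eta>) has_derivative (\<lambda>h. h *\<^sub>R \<eta>)) (at s)" by (auto intro!: derivative_eq_intros)
  have "((\<lambda>s. F (\<xi> + s *\<^sub>R \<eta>)) has_derivative (\<lambda>h. grad F (\<xi> + s *\<^sub>R \<eta>) \<bullet> (h *\<^sub>R \<eta>))) (at s)"
    by (rule has_derivative_compose[OF l F_derivatives(1)[OF assms]])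
  then show "((\<lambda>s. F (\<xi> + s *\<^sub>R \<eta>)) has_real_derivative grad F (\<xi> + s *\<^sub>R \<eta>) \<bullet> \<eta>) (at s)"
    unfolding has_field_derivative_def by (rule has_derivative_eq_rhs) (simp add: fun_eq_iff mult.commute)
  have "((\<lambda>s. grad F (\<xi> + s *\<^sub>R \<eta>)) has_derivative (\<lambda>h. hessian F (\<xi> + s *\<^sub>R \<eta>) *v (h *\<^sub>R \<eta>))) (at s)"
    by (rule has_derivative_compose[OF l F_derivatives(2)[OF assms]])
  then show "((\<lambda>s. grad F (\<xi> + s *\<^sub>R \<eta>)) has_vector_derivative hessian F (\<xi> + s *\<^sub>R \<eta>) *v \<eta>) (at s)"
    unfolding has_vector_derivative_def by (rule has_derivative_eq_rhs) (simp add: fun_eq_iff matrix_vector_mult_scaleR)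
qed

lemma grad_F_scale:
  assumes "\<xi> \<noteq> 0" "c \<noteq> 0"
  shows "grad F (c *\<^sub>R \<xi>) = sgn c *\<^sub>R grad F \<xi>"
proof -
  have "(F has_derivative (\<lambda>h. grad F (c *\<^sub>R \<xi>) \<bullet> h)) (at (c *\<^sub>R \<xi>))"
    using assms by (intro F_derivatives) auto
  then have "((\<lambda>x. F (c *\<^sub>R x)) has_derivative (\<lambda>h. grad F (c *\<^sub>R \<xi>) \<bullet> (c *\<^sub>R h))) (at \<xi>)"
    by (rule has_derivative_compose[rotated]) (auto intro!: derivative_eq_intros)
  then have "((\<lambda>x. \<bar>c\<bar> * F x) has_derivative (\<lambda>h. (c *\<^sub>R grad F (c *\<^sub>R \<xi>)) \<bullet> h)) (at \<xi>)"
    by (simp add: F_homogeneous)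
  then have 1: "grad (\<lambda>x. \<bar>c\<bar> * F x) \<xi> = c *\<^sub>R grad F (c *\<^sub>R \<xi>)" by (rule grad_eqI)
  have "((\<lambda>x. \<bar>c\<bar> * F x) has_derivative (\<lambda>h. \<bar>c\<bar> * (grad F \<xi> \<bullet> h))) (at \<xi>)"
    by (intro has_derivative_mult_right F_derivatives assms)
  then have "((\<lambda>x. \<bar>c\<bar> * F x) has_derivative (\<lambda>h. (\<bar>c\<bar> *\<^sub>R grad F \<xi>) \<bullet> h)) (at \<xi>)" by simp
  then have 2: "grad (\<lambda>x. \<bar>c\<bar> * F x) \<xi> = \<bar>c\<bar> *\<^sub>R grad F \<xi>" by (rule grad_eqI)
  have "inverse c *\<^sub>R (c *\<^sub>R grad F (c *\<^sub>R \<xi>)) = inverse c *\<^sub>R (\<bar>c\<bar> *\<^sub>R grad F \<xi>)" using 1 2 by simp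
  then show ?thesis using assms(2) by (cases "c > 0") (auto simp: sgn_if)
qed

text \<open>Negative factors are included because the curvature is defined through
  \<open>grad F (- grad g y)\<close>, and \<open>- grad g y\<close> is a negative multiple of the
  inward conormal of a chart.\<close>

lemma hessian_F_scale:
  assumes "\<xi> \<noteq> 0" "c \<noteq> 0"
  shows "hessian F (c *\<^sub>R \<xi>) = (1 / \<bar>c\<bar>) *\<^sub>R hessian F \<xi>"
proof -
  have "(grad F has_derivative (\<lambda>h. hessian F (c *\<^sub>R \<xi>) *v h)) (at (c *\<^sub>R \<xi>))"
    using assms by (intro F_derivatives) auto
  then have 1: "((\<lambda>x. grad F (c *\<^sub>R x)) has_derivative (\<lambda>h. hessian F (c *\<^sub>R \<xi>) *v (c *\<^sub>R h))) (at \<xi>)"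
    by (rule has_derivative_compose[rotated]) (auto intro!: derivative_eq_intros)
  have "((\<lambda>x. sgn c *\<^sub>R grad F x) has_derivative (\<lambda>h. sgn c *\<^sub>R (hessian F \<xi> *v h))) (at \<xi>)"
    by (intro has_derivative_scaleR_right F_derivatives assms)
  then have 2: "((\<lambda>x. grad F (c *\<^sub>R x)) has_derivative (\<lambda>h. sgn c *\<^sub>R (hessian F \<xi> *v h))) (at \<xi>)"
    by (rule has_derivative_transform_within_open[OF _ open_punctured]) (use assms grad_F_scale in auto)
  have "hessian F (c *\<^sub>R \<xi>) *v (c *\<^sub>R h) = sgn c *\<^sub>R (hessian F \<xi> *v h)" for h
    using has_derivative_unique[OF 1 2] by (rule fun_cong)
  then have h: "c *\<^sub>R (hessian F (c *\<^sub>R \<xi>) *v h) = sgn c *\<^sub>R (hessian F \<xi> *v h)" for h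
    by (simp add: matrix_vector_mult_scaleR)
  have "hessian F (c *\<^sub>R \<xi>) *v h = ((1 / \<bar>c\<bar>) *\<^sub>R hessian F \<xi>) *v h" for h
  proof -
    have "hessian F (c *\<^sub>R \<xi>) *v h = inverse c *\<^sub>R (c *\<^sub>R (hessian F (c *\<^sub>R \<xi>) *v h))" using assms by simp
    also have "\<dots> = (inverse c * sgn c) *\<^sub>R (hessian F \<xi> *v h)" unfolding h by simp
    also have "inverse c * sgn c = 1 / \<bar>c\<bar>" using assms by (simp add: sgn_if divide_simps)
    finally show ?thesis by (simp add: scaleR_matrix_vector_assoc)
  qed
  then show ?thesis by (simp add: matrix_eq)
qed

lemma grad_F_euler: assumes "\<xi> \<noteq> 0" shows "grad F \<xi> \<bullet> \<xi> = F \<xi>"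
proof -
  have 1: "((\<lambda>s. F (\<xi> + s *\<^sub>R \<xi>)) has_real_derivative grad F (\<xi> + 0 *\<^sub>R \<xi>) \<bullet> \<xi>) (at 0)"
    by (rule F_ray_derivative) (use assms in simp)
  have eq: "F (\<xi> + s *\<^sub>R \<xi>) = \<bar>1 + s\<bar> * F \<xi>" for s
    using F_homogeneous[of "1 + s" \<xi>] by (simp add: scaleR_add_left)
  have "((\<lambda>s. (1 + s) * F \<xi>) has_real_derivative F \<xi>) (at 0)" by (auto intro!: derivative_eq_intros)
  then have 2: "((\<lambda>s. F (\<xi> + s *\<^sub>R \<xi>)) has_real_derivative F \<xi>) (at 0)"
    by (rule has_field_derivative_transform_within_open[where S="{-1<..}"]) (auto simp: eq)
  show ?thesis using DERIV_unique[OF 1 2] by simp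
qed

text \<open>The gradient is constant along rays from the origin. With symmetry this makes the range
  of the Hessian orthogonal to \<xi>, that is, tangent to a surface with normal \<xi>.\<close>

lemma hessian_F_radial: assumes "\<xi> \<noteq> 0" shows "hessian F \<xi> *v \<xi> = 0"
proof -
  have 1: "((\<lambda>s. grad F (\<xi> + s *\<^sub>R \<xi>)) has_vector_derivative hessian F (\<xi> + 0 *\<^sub>R \<xi>) *v \<xi>) (at 0)"
    by (rule F_ray_derivative) (use assms in simp)
  have "((\<lambda>s. grad F \<xi>) has_vector_derivative 0) (at (0::real))" by simp
  then have 2: "((\<lambda>s. grad F (\<xi> + s *\<^sub>R \<xi>)) has_vector_derivative 0) (at 0)"
  proof (rule has_vector_derivative_transform_within_open[where S="{-1<..}"])
    fix s :: real assume "s \<in> {-1<..}"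
    then show "grad F \<xi> = grad F (\<xi> + s *\<^sub>R \<xi>)"
      using grad_F_scale[OF assms, of "1 + s"] by (simp add: scaleR_add_left)
  qed auto
  show ?thesis using vector_derivative_unique_at[OF 1 2] by simp
qed

text \<open>By subadditivity the difference quotients of F in direction \<eta>, from the right, are
  at most F \<eta>.\<close>

lemma grad_F_supports: assumes "\<xi> \<noteq> 0" shows "grad F \<xi> \<bullet> \<eta> \<le> F \<eta>"
proof -
  have d: "((\<lambda>s. F (\<xi> + s *\<^sub>R \<eta>)) has_real_derivative grad F (\<xi> + 0 *\<^sub>R \<eta>) \<bullet> \<eta>) (at 0)"
    by (rule F_ray_derivative) (use assms in simp)
  then have "((\<lambda>s. (F (\<xi> + s *\<^sub>R \<eta>) - F \<xi>) / s) \<longlongrightarrow> grad F \<xi> \<bullet> \<eta>) (at 0)"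
    by (simp add: has_field_derivative_iff)
  then have "((\<lambda>s. (F (\<xi> + s *\<^sub>R \<eta>) - F \<xi>) / s) \<longlongrightarrow> grad F \<xi> \<bullet> \<eta>) (at_right 0)"
    by (rule filterlim_mono) (auto simp: at_le)
  moreover have "\<forall>\<^sub>F s in at_right 0. (F (\<xi> + s *\<^sub>R \<eta>) - F \<xi>) / s \<le> F \<eta>"
    using eventually_at_right_less[of "0::real"]
  proof eventually_elim
    case (elim s)
    then show ?case using F_subadditive[of \<xi> "s *\<^sub>R \<eta>"] by (simp add: F_homogeneous field_simps)
  qed
  ultimately show ?thesis by (rule tendsto_upperbound) simp
qed

lemma hessian_F_symmetric: assumes "\<xi> \<noteq> 0" shows "transpose (hessian F \<xi>) = hessian F \<xi>"
  using hessian_symmetric(2)[OF open_punctured F_C2, of \<xi>] assms by simp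

text \<open>Monotonicity of the gradient: by Euler's identity the increment of the gradient paired
  with x - \<xi> is the sum of F x - grad F \<xi> . x and F \<xi> - grad F x . \<xi>, both
  nonnegative because gradients support F.\<close>

lemma hessian_F_psd: assumes "\<xi> \<noteq> 0" shows "0 \<le> \<eta> \<bullet> (hessian F \<xi> *v \<eta>)"
proof -
  have "((\<lambda>s. grad F (\<xi> + s *\<^sub>R \<eta>)) has_vector_derivative hessian F (\<xi> + 0 *\<^sub>R \<eta>) *v \<eta>) (at 0)"
    by (rule F_ray_derivative) (use assms in simp)
  from has_derivative_inner_left[OF this[unfolded has_vector_derivative_def], of \<eta>]
  have "((\<lambda>s. grad F (\<xi> + s *\<^sub>R \<eta>) \<bullet> \<eta>) has_real_derivative (hessian F \<xi> *v \<eta>) \<bullet> \<eta>) (at 0)"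
    unfolding has_field_derivative_def by (rule has_derivative_eq_rhs) (simp add: fun_eq_iff mult.commute)
  then have "((\<lambda>s. (grad F (\<xi> + s *\<^sub>R \<eta>) \<bullet> \<eta> - grad F \<xi> \<bullet> \<eta>) / s) \<longlongrightarrow> (hessian F \<xi> *v \<eta>) \<bullet> \<eta>) (at 0)"
    by (simp add: has_field_derivative_iff)
  then have lim: "((\<lambda>s. (grad F (\<xi> + s *\<^sub>R \<eta>) \<bullet> \<eta> - grad F \<xi> \<bullet> \<eta>) / s) \<longlongrightarrow> (hessian F \<xi> *v \<eta>) \<bullet> \<eta>) (at_right 0)"
    by (rule filterlim_mono) (auto simp: at_le)
  have "((\<lambda>s. \<xi> + s *\<^sub>R \<eta>) \<longlongrightarrow> \<xi>) (at_right 0)" by (auto intro!: tendsto_eq_intros)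
  then have "\<forall>\<^sub>F s in at_right 0. \<xi> + s *\<^sub>R \<eta> \<noteq> 0"
    using assms by (rule tendsto_imp_eventually_ne)
  then have "\<forall>\<^sub>F s in at_right 0. 0 \<le> (grad F (\<xi> + s *\<^sub>R \<eta>) \<bullet> \<eta> - grad F \<xi> \<bullet> \<eta>) / s"
    using eventually_at_right_less[of "0::real"]
  proof eventually_elim
    case (elim s)
    define x where "x = \<xi> + s *\<^sub>R \<eta>"
    have "s * (grad F x \<bullet> \<eta> - grad F \<xi> \<bullet> \<eta>) = grad F x \<bullet> (x - \<xi>) - grad F \<xi> \<bullet> (x - \<xi>)"
      by (simp add: x_def right_diff_distrib)
    also have "\<dots> = F x - grad F x \<bullet> \<xi> - grad F \<xi> \<bullet> x + F \<xi>"
      using grad_F_euler[of x] grad_F_euler[OF assms] elim by (simp add: x_def[symmetric] inner_diff_right)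
    also have "\<dots> \<ge> 0"
      using grad_F_supports[of x \<xi>] grad_F_supports[OF assms, of x] elim by (simp add: x_def[symmetric])
    finally show ?case using elim by (simp add: x_def zero_le_mult_iff)
  qed
  from tendsto_lowerbound[OF lim this] show ?thesis by (simp add: inner_commute)
qed

subsection \<open>The polar function\<close>

lemma polar_bdd: "bdd_above ((\<lambda>\<xi>. (\<xi> \<bullet> v) / F \<xi>) ` (UNIV - {0}))"
proof (rule bdd_aboveI2)
  fix \<xi> :: "real^'n" assume x: "\<xi> \<in> UNIV - {0}"
  have "\<xi> \<bullet> v \<le> norm \<xi> * norm v" by (rule norm_cauchy_schwarz)
  also have "\<dots> \<le> (F \<xi> / a) * norm v"
    using F_lower[of \<xi>] a_pos by (intro mult_right_mono) (auto simp: field_simps)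
  finally show "(\<xi> \<bullet> v) / F \<xi> \<le> norm v / a" using F_pos[of \<xi>] x by (simp add: field_simps)
qed

lemma polar_ge: assumes "\<xi> \<noteq> 0" shows "\<xi> \<bullet> v \<le> F \<xi> * polar F v"
proof -
  have "(\<xi> \<bullet> v) / F \<xi> \<le> polar F v"
    unfolding polar_def by (rule cSUP_upper[OF _ polar_bdd]) (use assms in simp)
  then show ?thesis using F_pos[OF assms] by (simp add: field_simps)
qed

lemma punctured_nonempty: "UNIV - {0 :: real^'n} \<noteq> {}"
  using axis_eq_0_iff[of _ "1::real"] by (metis DiffI UNIV_I empty_iff singletonD one_neq_zero)

lemma polar_le: assumes "\<And>\<xi>. \<xi> \<noteq> 0 \<Longrightarrow> \<xi> \<bullet> v \<le> F \<xi> * c" shows "polar F v \<le> c"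
  unfolding polar_def
  by (rule cSUP_least[OF punctured_nonempty]) (use assms F_pos in \<open>auto simp: field_simps\<close>)

lemma polar_0: "polar F 0 = 0"
  unfolding polar_def by (simp add: cSUP_const[OF punctured_nonempty])

lemma polar_pos: assumes "v \<noteq> 0" shows "0 < polar F v"
  using polar_ge[OF assms, of v] assms F_pos[OF assms] by (smt (verit) inner_gt_zero_iff mult_nonneg_nonpos)

lemma polar_nonneg: "0 \<le> polar F v"
  using polar_pos[of v] polar_0 by (cases "v = 0") auto

lemma polar_subadditive: "polar F (v + w) \<le> polar F v + polar F w"
proof (rule polar_le)
  fix \<xi> :: "real^'n" assume "\<xi> \<noteq> 0"
  then show "\<xi> \<bullet> (v + w) \<le> F \<xi> * (polar F v + polar F w)"
    using polar_ge[of \<xi> v] polar_ge[of \<xi> w] by (simp add: inner_add_right distrib_left)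
qed

lemma polar_scale_le: assumes "0 \<le> t" shows "polar F (t *\<^sub>R v) \<le> t * polar F v"
proof (rule polar_le)
  fix \<xi> :: "real^'n" assume "\<xi> \<noteq> 0"
  then show "\<xi> \<bullet> (t *\<^sub>R v) \<le> F \<xi> * (t * polar F v)"
    using mult_left_mono[OF polar_ge[of \<xi> v] assms] by (simp add: mult.left_commute)
qed

lemma polar_norm: "polar F v \<le> norm v / a"
proof (rule polar_le)
  fix \<xi> :: "real^'n" assume "\<xi> \<noteq> 0"
  have "\<xi> \<bullet> v \<le> norm \<xi> * norm v" by (rule norm_cauchy_schwarz)
  also have "\<dots> \<le> (F \<xi> / a) * norm v"
    using F_lower[of \<xi>] a_pos by (intro mult_right_mono) (auto simp: field_simps)
  finally show "\<xi> \<bullet> v \<le> F \<xi> * (norm v / a)" by simp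
qed

lemma polar_lipschitz: "\<bar>polar F v - polar F w\<bar> \<le> norm (v - w) / a"
  using polar_subadditive[of w "v - w"] polar_subadditive[of v "w - v"]
    polar_norm[of "v - w"] polar_norm[of "w - v"] by (simp add: norm_minus_commute abs_le_iff)

lemma polar_continuous: "continuous_on UNIV (polar F)"
proof (rule lipschitz_on_continuous_on)
  show "(1 / a)-lipschitz_on UNIV (polar F)"
    using polar_lipschitz a_pos by (intro lipschitz_onI) (auto simp: dist_norm)
qed

lemma polar_grad_F: assumes "\<xi> \<noteq> 0" shows "polar F (grad F \<xi>) \<le> 1"
  by (rule polar_le) (use grad_F_supports[OF assms] in \<open>simp add: inner_commute\<close>)

end

section \<open>Determinants along a family of parallel surfaces\<close>

text \<open>A maximiser b of the quadratic form on the unit sphere of S is an eigenvector: by the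
  first-order condition f b is orthogonal to all vectors of S that are orthogonal to b.\<close>

lemma selfadjoint_eigenvector:
  fixes f :: "'a::euclidean_space \<Rightarrow> 'a"
  assumes lf: "linear f" and sa: "\<And>x y. f x \<bullet> y = x \<bullet> f y"
    and S: "subspace S" "f ` S \<subseteq> S" "S \<noteq> {0}"
  obtains b c where "b \<in> S" "norm b = 1" "f b = c *\<^sub>R b"
proof -
  interpret f: linear f by (rule lf)
  let ?K = "S \<inter> sphere 0 1"
  obtain z where z: "z \<in> S" "z \<noteq> 0" using S subspace_0 by blast
  have "z /\<^sub>R norm z \<in> ?K" using z S(1) by (simp add: subspace_scale)
  then have "?K \<noteq> {}" by blast
  moreover have "compact ?K" by (intro closed_Int_compact closed_subspace S(1)) auto
  moreover have "continuous_on ?K (\<lambda>x. x \<bullet> f x)"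
    by (intro continuous_intros linear_continuous_on linear_linear[THEN iffD2] lf)
  ultimately obtain b where b: "b \<in> ?K" and max: "\<And>y. y \<in> ?K \<Longrightarrow> y \<bullet> f y \<le> b \<bullet> f b"
    using continuous_attains_sup by metis
  define c where "c = b \<bullet> f b"
  have bS: "b \<in> S" and nb: "norm b = 1" using b by auto
  have le: "y \<bullet> f y \<le> c * (y \<bullet> y)" if "y \<in> S" for y
  proof (cases "y = 0")
    case False
    have "(y /\<^sub>R norm y) \<bullet> f (y /\<^sub>R norm y) \<le> c"
      unfolding c_def using False that S(1) by (intro max) (simp add: subspace_scale)
    then have "y \<bullet> f y \<le> c * (norm y)\<^sup>2"
      using False by (simp add: f.scaleR field_simps power2_eq_square)
    then show ?thesis by (simp add: power2_norm_eq_inner)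
  qed simp
  have orth: "y \<bullet> f b = 0" if y: "y \<in> S" "y \<bullet> b = 0" for y
  proof -
    have q: "2 * t * (y \<bullet> f b) + t\<^sup>2 * (y \<bullet> f y - c * (y \<bullet> y)) \<le> 0" for t
    proof -
      have "b + t *\<^sub>R y \<in> S" using bS y S(1) by (simp add: subspace_add subspace_scale)
      from le[OF this] have "(b + t *\<^sub>R y) \<bullet> f (b + t *\<^sub>R y) \<le> c * ((b + t *\<^sub>R y) \<bullet> (b + t *\<^sub>R y))" .
      moreover have "b \<bullet> f y = y \<bullet> f b" using sa[of b y] by (simp add: inner_commute)
      moreover have "b \<bullet> b = 1" using nb by (simp add: dot_square_norm)
      moreover have "b \<bullet> y = 0" using y by (simp add: inner_commute)
      ultimately show ?thesis using y(2)
        by (simp add: f.add f.scaleR inner_add_left inner_add_right c_def[symmetric] algebra_simps power2_eq_square)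
    qed
    define m where "m = y \<bullet> f y - c * (y \<bullet> y)"
    define l where "l = y \<bullet> f b"
    show ?thesis
    proof (rule ccontr)
      assume "y \<bullet> f b \<noteq> 0"
      then have l0: "l \<noteq> 0" by (simp add: l_def)
      \<comment> \<open>For this t the quadratic term is at least -t l, so that the whole expression
        is at least t l, which is positive.\<close>
      define t where "t = l / (\<bar>m\<bar> + 1)"
      have "2 * t * l + t\<^sup>2 * m \<le> 0" using q[of t] by (simp add: m_def l_def)
      moreover have "t\<^sup>2 * m \<ge> - (t * l)"
      proof -
        have "t\<^sup>2 * m \<ge> - (t\<^sup>2 * (\<bar>m\<bar> + 1))"
          using mult_left_mono[of "- (\<bar>m\<bar> + 1)" m "t\<^sup>2"] by (simp only: mult_minus_right) simp
        moreover have "t\<^sup>2 * (\<bar>m\<bar> + 1) = t * l" by (simp add: t_def power2_eq_square)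
        ultimately show ?thesis by simp
      qed
      moreover have "t * l > 0" using l0 by (simp add: t_def power2_eq_square[symmetric] add_nonneg_pos)
      ultimately show False by simp
    qed
  qed
  define y where "y = f b - c *\<^sub>R b"
  have yS: "y \<in> S" unfolding y_def using S bS by (auto intro: subspace_diff subspace_scale)
  have "b \<bullet> b = 1" using nb by (simp add: dot_square_norm)
  then have yb: "y \<bullet> b = 0"
    by (simp add: y_def inner_diff_left c_def inner_commute[of "f b" b])
  have "y \<bullet> y = y \<bullet> f b - c * (y \<bullet> b)" by (simp add: y_def inner_diff_right)
  then have "y = 0" using orth[OF yS yb] yb by simp
  then have "f b = c *\<^sub>R b" by (simp add: y_def)
  then show ?thesis using that bS nb by blast
qed

lemma selfadjoint_eigenbasis:
  fixes f :: "'a::euclidean_space \<Rightarrow> 'a"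
  assumes lf: "linear f" and sa: "\<And>x y. f x \<bullet> y = x \<bullet> f y"
  shows "subspace S \<Longrightarrow> f ` S \<subseteq> S \<Longrightarrow>
    \<exists>B. pairwise orthogonal B \<and> (\<forall>b\<in>B. norm b = 1 \<and> (\<exists>c. f b = c *\<^sub>R b)) \<and> span B = S"
proof (induction "dim S" arbitrary: S rule: less_induct)
  case less
  show ?case
  proof (cases "S = {0}")
    case True
    then show ?thesis by (intro exI[of _ "{}"]) auto
  next
    case False
    obtain b c where b: "b \<in> S" "norm b = 1" "f b = c *\<^sub>R b"
      by (rule selfadjoint_eigenvector[OF lf sa less.prems False])
    define T where "T = S \<inter> {x. b \<bullet> x = 0}"
    have T: "subspace T" unfolding T_def by (intro subspace_inter less.prems subspace_hyperplane)
    have "b \<notin> T" using b by (auto simp: T_def)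
    then have "T \<subset> S" using b(1) unfolding T_def by blast
    moreover have "span T = T" "span S = S" using T less.prems(1) by (simp_all only: span_eq_iff)
    ultimately have "dim T < dim S" by (intro dim_psubset) (simp only:)
    moreover have "f ` T \<subseteq> T" using less.prems b sa by (auto simp: T_def simp flip: sa)
    ultimately obtain B where B: "pairwise orthogonal B" "\<forall>b\<in>B. norm b = 1 \<and> (\<exists>c. f b = c *\<^sub>R b)" "span B = T"
      using less.hyps[of T] T by blast
    have "B \<subseteq> T" using B span_superset by blast
    then have "pairwise orthogonal (insert b B)"
      using B(1) by (auto simp: pairwise_insert orthogonal_def T_def inner_commute)
    moreover have "span (insert b B) = S"
    proof
      show "span (insert b B) \<subseteq> S" using b \<open>B \<subseteq> T\<close> less.prems
        by (intro span_minimal) (auto simp: T_def)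
      show "S \<subseteq> span (insert b B)"
      proof
        fix x assume x: "x \<in> S"
        have "x - (b \<bullet> x) *\<^sub>R b \<in> T" using x b less.prems(1)
          by (auto simp: T_def inner_diff_right dot_square_norm intro: subspace_diff subspace_scale)
        then have "x - (b \<bullet> x) *\<^sub>R b \<in> span B" using B by simp
        then show "x \<in> span (insert b B)" by (rule span_breakdown_eq[THEN iffD2, OF exI])
      qed
    qed
    ultimately show ?thesis using B b by (intro exI[of _ "insert b B"]) auto
  qed
qed

definition diag_matrix :: "('n \<Rightarrow> real) \<Rightarrow> real^'n^'n" where
  "diag_matrix d = (\<chi> i j. if i = j then d i else 0)"

lemma spectral_theorem:
  fixes A :: "real^'n^'n"
  assumes "transpose A = A"
  obtains Q d where "orthogonal_matrix Q" "A = Q ** diag_matrix d ** transpose Q"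
    "\<And>i. A *v column i Q = d i *\<^sub>R column i Q"
proof -
  have "(A *v x) \<bullet> y = x \<bullet> (A *v y)" for x y
    using assms by (metis dot_lmul_matrix transpose_matrix_vector)
  then obtain B where B: "pairwise orthogonal B" "\<And>b. b\<in>B \<Longrightarrow> norm b = 1 \<and> (\<exists>c. A *v b = c *\<^sub>R b)"
      "span B = UNIV"
    using selfadjoint_eigenbasis[of "(*v) A" UNIV] by (auto simp: matrix_vector_mul_linear)
  have "0 \<notin> B" using B(2) by force
  then have ind: "independent B" using B(1) by (rule pairwise_orthogonal_independent[rotated])
  then have "card B = CARD('n)" using B(3) 
    by (metis dim_UNIV DIM_cart DIM_real dim_span_eq_card_independent mult.right_neutral)
  moreover have "finite B" using ind by (rule independent_imp_finite)
  ultimately obtain q where q: "bij_betw q (UNIV::'n set) B"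
    by (metis finite_class.finite_UNIV finite_same_card_bij)
  have qB: "q i \<in> B" for i using q by (auto simp: bij_betw_def)
  have "\<forall>i. \<exists>c. A *v q i = c *\<^sub>R q i" using B(2) qB by blast
  then obtain d where d: "\<And>i. A *v q i = d i *\<^sub>R q i" by metis
  define Q :: "real^'n^'n" where "Q = (\<chi> i j. q j $ i)"
  have col: "column i Q = q i" for i by (simp add: column_def Q_def vec_eq_iff)
  have on: "q i \<bullet> q j = (if i = j then 1 else 0)" for i j
  proof (cases "i = j")
    case True
    then show ?thesis using B(2)[OF qB] by (simp add: dot_square_norm)
  next
    case False
    then have "q i \<noteq> q j" using q by (auto simp: bij_betw_def inj_on_def)
    then show ?thesis using B(1) qB False by (auto simp: pairwise_def orthogonal_def)
  qed
  have Qo: "orthogonal_matrix Q"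
    unfolding orthogonal_matrix
    by (simp add: matrix_mult_dot[of "transpose Q"] vec_eq_iff mat_def row_transpose col on column_transpose
       flip: row_def column_def)
       (simp add: matrix_matrix_mult_def transpose_def Q_def on[unfolded inner_vec_def, simplified])
  have "A ** Q = Q ** diag_matrix d"
  proof -
    have "(A ** Q) $ i $ j = (Q ** diag_matrix d) $ i $ j" for i j
    proof -
      have "(A ** Q) $ i $ j = (A *v q j) $ i"
        by (simp add: matrix_matrix_mult_def matrix_vector_mult_def Q_def)
      also have "\<dots> = (Q ** diag_matrix d) $ i $ j"
        by (simp add: d matrix_matrix_mult_def Q_def diag_matrix_def if_distrib cong: if_cong)
      finally show ?thesis .
    qed
    then show ?thesis by (simp add: vec_eq_iff)
  qed
  then have 1: "A ** Q ** transpose Q = Q ** diag_matrix d ** transpose Q" by (simp only:)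
  have 2: "A ** Q ** transpose Q = A"
    using Qo by (simp only: matrix_mul_assoc[symmetric] orthogonal_matrix_def matrix_mul_rid)
  show ?thesis by (rule that[OF Qo trans[OF 2[symmetric] 1]]) (simp only: col d)
qed

lemma matrix_sub_ldistrib: "A ** (B - C) = A ** B - A ** (C :: real^'n^'m)"
  by (simp add: matrix_matrix_mult_def vec_eq_iff right_diff_distrib sum_subtractf)

lemma matrix_sub_rdistrib: "(B - C) ** A = B ** A - C ** (A :: real^'n^'m)"
  by (simp add: matrix_matrix_mult_def vec_eq_iff left_diff_distrib sum_subtractf)

lemma diag_matrix_mult: "diag_matrix d ** diag_matrix e = diag_matrix (\<lambda>i. d i * e i)"
  by (simp add: diag_matrix_def matrix_matrix_mult_def vec_eq_iff mult_delta_left)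

lemma transpose_diag_matrix: "transpose (diag_matrix d) = diag_matrix d"
  by (simp add: diag_matrix_def transpose_def vec_eq_iff)

lemma det_conj_orthogonal:
  fixes Q :: "real^'n^'n"
  assumes "orthogonal_matrix Q"
  shows "det (Q ** X ** transpose Q) = det X"
proof -
  have "det Q * det (transpose Q) = 1"
    using assms by (metis det_I det_mul orthogonal_matrix_def)
  then show ?thesis by (simp add: det_mul)
qed

text \<open>Serves to replace the product of M with a symmetric matrix K, which need not be
  symmetric, by the symmetric matrix S K S.\<close>

lemma psd_sqrt:
  fixes M :: "real^'n^'n"
  assumes "transpose M = M" "\<And>v. 0 \<le> v \<bullet> (M *v v)"
  obtains S where "transpose S = S" "\<And>v. 0 \<le> v \<bullet> (S *v v)" "S ** S = M"
proof -
  obtain Q d where Q: "orthogonal_matrix Q" "M = Q ** diag_matrix d ** transpose Q"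
    and ev: "\<And>i. M *v column i Q = d i *\<^sub>R column i Q"
    by (rule spectral_theorem[OF assms(1)]) blast
  have nz: "column i Q \<bullet> column i Q = 1" for i
    using Q(1) by (metis dot_square_norm norm_eq_1 orthogonal_matrix_orthonormal_columns power_one)
  have d: "0 \<le> d i" for i
    using assms(2)[of "column i Q"] by (simp add: ev nz)
  define S where "S = Q ** diag_matrix (\<lambda>i. sqrt (d i)) ** transpose Q"
  have QQ: "transpose Q ** Q = mat 1" using Q by (simp add: orthogonal_matrix_def)
  have "S ** S = Q ** (diag_matrix (\<lambda>i. sqrt (d i)) ** ((transpose Q ** Q) ** diag_matrix (\<lambda>i. sqrt (d i)))) ** transpose Q"
    by (simp add: S_def matrix_mul_assoc)
  also have "\<dots> = M" using d by (simp add: QQ diag_matrix_mult Q(2))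
  finally have 1: "S ** S = M" .
  have 2: "transpose S = S"
    by (simp add: S_def matrix_transpose_mul transpose_diag_matrix matrix_mul_assoc)
  have 3: "0 \<le> v \<bullet> (S *v v)" for v
  proof -
    define w where "w = transpose Q *v v"
    have "v \<bullet> (S *v v) = w \<bullet> (diag_matrix (\<lambda>i. sqrt (d i)) *v w)"
      unfolding S_def w_def
      by (metis (no_types) dot_lmul_matrix matrix_vector_mul_assoc transpose_matrix_vector)
    also have "\<dots> = (\<Sum>i\<in>UNIV. w $ i * (sqrt (d i) * w $ i))"
      by (simp add: inner_vec_def diag_matrix_def matrix_vector_mult_def mult_delta_left)
    also have "\<dots> \<ge> 0"
    proof (rule sum_nonneg)
      fix i
      have "w $ i * (sqrt (d i) * w $ i) = sqrt (d i) * (w $ i)\<^sup>2" by (simp add: power2_eq_square)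
      then show "0 \<le> w $ i * (sqrt (d i) * w $ i)" using d[of i] by (simp only: zero_le_mult_iff real_sqrt_ge_zero zero_le_power2) simp
    qed
    finally show ?thesis .
  qed
  show ?thesis by (rule that[OF 2 3 1])
qed

lemma tendsto_det:
  fixes X :: "nat \<Rightarrow> real^'n^'n"
  assumes "\<And>i j. (\<lambda>k. X k $ i $ j) \<longlonglongrightarrow> A $ i $ j"
  shows "(\<lambda>k. det (X k)) \<longlonglongrightarrow> det A"
  unfolding det_def by (intro tendsto_intros assms)

text \<open>If S is invertible, (1 + S Y) S = S (1 + Y S) gives the identity. A positive
  semidefinite S becomes invertible after adding a small positive multiple of the identity, and
  determinants are continuous.\<close>

lemma det_sylvester_psd:
  fixes S Y :: "real^'n^'n"
  assumes "\<And>v. 0 \<le> v \<bullet> (S *v v)"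
  shows "det (mat 1 + S ** Y) = det (mat 1 + Y ** S)"
proof -
  define X where "X k = S + inverse (real (Suc k)) *\<^sub>R mat 1" for k
  have eq: "det (mat 1 + X k ** Y) = det (mat 1 + Y ** X k)" for k
  proof -
    have "X k *v v = 0 \<Longrightarrow> v = 0" for v
    proof -
      assume "X k *v v = 0"
      then have "0 = v \<bullet> (S *v v) + inverse (real (Suc k)) * (v \<bullet> v)"
        by (simp add: X_def matrix_vector_mult_add_rdistrib inner_add_right
          flip: scaleR_matrix_vector_assoc) (metis inner_add_right inner_scaleR_right inner_zero_right)
      then have "inverse (real (Suc k)) * (v \<bullet> v) \<le> 0" using assms[of v] by linarith
      then have "v \<bullet> v \<le> 0" by (simp add: mult_le_0_iff)
      then show "v = 0" by (metis inner_eq_zero_iff inner_ge_zero order_antisym)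
    qed
    then have "invertible (X k)"
      by (simp add: invertible_left_inverse matrix_left_invertible_ker)
    then have "det (X k) \<noteq> 0" by (simp add: invertible_det_nz)
    moreover have "(mat 1 + X k ** Y) ** X k = X k ** (mat 1 + Y ** X k)"
      by (simp add: matrix_add_ldistrib matrix_mul_assoc) (simp add: matrix_matrix_mult_def vec_eq_iff mat_def distrib_right sum.distrib mult_delta_left)
    then have "det (mat 1 + X k ** Y) * det (X k) = det (X k) * det (mat 1 + Y ** X k)"
      by (metis det_mul)
    ultimately show ?thesis by simp
  qed
  have lim: "(\<lambda>k. X k $ i $ j) \<longlonglongrightarrow> S $ i $ j" for i j
  proof -
    have "(\<lambda>k. S $ i $ j + inverse (real (Suc k)) * (mat 1 :: real^'n^'n) $ i $ j) \<longlonglongrightarrow> 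
        S $ i $ j + 0 * (mat 1 :: real^'n^'n) $ i $ j"
      by (intro tendsto_intros LIMSEQ_inverse_real_of_nat)
    then show ?thesis by (simp add: X_def)
  qed
  have "(\<lambda>k. det (mat 1 + X k ** Y)) \<longlonglongrightarrow> det (mat 1 + S ** Y)"
    by (rule tendsto_det) (auto simp: matrix_matrix_mult_def intro!: tendsto_intros lim)
  moreover have "(\<lambda>k. det (mat 1 + Y ** X k)) \<longlonglongrightarrow> det (mat 1 + Y ** S)"
    by (rule tendsto_det) (auto simp: matrix_matrix_mult_def intro!: tendsto_intros lim)
  ultimately show ?thesis unfolding eq by (rule LIMSEQ_unique)
qed

text \<open>As long as all factors are positive, the logarithmic derivative of the product is minus
  the sum of \<alpha>/(1 - t \<alpha>), hence at most minus the sum of the \<alpha>. The proof uses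
  the version for finite increments that follows from 1 + x \<le> exp x.\<close>

lemma prod_one_minus_antimono:
  fixes \<alpha> :: "'i::finite \<Rightarrow> real"
  assumes "\<And>i. \<alpha> i * t1 \<le> 1" "0 \<le> (\<Sum>i\<in>UNIV. \<alpha> i)" "0 \<le> s" "s \<le> t" "t < t1"
  shows "0 < (\<Prod>i\<in>UNIV. 1 - t * \<alpha> i)" "(\<Prod>i\<in>UNIV. 1 - t * \<alpha> i) \<le> (\<Prod>i\<in>UNIV. 1 - s * \<alpha> i)"
proof -
  have pos: "0 < 1 - r * \<alpha> i" if "0 \<le> r" "r < t1" for r i
  proof (cases "\<alpha> i \<le> 0")
    case True
    then show ?thesis using that mult_nonneg_nonpos[of r "\<alpha> i"] by linarith
  next
    case False
    then have "r * \<alpha> i < t1 * \<alpha> i" using that by simp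
    then show ?thesis using assms(1)[of i] by (simp add: mult.commute)
  qed
  show "0 < (\<Prod>i\<in>UNIV. 1 - t * \<alpha> i)" using pos[of t] assms by (simp add: prod_pos)
  have "(\<Prod>i\<in>UNIV. 1 - t * \<alpha> i) \<le> (\<Prod>i\<in>UNIV. (1 - s * \<alpha> i) * exp (- (t - s) * \<alpha> i))"
  proof (rule prod_mono, safe)
    fix i
    show "0 \<le> 1 - t * \<alpha> i" using pos[of t i] assms by simp
    define u where "u = 1 - s * \<alpha> i"
    have u: "u > 0" using pos[of s i] assms by (simp add: u_def)
    \<comment> \<open>For positive \<alpha> the factor u is at most 1, for negative \<alpha> at
      least 1; one computation covers both signs.\<close>
    have "\<alpha> i \<le> \<alpha> i / u"
    proof -
      have "\<alpha> i * u = \<alpha> i - s * (\<alpha> i)\<^sup>2" by (simp add: u_def algebra_simps power2_eq_square)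
      also have "\<dots> \<le> \<alpha> i" using assms by simp
      finally show ?thesis using u by (simp add: field_simps)
    qed
    then have "(t - s) * \<alpha> i \<le> (t - s) * (\<alpha> i / u)" using assms by (intro mult_left_mono) auto
    then have "1 - (t - s) * (\<alpha> i / u) \<le> 1 + (- (t - s) * \<alpha> i)"
      by (simp add: minus_mult_left[symmetric] del: minus_diff_eq)
    also have "\<dots> \<le> exp (- (t - s) * \<alpha> i)" by (rule exp_ge_add_one_self)
    finally have "u * (1 - (t - s) * (\<alpha> i / u)) \<le> u * exp (- (t - s) * \<alpha> i)" using u by simp
    moreover have "u * (1 - (t - s) * (\<alpha> i / u)) = 1 - t * \<alpha> i"
      using u by (simp add: field_simps) (simp add: u_def algebra_simps)
    ultimately show "1 - t * \<alpha> i \<le> (1 - s * \<alpha> i) * exp (- (t - s) * \<alpha> i)" by (simp add: u_def)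
  qed
  also have "\<dots> = (\<Prod>i\<in>UNIV. 1 - s * \<alpha> i) * exp (- (t - s) * (\<Sum>i\<in>UNIV. \<alpha> i))"
    by (simp add: prod.distrib exp_sum sum_distrib_left flip: sum_negf)
  also have "\<dots> \<le> (\<Prod>i\<in>UNIV. 1 - s * \<alpha> i) * 1"
  proof (rule mult_left_mono)
    have "0 \<le> (t - s) * (\<Sum>i\<in>UNIV. \<alpha> i)" using assms by simp
    then show "exp (- (t - s) * (\<Sum>i\<in>UNIV. \<alpha> i)) \<le> 1" by (simp only: mult_minus_left) simp
  qed (use assms pos[of s] in \<open>auto simp: prod_nonneg less_imp_le\<close>)
  finally show "(\<Prod>i\<in>UNIV. 1 - t * \<alpha> i) \<le> (\<Prod>i\<in>UNIV. 1 - s * \<alpha> i)" by simp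
qed

text \<open>With S the square root of M, the matrix S K S is symmetric and yields the same
  determinants, so everything is expressed by its eigenvalues \<alpha>. Their sum is the trace of M
  K, and \<open>inner\<close> bounds each of them by 1/t1.\<close>

lemma det_one_minus_antimono:
  fixes M K :: "real^'n^'n"
  assumes "transpose M = M" "\<And>v. 0 \<le> v \<bullet> (M *v v)" "transpose K = K"
    and inner: "\<And>v. t1 * ((M *v v) \<bullet> (K *v (M *v v))) \<le> v \<bullet> (M *v v)"
    and tr: "0 \<le> trace (M ** K)" and t: "0 \<le> s" "s \<le> t" "t < t1"
  shows "0 < det (mat 1 - t *\<^sub>R (M ** K))" 
    "det (mat 1 - t *\<^sub>R (M ** K)) \<le> det (mat 1 - s *\<^sub>R (M ** K))"
proof -
  obtain S where S: "transpose S = S" "\<And>v. 0 \<le> v \<bullet> (S *v v)" "S ** S = M"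
    using psd_sqrt[OF assms(1,2)] by blast
  define A where "A = S ** K ** S"
  have "transpose A = A"
    by (simp add: A_def matrix_transpose_mul S assms(3) matrix_mul_assoc)
  then obtain Q \<alpha> where Q: "orthogonal_matrix Q" "A = Q ** diag_matrix \<alpha> ** transpose Q"
    and ev: "\<And>i. A *v column i Q = \<alpha> i *\<^sub>R column i Q"
    using spectral_theorem by blast
  have Ssym: "(S *v x) \<bullet> y = x \<bullet> (S *v y)" for x y
    using S(1) by (metis dot_lmul_matrix transpose_matrix_vector)
  have det: "det (mat 1 - r *\<^sub>R (M ** K)) = (\<Prod>i\<in>UNIV. 1 - r * \<alpha> i)" for r
  proof -
    have "S ** ((- r) *\<^sub>R (S ** K)) = (- r) *\<^sub>R (M ** K)"
      by (simp only: matrix_scalar_ac scalar_matrix_assoc[symmetric] S(3)[symmetric] matrix_mul_assoc)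
    then have "det (mat 1 - r *\<^sub>R (M ** K)) = det (mat 1 + S ** ((- r) *\<^sub>R (S ** K)))"
      by simp
    also have "\<dots> = det (mat 1 + ((- r) *\<^sub>R (S ** K)) ** S)"
      by (rule det_sylvester_psd[OF S(2)])
    also have "mat 1 + ((- r) *\<^sub>R (S ** K)) ** S = mat 1 - r *\<^sub>R A"
      by (simp only: A_def scalar_matrix_assoc[symmetric]) simp
    also have "mat 1 - r *\<^sub>R A = Q ** diag_matrix (\<lambda>i. 1 - r * \<alpha> i) ** transpose Q"
    proof -
      have "diag_matrix (\<lambda>i. 1 - r * \<alpha> i) = mat 1 - r *\<^sub>R diag_matrix \<alpha>"
        by (simp add: diag_matrix_def vec_eq_iff mat_def)
      moreover have "Q ** (mat 1 - r *\<^sub>R diag_matrix \<alpha>) ** transpose Q = 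
          Q ** transpose Q - r *\<^sub>R (Q ** diag_matrix \<alpha> ** transpose Q)"
        by (simp add: matrix_sub_ldistrib matrix_sub_rdistrib matrix_scalar_ac scalar_matrix_assoc)
      ultimately show ?thesis using Q by (simp add: orthogonal_matrix_def)
    qed
    also have "det \<dots> = det (diag_matrix (\<lambda>i. 1 - r * \<alpha> i))" by (rule det_conj_orthogonal[OF Q(1)])
    also have "\<dots> = (\<Prod>i\<in>UNIV. 1 - r * \<alpha> i)"
      by (subst det_diagonal) (auto simp: diag_matrix_def)
    finally show ?thesis .
  qed
  have le: "\<alpha> i * t1 \<le> 1" for i
  proof (cases "\<alpha> i \<le> 0")
    case True
    then show ?thesis using t mult_nonpos_nonneg[of "\<alpha> i" t1] by linarith
  next
    case False
    define u where "u = column i Q"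
    have uu: "u \<bullet> u = 1" unfolding u_def
      using Q(1) by (metis dot_square_norm norm_eq_1 orthogonal_matrix_orthonormal_columns power_one)
    \<comment> \<open>An eigenvector u with \<alpha> \<noteq> 0 lies in the range of S although S
      may be singular; w is a preimage, and \<open>inner\<close> at w reads t1 \<alpha> \<le>
      1.\<close>
    define w where "w = (1 / \<alpha> i) *\<^sub>R (K *v (S *v u))"
    have "S *v w = (1 / \<alpha> i) *\<^sub>R (A *v u)"
      by (simp add: w_def A_def matrix_vector_mult_scaleR matrix_vector_mul_assoc matrix_mul_assoc)
    then have Sw: "S *v w = u" using False by (simp add: ev[folded u_def] u_def)
    have Mw: "M *v w = S *v u" by (simp add: S(3)[symmetric] matrix_vector_mul_assoc[symmetric] Sw)
    have "t1 * ((S *v u) \<bullet> (K *v (S *v u))) \<le> w \<bullet> (S *v u)" using inner[of w] by (simp add: Mw)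
    moreover have "w \<bullet> (S *v u) = 1" using Ssym[of w u] uu by (simp add: Sw)
    moreover have "(S *v u) \<bullet> (K *v (S *v u)) = u \<bullet> (A *v u)"
      by (simp only: A_def Ssym matrix_vector_mul_assoc[symmetric])
    moreover have "u \<bullet> (A *v u) = \<alpha> i" using ev[of i] uu by (simp add: u_def)
    ultimately show ?thesis by (simp add: mult.commute)
  qed
  have sum: "0 \<le> (\<Sum>i\<in>UNIV. \<alpha> i)"
  proof -
    have "trace (M ** K) = trace (S ** (S ** K))" by (simp add: S(3)[symmetric] matrix_mul_assoc)
    also have "\<dots> = trace A" by (simp add: A_def trace_mul_sym[of S])
    also have "\<dots> = trace (transpose Q ** (Q ** diag_matrix \<alpha>))"
      by (subst trace_mul_sym) (simp add: Q(2))
    also have "\<dots> = trace (diag_matrix \<alpha>)"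
      using Q(1) by (simp add: matrix_mul_assoc orthogonal_matrix_def)
    also have "\<dots> = (\<Sum>i\<in>UNIV. \<alpha> i)" by (simp add: trace_def diag_matrix_def)
    finally show ?thesis using tr by simp
  qed
  show "0 < det (mat 1 - t *\<^sub>R (M ** K))" 
    "det (mat 1 - t *\<^sub>R (M ** K)) \<le> det (mat 1 - s *\<^sub>R (M ** K))"
    unfolding det using prod_one_minus_antimono[of \<alpha>, OF le sum t] by auto
qed

section \<open>The one-dimensional Riccati equation\<close>

text \<open>For the integrand 1/(1 - x^p/(p-1))^(1/p) the inverse is the p-sine function. The
  integrand may be unbounded at b, which is why continuity is asked for on \<open>{0..y}\<close>
  with y < b and integrability on the whole interval.\<close>

lemma inverse_of_integral:
  fixes I :: "real \<Rightarrow> real"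
  assumes "0 < b" and cont: "\<And>y. y < b \<Longrightarrow> continuous_on {0..y} I"
    and pos: "\<And>x. 0 \<le> x \<Longrightarrow> x < b \<Longrightarrow> 0 < I x"
    and int: "I integrable_on {0..b}"
  shows "\<exists>s. \<forall>t. 0 < t \<and> t < integral {0..b} I \<longrightarrow>
    0 < s t \<and> s t < b \<and> (s has_real_derivative 1 / I (s t)) (at t)"
proof -
  define w where "w x = integral {0..x} I" for x
  have wc: "continuous_on {0..b} w"
    unfolding w_def by (rule indefinite_integral_continuous_1[OF int])
  have wd: "(w has_real_derivative I x) (at x)" if "0 < x" "x < b" for x
  proof -
    define y where "y = (x + b) / 2"
    have y: "x < y" "y < b" using that by (auto simp: y_def)
    have "(w has_real_derivative I x) (at x within {0..y})"
      unfolding w_def by (rule integral_has_real_derivative[OF cont[OF y(2)]]) (use that y in auto)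
    then show ?thesis using that y by (simp add: at_within_Icc_at)
  qed
  have mono: "w x < w y" if "0 \<le> x" "x < y" "y \<le> b" for x y
  proof (rule DERIV_pos_imp_increasing_open[OF that(2)])
    show "\<exists>d. (w has_real_derivative d) (at z) \<and> 0 < d" if "x < z" "z < y" for z
      using wd[of z] pos[of z] that \<open>0 \<le> x\<close> \<open>y \<le> b\<close> by auto
    show "continuous_on {x..y} w"
      using wc by (rule continuous_on_subset) (use that in auto)
  qed
  define s where "s t = (SOME x. 0 \<le> x \<and> x \<le> b \<and> w x = t)" for t
  have w0: "w 0 = 0" by (simp add: w_def)
  have s: "0 < s t \<and> s t < b \<and> w (s t) = t" if "0 < t" "t < w b" for t
  proof -
    have "\<exists>x\<ge>0. x \<le> b \<and> w x = t"
      using IVT'[of w 0 t b] wc that w0 assms(1) by auto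
    then have *: "0 \<le> s t \<and> s t \<le> b \<and> w (s t) = t"
      unfolding s_def by (rule someI2_ex[where P="\<lambda>x. 0 \<le> x \<and> x \<le> b \<and> w x = t"]) auto
    then have "s t \<noteq> 0" "s t \<noteq> b" using that w0 by auto
    with * show ?thesis by auto
  qed
  have sw: "s (w x) = x" if "0 < x" "x < b" for x
  proof -
    have r: "0 < w x" "w x < w b" using mono[of 0 x] mono[of x b] that w0 by auto
    show ?thesis using s[OF r] mono[of "s (w x)" x] mono[of x "s (w x)"] that
      by (cases "s (w x)" x rule: linorder_cases) auto
  qed
  have "(s has_real_derivative inverse (I (s t))) (at t)" if t: "0 < t" "t < w b" for t
  proof (rule DERIV_inverse_function[where f=w and a=0 and b="w b"])
    show "(w has_real_derivative I (s t)) (at (s t))" using wd s[OF t] by auto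
    show "I (s t) \<noteq> 0" using pos[of "s t"] s[OF t] by auto
    have st: "0 < s t" "s t < b" using s[OF t] by auto
    have "isCont s (w (s t))"
    proof (rule isCont_inverse_function2[where f=w and x="s t" and a="s t / 2" and b="(s t + b) / 2"])
      fix z assume "s t / 2 \<le> z" "z \<le> (s t + b) / 2"
      then have z: "0 < z" "z < b" using st by auto
      show "s (w z) = z" by (rule sw[OF z])
      show "isCont w z" by (rule DERIV_isCont[OF wd[OF z]])
    qed (use st in auto)
    then show "isCont s t" using s[OF t] by simp
  qed (use t s in auto)
  with s show ?thesis by (intro exI[of _ s]) (simp add: w_def inverse_eq_divide)
qed

text \<open>Let s be the p-sine function, s' = q(s)^(1/p). Then w(t) = s(c t) satisfies (w'^(p-1))'
  = -c^p w^(p-1), and h = (w'/w)^(p-1) solves the Riccati equation. The first zero of w' is at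
  pi_p/(2c), so this c makes h positive on all of (0, R).\<close>

lemma pi_p_riccati:
  assumes p: "1 < p" and R: "0 < R" and c: "c = (pi_p p / 2) / R" "0 < pi_p p"
  obtains h where "\<And>t. 0 < t \<Longrightarrow> t < R \<Longrightarrow> 0 < h t"
    "\<And>t. 0 < t \<Longrightarrow> t < R \<Longrightarrow>
       (h has_real_derivative - (c powr p) - (p - 1) * h t powr (p / (p - 1))) (at t)"
proof -
  define b where "b = (p - 1) powr (1 / p)"
  define q where "q x = 1 - x powr p / (p - 1)" for x
  define I where "I x = 1 / (q x) powr (1 / p)" for x
  have b: "b > 0" using p by (simp add: b_def)
  have bp: "b powr p = p - 1" using p by (simp add: b_def powr_powr)
  have qpos: "0 < q x" if "0 \<le> x" "x < b" for x
  proof -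
    have "x powr p < b powr p" using that p by (intro powr_less_mono2) auto
    then show ?thesis using p by (simp add: q_def bp field_simps)
  qed
  have Ic: "continuous_on {0..y} I" if "y < b" for y
  proof -
    have "continuous_on {0..y} q" unfolding q_def using p
      by (intro continuous_intros continuous_on_powr') auto
    moreover have "\<forall>x\<in>{0..y}. 0 < q x" using qpos that by auto
    ultimately show ?thesis unfolding I_def
      by (intro continuous_on_divide continuous_on_const continuous_on_powr') (auto simp: less_imp_le)
  qed
  have pp: "pi_p p = 2 * (LINT t:{0..b}|lborel. I t)"
    by (simp add: pi_p_def I_def q_def b_def)
  \<comment> \<open>A Bochner integral that does not exist has the value 0, so
    \<open>0 < pi_p p\<close> forces the integrand to be integrable.\<close>
  have "set_integrable lborel {0..b} I"
    using c(2) unfolding pp set_lebesgue_integral_def set_integrable_def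
    by (metis not_integrable_integral_eq mult_zero_right less_irrefl)
  from set_borel_integral_eq_integral[OF this]
  have int: "I integrable_on {0..b}" "pi_p p / 2 = integral {0..b} I" by (simp_all add: pp)
  have Ipos: "0 < I x" if "0 \<le> x" "x < b" for x using qpos[OF that] by (simp add: I_def)
  obtain s where s: "\<And>t. 0 < t \<Longrightarrow> t < integral {0..b} I \<Longrightarrow> 0 < s t \<and> s t < b"
    and sd: "\<And>t. 0 < t \<Longrightarrow> t < integral {0..b} I \<Longrightarrow> (s has_real_derivative 1 / I (s t)) (at t)"
    using inverse_of_integral[OF b Ic Ipos int(1)] by blast
  \<comment> \<open>This is (s'/s)^(p-1) as a function of x = s, because s' = 1/I(s) =
    q(s)^(1/p).\<close>
  define k where "k x = x powr (1 - p) * q x powr ((p - 1) / p)" for x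
  have kd: "(k has_real_derivative - (p - 1) * x powr (- p) * q x powr ((p - 1) / p) - q x powr (- 1 / p)) (at x)"
    if x: "0 < x" "x < b" for x
  proof -
    have dq: "(q has_real_derivative 0 - p * x powr (p - 1) / (p - 1)) (at x)"
      unfolding q_def using x p 
      by (auto intro!: derivative_eq_intros)
    have q0: "0 < q x" using qpos x by simp
    have "((\<lambda>x. q x powr ((p - 1) / p)) has_real_derivative 
        (p - 1) / p * q x powr ((p - 1) / p - 1) * (0 - p * x powr (p - 1) / (p - 1))) (at x)"
      by (rule DERIV_chain2[OF has_real_derivative_powr[OF q0] dq])
    moreover have "((\<lambda>x. x powr (1 - p)) has_real_derivative (1 - p) * x powr (1 - p - 1)) (at x)"
      by (rule has_real_derivative_powr[OF x(1)])
    ultimately have "(k has_real_derivative x powr (1 - p) * ((p - 1) / p * q x powr ((p - 1) / p - 1) * (0 - p * x powr (p - 1) / (p - 1)))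
       + (1 - p) * x powr (1 - p - 1) * q x powr ((p - 1) / p)) (at x)"
      unfolding k_def by (intro DERIV_mult')
    moreover have "x powr (1 - p) * ((p - 1) / p * q x powr ((p - 1) / p - 1) * (0 - p * x powr (p - 1) / (p - 1)))
       = - (q x powr (- 1 / p))"
    proof -
      have "x powr (1 - p) * x powr (p - 1) = 1" using x by (simp flip: powr_add)
      moreover have "(p - 1) / p - 1 = - 1 / p" using p by (simp add: field_simps)
      moreover have "(p - 1) / p * Q * (0 - p * Y / (p - 1)) = - (Q * Y)" for Q Y
        using p by (simp add: field_simps)
      ultimately show ?thesis by (simp only: mult_minus_right mult.left_commute[of "x powr (1 - p)"] mult_1_right)
    qed
    moreover have "(1 - p) * x powr (1 - p - 1) = - (p - 1) * x powr (- p)" by simp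
    ultimately show ?thesis by (simp add: algebra_simps)
  qed
  define h where "h t = c powr (p - 1) * k (s (c * t))" for t
  have c0: "c > 0" using c R by simp
  have rng: "0 < c * t" "c * t < integral {0..b} I" if "0 < t" "t < R" for t
    using that c0 R int(2) by (auto simp: c(1) field_simps)
  show ?thesis
  proof (rule that[of h])
    fix t assume t: "0 < t" "t < R"
    define x where "x = s (c * t)"
    have x: "0 < x" "x < b" using s[OF rng[OF t]] by (auto simp: x_def)
    have q0: "0 < q x" using qpos x by simp
    show "0 < h t" using c0 x q0 by (simp add: h_def k_def x_def[symmetric])
    have kp: "k x powr (p / (p - 1)) = x powr (- p) * q x"
    proof -
      have "(1 - p) * (p / (p - 1)) = - p" "(p - 1) / p * (p / (p - 1)) = 1" using p by (simp_all add: field_simps)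
      then show ?thesis using x q0 by (simp add: k_def powr_mult powr_powr)
    qed
    have cp: "(c powr (p - 1)) powr (p / (p - 1)) = c powr p" "c powr (p - 1) * c = c powr p"
      using p c0 by (simp add: powr_powr, simp add: powr_diff)
    have "((\<lambda>t. s (c * t)) has_real_derivative 1 / I x * c) (at t)"
      unfolding x_def by (rule DERIV_chain2[where f=s and g="\<lambda>t. c * t", OF sd[OF rng[OF t]]]) (auto intro!: derivative_eq_intros)
    from DERIV_chain2[where f=k and g="\<lambda>t. s (c * t)", OF kd[OF x, unfolded x_def] this]
    have "(h has_real_derivative c powr (p - 1) * ((- (p - 1) * x powr (- p) * q x powr ((p - 1) / p) - q x powr (- 1 / p)) * (1 / I x * c))) (at t)"
      unfolding h_def x_def by (rule DERIV_cmult)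
    moreover have "c powr (p - 1) * ((- (p - 1) * x powr (- p) * q x powr ((p - 1) / p) - q x powr (- 1 / p)) * (1 / I x * c))
       = - (c powr p) - (p - 1) * h t powr (p / (p - 1))"
    proof -
      have i: "1 / I x = q x powr (1 / p)" by (simp add: I_def)
      have e: "q x powr ((p - 1) / p) * q x powr (1 / p) = q x" "q x powr (- 1 / p) * q x powr (1 / p) = 1"
        using q0 p by (simp_all add: field_simps flip: powr_add)
      have "h t powr (p / (p - 1)) = c powr p * (x powr (- p) * q x)"
        using x q0 c0 by (simp add: h_def x_def[symmetric] powr_mult cp kp k_def del: powr_powr)
          (simp add: kp[unfolded k_def] flip: powr_mult)
      moreover have "c powr (p - 1) * ((- (p - 1) * x powr (- p) * q x powr ((p - 1) / p) - q x powr (- 1 / p)) * (1 / I x * c))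
        = (c powr (p - 1) * c) * (- (p - 1) * x powr (- p) * (q x powr ((p - 1) / p) * q x powr (1 / p)) - q x powr (- 1 / p) * q x powr (1 / p))"
        unfolding i by (simp add: algebra_simps)
      ultimately show ?thesis unfolding e cp by (simp add: algebra_simps)
    qed
    ultimately show "(h has_real_derivative - (c powr p) - (p - 1) * h t powr (p / (p - 1))) (at t)" by simp
  qed
qed

section \<open>Change of variables over an arbitrary finite index type\<close>

text \<open>
  The change-of-variables theorem of the library requires a well-ordered index type. Coordinates
  are therefore renamed along a bijection with an initial segment of the natural numbers.
\<close>

typedef ('a::finite) fin_index = "{..<CARD('a)}"
  by (auto intro!: exI[of _ 0])

instantiation fin_index :: (finite) linorder
begin
definition less_eq_fin_index :: "'a fin_index \<Rightarrow> 'a fin_index \<Rightarrow> bool"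
  where "less_eq_fin_index x y \<longleftrightarrow> Rep_fin_index x \<le> Rep_fin_index y"
definition less_fin_index :: "'a fin_index \<Rightarrow> 'a fin_index \<Rightarrow> bool"
  where "less_fin_index x y \<longleftrightarrow> Rep_fin_index x < Rep_fin_index y"
instance
  by standard (auto simp: less_eq_fin_index_def less_fin_index_def Rep_fin_index_inject)
end

instance fin_index :: (finite) wellorder
proof
  fix P :: "'a fin_index \<Rightarrow> bool" and a
  assume step: "\<And>x. (\<And>y. y < x \<Longrightarrow> P y) \<Longrightarrow> P x"
  show "P a"
    by (induction a rule: measure_induct_rule[of Rep_fin_index])
       (rule step, simp add: less_fin_index_def)
qed

lemma bij_betw_Rep_fin_index: "bij_betw Rep_fin_index (UNIV :: 'a::finite fin_index set) {..<CARD('a)}"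
  using type_definition.Rep_range[OF type_definition_fin_index]
  by (auto simp: bij_betw_def inj_on_def Rep_fin_index_inject)

instance fin_index :: (finite) finite
  by standard (use bij_betw_finite[OF bij_betw_Rep_fin_index] in simp)

lemma ex_bij_fin_index: "\<exists>\<sigma> :: 'n::finite fin_index \<Rightarrow> 'n. bij \<sigma>"
proof -
  have "card (UNIV :: 'n fin_index set) = card (UNIV :: 'n set)"
    using bij_betw_same_card[OF bij_betw_Rep_fin_index[where 'a='n]] by simp
  then show ?thesis by (intro finite_same_card_bij) auto
qed

lemma lborel_distr_reindex:
  fixes \<sigma> :: "'m::finite \<Rightarrow> 'n::finite"
  assumes "bij \<sigma>"
  shows "distr lborel borel (\<lambda>x::real^'n. \<chi> i. x $ \<sigma> i) = (lborel :: (real^'m) measure)"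
proof (rule lborel_eqI[symmetric])
  let ?T = "\<lambda>x::real^'n. \<chi> i. x $ \<sigma> i"
  let ?T' = "\<lambda>y::real^'m. \<chi> j. y $ inv \<sigma> j"
  have s: "\<sigma> (inv \<sigma> j) = j" "inv \<sigma> (\<sigma> i) = i" for i j
    using assms by (simp_all add: bij_is_surj surj_f_inv_f bij_is_inj)
  have T: "?T \<in> measurable lborel borel"
    by (subst measurable_lborel2) (intro borel_measurable_continuous_onI continuous_on_vec_lambda continuous_intros)
  have prod_Basis: "(\<Prod>b\<in>Basis. (x::real^'k) \<bullet> b) = (\<Prod>i\<in>UNIV. x $ i)" for x
    by (subst prod.reindex_bij_betw[of "\<lambda>i. axis i 1" UNIV Basis, symmetric])
       (auto simp: bij_betw_def inj_on_def axis_eq_axis Basis_vec_def inner_axis)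
  fix l u :: "real^'m" assume le: "\<And>b. b \<in> Basis \<Longrightarrow> l \<bullet> b \<le> u \<bullet> b"
  have le': "l $ i \<le> u $ i" for i
    using le[of "axis i 1"] by (simp add: inner_axis axis_in_Basis_iff)
  have "?T -` box l u = box (?T' l) (?T' u)"
  proof -
    have "(\<forall>i. l $ i < x $ \<sigma> i \<and> x $ \<sigma> i < u $ i) \<longleftrightarrow> (\<forall>j. l $ inv \<sigma> j < x $ j \<and> x $ j < u $ inv \<sigma> j)" for x
      using s by metis
    then show ?thesis by (auto simp: mem_box_cart)
  qed
  then have "emeasure (distr lborel borel ?T) (box l u) = emeasure lborel (box (?T' l) (?T' u))"
    by (subst emeasure_distr[OF T]) auto
  also have "\<dots> = (\<Prod>b\<in>Basis. (?T' u - ?T' l) \<bullet> b)"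
    by (rule emeasure_lborel_box) (auto simp: Basis_vec_def inner_axis le')
  also have "(\<Prod>b\<in>Basis. (?T' u - ?T' l) \<bullet> b) = (\<Prod>j\<in>UNIV. u $ inv \<sigma> j - l $ inv \<sigma> j)"
    by (simp add: prod_Basis)
  also have "\<dots> = (\<Prod>i\<in>UNIV. u $ i - l $ i)"
    using assms by (intro prod.reindex_bij_betw) (rule bij_imp_bij_inv)
  also have "\<dots> = (\<Prod>b\<in>Basis. (u - l) \<bullet> b)" by (simp add: prod_Basis)
  finally show "emeasure (distr lborel borel ?T) (box l u) = ennreal (\<Prod>b\<in>Basis. (u - l) \<bullet> b)" .
qed simp

text \<open>A Lebesgue set is a Borel set up to a subset of a Borel null set, and renaming
  coordinates preserves \<open>lborel\<close>; this extends the invariance to the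
  completion.\<close>

lemma lebesgue_reindex_measurable:
  fixes \<sigma> :: "'m::finite \<Rightarrow> 'n::finite"
  assumes "bij \<sigma>"
  shows "(\<lambda>x::real^'n. \<chi> i. x $ \<sigma> i) \<in> measurable lebesgue (lebesgue :: (real^'m) measure)"
    and "distr lebesgue lebesgue (\<lambda>x::real^'n. \<chi> i. x $ \<sigma> i) = (lebesgue :: (real^'m) measure)"
proof -
  let ?T = "\<lambda>x::real^'n. \<chi> i. x $ \<sigma> i"
  have T: "?T \<in> measurable lborel borel"
    by (subst measurable_lborel2) (intro borel_measurable_continuous_onI continuous_on_vec_lambda continuous_intros)
  have sT: "?T -` S \<in> sets lborel" if "S \<in> sets borel" for S
    using measurable_sets[OF T that] by simp
  have eT: "emeasure lborel (?T -` S) = emeasure lborel S" if "S \<in> sets borel" for S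
    using emeasure_distr[OF T that] lborel_distr_reindex[OF assms] by simp
  have key: "?T -` A \<in> sets lebesgue \<and> emeasure lebesgue (?T -` A) = emeasure lebesgue A"
    if A: "A \<in> sets lebesgue" for A
  proof -
    obtain S N N' where SN: "A = S \<union> N" "N \<subseteq> N'" "N' \<in> null_sets lborel" "S \<in> sets lborel"
      using A by (rule sets_completionE)
    have n: "?T -` N' \<in> null_sets lborel"
      using SN(3) sT[of N'] eT[of N'] by (auto simp: null_sets_def)
    have 1: "?T -` A \<in> sets lebesgue"
      by (rule sets_completionI[of _ "?T -` S" "?T -` N" "?T -` N'"])
         (use SN n sT[of S] in auto)
    have "emeasure lebesgue (?T -` A) = emeasure lebesgue (?T -` S)"
    proof (rule emeasure_eq_AE)
      show "AE x in lebesgue. x \<in> ?T -` A \<longleftrightarrow> x \<in> ?T -` S"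
        by (rule AE_I'[OF null_sets_completionI[OF n]]) (use SN in auto)
    qed (use 1 sT[of S] SN in auto)
    also have "\<dots> = emeasure lebesgue S" using sT[of S] eT[of S] SN by simp
    also have "\<dots> = emeasure lebesgue A"
    proof (rule emeasure_eq_AE)
      show "AE x in lebesgue. x \<in> S \<longleftrightarrow> x \<in> A"
        by (rule AE_I'[OF null_sets_completionI[OF SN(3)]]) (use SN in auto)
    qed (use A SN in auto)
    finally show ?thesis using 1 by simp
  qed
  show m: "?T \<in> measurable lebesgue (lebesgue :: (real^'m) measure)"
    by (rule measurableI) (use key in auto)
  show "distr lebesgue lebesgue ?T = (lebesgue :: (real^'m) measure)"
  proof (rule measure_eqI)
    fix A assume "A \<in> sets (distr lebesgue lebesgue ?T)"
    then have A: "A \<in> sets lebesgue" by simp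
    show "emeasure (distr lebesgue lebesgue ?T) A = emeasure lebesgue A"
      using conjunct2[OF key[OF A]] emeasure_distr[OF m A] by (simp only: space_completion space_lborel space_borel Int_UNIV_right)
  qed simp
qed

lemma integrable_lebesgue_reindex:
  fixes \<sigma> :: "'m::finite \<Rightarrow> 'n::finite" and f :: "real^'m \<Rightarrow> real"
  assumes "bij \<sigma>"
  shows "integrable lebesgue (\<lambda>x::real^'n. f (\<chi> i. x $ \<sigma> i)) \<longleftrightarrow> integrable lebesgue f" (is ?I)
    and "(LINT x|lebesgue. f (\<chi> i. (x::real^'n) $ \<sigma> i)) = (LINT x|lebesgue. f x)"
proof -
  have *: "integrable lebesgue (\<lambda>x::real^'b. f (\<chi> i. x $ \<tau> i)) \<and>
      (LINT x|lebesgue. f (\<chi> i. (x::real^'b) $ \<tau> i)) = (LINT x|lebesgue. f x)"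
    if "bij \<tau>" "integrable lebesgue f" for \<tau> :: "'a::finite \<Rightarrow> 'b::finite" and f :: "real^'a \<Rightarrow> real"
  proof -
    note T = lebesgue_reindex_measurable[OF that(1)]
    have m: "f \<in> borel_measurable lebesgue" using that(2) by simp
    show ?thesis
      using integrable_distr_eq[OF T(1) m] integral_distr[OF T(1) m] that(2) unfolding T(2) by simp
  qed
  show I: ?I
  proof
    assume "integrable lebesgue (\<lambda>x::real^'n. f (\<chi> i. x $ \<sigma> i))"
    from *[OF bij_imp_bij_inv[OF assms] this] show "integrable lebesgue f"
      using assms by (simp add: bij_is_inj)
  qed (use *[OF assms] in blast)
  show "(LINT x|lebesgue. f (\<chi> i. (x::real^'n) $ \<sigma> i)) = (LINT x|lebesgue. f x)"
  proof (cases "integrable lebesgue f")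
    case True
    then show ?thesis using *[OF assms] by blast
  next
    case False
    then show ?thesis using I by (simp add: not_integrable_integral_eq)
  qed
qed

text \<open>Conjugation by \<sigma> maps permutations of one index type to those of the other and
  preserves signs; it matches the two Leibniz sums term by term.\<close>

lemma det_reindex:
  fixes \<sigma> :: "'m::finite \<Rightarrow> 'n::finite" and A :: "real^'n^'n"
  assumes \<sigma>: "bij \<sigma>"
  shows "det (\<chi> i j. A $ \<sigma> i $ \<sigma> j) = det A"
proof -
  have s: "\<sigma> (inv \<sigma> j) = j" "inv \<sigma> (\<sigma> i) = i" for i j
    using assms by (simp_all add: bij_is_surj surj_f_inv_f bij_is_inj)
  have pm: "\<sigma> \<circ> p \<circ> inv \<sigma> permutes UNIV" "sign (\<sigma> \<circ> p \<circ> inv \<sigma>) = sign p" if "p permutes UNIV" for p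
  proof -
    have eq: "map_permutation UNIV \<sigma> p = \<sigma> \<circ> p \<circ> inv \<sigma>"
      using bij_is_surj[OF \<sigma>] by (simp add: map_permutation_def restrict_id_def o_def)
    show "sign (\<sigma> \<circ> p \<circ> inv \<sigma>) = sign p"
      using sign_map_permutation[OF bij_is_inj[OF \<sigma>] that] by (simp add: eq)
    have "bij (\<sigma> \<circ> p \<circ> inv \<sigma>)"
      using \<sigma> that by (intro bij_comp permutes_bij bij_imp_bij_inv)
    then show "\<sigma> \<circ> p \<circ> inv \<sigma> permutes UNIV" by (intro bij_imp_permutes) auto
  qed
  have "(\<Sum>p\<in>{p. p permutes UNIV}. of_int (sign p) * (\<Prod>i\<in>UNIV. A $ \<sigma> i $ \<sigma> (p i)))
      = (\<Sum>q\<in>{q. q permutes UNIV}. of_int (sign q) * (\<Prod>j\<in>UNIV. A $ j $ q j))"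
  proof (rule sum.reindex_bij_witness[of _ "\<lambda>q. inv \<sigma> \<circ> q \<circ> \<sigma>" "\<lambda>p. \<sigma> \<circ> p \<circ> inv \<sigma>"])
    fix p assume p: "p \<in> {p. p permutes (UNIV::'m set)}"
    show "inv \<sigma> \<circ> (\<sigma> \<circ> p \<circ> inv \<sigma>) \<circ> \<sigma> = p" by (simp add: fun_eq_iff s)
    show "\<sigma> \<circ> p \<circ> inv \<sigma> \<in> {q. q permutes UNIV}" using pm p by simp
    have "(\<Prod>j\<in>UNIV. A $ j $ (\<sigma> \<circ> p \<circ> inv \<sigma>) j) = (\<Prod>i\<in>UNIV. A $ \<sigma> i $ (\<sigma> \<circ> p \<circ> inv \<sigma>) (\<sigma> i))"
      by (rule prod.reindex_bij_betw[OF \<sigma>, symmetric])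
    then show "of_int (sign (\<sigma> \<circ> p \<circ> inv \<sigma>)) * (\<Prod>j\<in>UNIV. A $ j $ (\<sigma> \<circ> p \<circ> inv \<sigma>) j)
        = of_int (sign p) * (\<Prod>i\<in>UNIV. A $ \<sigma> i $ \<sigma> (p i))"
      using pm p by (simp add: s)
  next
    fix q assume q: "q \<in> {q. q permutes (UNIV::'n set)}"
    show "\<sigma> \<circ> (inv \<sigma> \<circ> q \<circ> \<sigma>) \<circ> inv \<sigma> = q" by (simp add: fun_eq_iff s)
    have "bij (inv \<sigma> \<circ> q \<circ> \<sigma>)"
      using \<sigma> q by (intro bij_comp permutes_bij bij_imp_bij_inv) auto
    then show "inv \<sigma> \<circ> q \<circ> \<sigma> \<in> {p. p permutes UNIV}" by (auto intro: bij_imp_permutes)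
  qed
  then show ?thesis by (simp add: det_def)
qed

text \<open>The integrand is turned into a multiple of the unit vector of real^1 to fit the form of
  \<open>has_absolute_integral_change_of_variables\<close>; the inner product with that vector
  brings it back.\<close>

lemma change_of_variables_real:
  fixes f :: "real^'m::{finite,wellorder} \<Rightarrow> real" and g :: "real^'m::_ \<Rightarrow> real^'m::_"
  assumes S: "S \<in> sets lebesgue"
    and der_g: "\<And>x. x \<in> S \<Longrightarrow> (g has_derivative (\<lambda>h. G x *v h)) (at x within S)"
    and inj: "inj_on g S" and f: "set_integrable lebesgue (g ` S) f"
  shows "set_integrable lebesgue S (\<lambda>x. \<bar>det (G x)\<bar> * f (g x))"
    and "(LINT x:S|lebesgue. \<bar>det (G x)\<bar> * f (g x)) = (LINT x:g ` S|lebesgue. f x)"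
proof -
  define a :: "real^1" where "a = axis 1 1"
  have aa: "a \<bullet> a = 1" by (simp add: a_def inner_axis_axis)
  define h where "h x = f x *\<^sub>R a" for x
  have h: "h absolutely_integrable_on (g ` S)"
    using f unfolding set_integrable_def h_def scaleR_scaleR[symmetric]
    using integrable_scaleR_left[of a lebesgue "\<lambda>x. indicat_real (g ` S) x *\<^sub>R f x"] by simp
  have "(\<lambda>x. \<bar>det (matrix ((*v) (G x)))\<bar> *\<^sub>R h (g x)) absolutely_integrable_on S \<and>
      integral S (\<lambda>x. \<bar>det (matrix ((*v) (G x)))\<bar> *\<^sub>R h (g x)) = integral (g ` S) h"
    using has_absolute_integral_change_of_variables[OF S der_g inj, of h "integral (g ` S) h"] h by simp
  then have 1: "(\<lambda>x. \<bar>det (G x)\<bar> *\<^sub>R h (g x)) absolutely_integrable_on S"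
    and 2: "integral S (\<lambda>x. \<bar>det (G x)\<bar> *\<^sub>R h (g x)) = integral (g ` S) h"
    by simp_all
  show I: "set_integrable lebesgue S (\<lambda>x. \<bar>det (G x)\<bar> * f (g x))"
    using 1[unfolded set_integrable_def]
      integrable_inner_left[of a lebesgue "\<lambda>x. indicat_real S x *\<^sub>R \<bar>det (G x)\<bar> *\<^sub>R h (g x)"]
    unfolding set_integrable_def by (simp add: h_def aa)
  have "(LINT x:S|lebesgue. \<bar>det (G x)\<bar> * f (g x)) *\<^sub>R a = (LINT x:S|lebesgue. \<bar>det (G x)\<bar> *\<^sub>R h (g x))"
    using I unfolding set_lebesgue_integral_def set_integrable_def h_def
    by (simp flip: integral_scaleR_left)
  also have "\<dots> = integral S (\<lambda>x. \<bar>det (G x)\<bar> *\<^sub>R h (g x))"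
    by (rule set_lebesgue_integral_eq_integral(2)[OF 1])
  also have "\<dots> = (LINT x:g ` S|lebesgue. h x)"
    unfolding 2 by (rule set_lebesgue_integral_eq_integral(2)[OF h, symmetric])
  also have "\<dots> = (LINT x:g ` S|lebesgue. f x) *\<^sub>R a"
    using f unfolding set_lebesgue_integral_def set_integrable_def h_def
    by (simp flip: integral_scaleR_left)
  finally have "((LINT x:S|lebesgue. \<bar>det (G x)\<bar> * f (g x)) *\<^sub>R a) \<bullet> a = ((LINT x:g ` S|lebesgue. f x) *\<^sub>R a) \<bullet> a"
    by (rule arg_cong)
  then show "(LINT x:S|lebesgue. \<bar>det (G x)\<bar> * f (g x)) = (LINT x:g ` S|lebesgue. f x)" by (simp add: aa)
qed

text \<open>The map is conjugated by the renaming T with inverse U, which affects neither the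
  measure nor the determinant nor injectivity.\<close>

lemma change_of_variables_finite:
  fixes f :: "real^'n \<Rightarrow> real" and g :: "real^'n \<Rightarrow> real^'n"
  assumes S: "S \<in> sets lebesgue"
    and der_g: "\<And>x. x \<in> S \<Longrightarrow> (g has_derivative (\<lambda>h. G x *v h)) (at x within S)"
    and inj: "inj_on g S" and f: "set_integrable lebesgue (g ` S) f"
  shows "set_integrable lebesgue S (\<lambda>x. \<bar>det (G x)\<bar> * f (g x))"
    and "(LINT x:S|lebesgue. \<bar>det (G x)\<bar> * f (g x)) = (LINT x:g ` S|lebesgue. f x)"
proof -
  obtain \<sigma> :: "'n fin_index \<Rightarrow> 'n" where \<sigma>: "bij \<sigma>" using ex_bij_fin_index by blast
  define T where "T x = (\<chi> i. x $ \<sigma> i)" for x :: "real^'n"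
  define U where "U y = (\<chi> j. y $ inv \<sigma> j)" for y :: "real^'n fin_index"
  have s: "\<sigma> (inv \<sigma> j) = j" "inv \<sigma> (\<sigma> i) = i" for i j
    using \<sigma> by (simp_all add: bij_is_surj surj_f_inv_f bij_is_inj)
  have TU: "T (U y) = y" "U (T x) = x" for x y by (simp_all add: T_def U_def s)
  have lin: "linear T" "linear U" by (auto simp: T_def U_def linear_iff vec_eq_iff)
  define G' where "G' y = (\<chi> i j. G (U y) $ \<sigma> i $ \<sigma> j)" for y
  define S' where "S' = U -` S"
  define g' where "g' y = T (g (U y))" for y
  have S': "S' \<in> sets lebesgue"
    using measurable_sets[OF lebesgue_reindex_measurable(1)[OF bij_imp_bij_inv[OF \<sigma>]] S]
    by (simp add: S'_def U_def vimage_def)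
  have US: "U ` S' = S" using surjI[of U T] TU unfolding S'_def by (intro surj_image_vimage_eq) auto
  have G': "T (G (U y) *v U h) = G' y *v h" for y h
    by (simp add: T_def G'_def matrix_vector_mult_def vec_eq_iff U_def)
       (subst sum.reindex_bij_betw[OF \<sigma>, symmetric], simp add: s)
  have der': "(g' has_derivative (\<lambda>h. G' y *v h)) (at y within S')" if "y \<in> S'" for y
  proof -
    have "(g has_derivative (\<lambda>h. G (U y) *v h)) (at (U y) within U ` S')"
      using der_g[of "U y"] that unfolding US by (simp add: S'_def)
    moreover have "(U has_derivative U) (at y within S')"
      using lin by (intro bounded_linear_imp_has_derivative) (simp add: linear_linear)
    ultimately have "((\<lambda>y. g (U y)) has_derivative (\<lambda>h. G (U y) *v U h)) (at y within S')"
      by (rule has_derivative_in_compose[rotated])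
    moreover have "bounded_linear T" using lin by (simp add: linear_linear)
    ultimately have "((\<lambda>y. T (g (U y))) has_derivative (\<lambda>h. T (G (U y) *v U h))) (at y within S')"
      by (rule bounded_linear.has_derivative[rotated])
    then show ?thesis by (simp add: g'_def[abs_def] G')
  qed
  have inj': "inj_on g' S'"
  proof (rule inj_onI)
    fix y z assume yz: "y \<in> S'" "z \<in> S'" "g' y = g' z"
    then have "U (T (g (U y))) = U (T (g (U z)))" by (simp only: g'_def)
    then have "g (U y) = g (U z)" by (simp only: TU(2))
    then have "U y = U z" using inj yz by (auto simp: S'_def dest: inj_onD)
    then have "T (U y) = T (U z)" by (simp only:)
    then show "y = z" by (simp only: TU(1))
  qed
  have img: "y \<in> g' ` S' \<longleftrightarrow> U y \<in> g ` S" for y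
  proof
    assume "y \<in> g' ` S'"
    then obtain z where "z \<in> S'" "y = T (g (U z))" by (auto simp: g'_def)
    then show "U y \<in> g ` S" using US by (auto simp: TU(2))
  next
    assume "U y \<in> g ` S"
    then obtain x where x: "x \<in> S" "U y = g x" by blast
    have "y = T (U y)" by (simp only: TU(1))
    also have "\<dots> = g' (T x)" by (simp only: g'_def x TU(2))
    finally show "y \<in> g' ` S'" using x TU(2) by (auto simp: S'_def)
  qed
  have ind: "indicator (g' ` S') y = (indicator (g ` S) (U y) :: real)" for y
    by (simp add: indicator_def img)
  have indS: "indicator S' y = (indicator S (U y) :: real)" for y
    by (simp add: indicator_def S'_def)
  have det: "det (G' y) = det (G (U y))" for y unfolding G'_def by (rule det_reindex[OF \<sigma>])
  note tr = integrable_lebesgue_reindex[OF bij_imp_bij_inv[OF \<sigma>], folded U_def]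
  have f': "set_integrable lebesgue (g' ` S') (\<lambda>y. f (U y))"
    using f tr(1)[of "\<lambda>x. indicator (g ` S) x *\<^sub>R f x"] by (simp only: set_integrable_def ind)
  have gU: "f (U (g' y)) = f (g (U y))" for y by (simp add: g'_def TU)
  note cv = change_of_variables_real[OF S' der' inj' f', unfolded det gU]
  define F1 where "F1 x = indicator S x *\<^sub>R (\<bar>det (G x)\<bar> * f (g x))" for x
  define F2 where "F2 x = indicator (g ` S) x *\<^sub>R f x" for x
  have "integrable lebesgue (\<lambda>y. F1 (U y))"
    using cv(1) by (simp only: F1_def set_integrable_def indS)
  then have "integrable lebesgue F1" using tr(1)[of F1] by blast
  then show "set_integrable lebesgue S (\<lambda>x. \<bar>det (G x)\<bar> * f (g x))"
    by (simp only: set_integrable_def F1_def[abs_def])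
  have "(LINT y|lebesgue. F1 (U y)) = (LINT y|lebesgue. F2 (U y))"
    using cv(2) by (simp only: F1_def F2_def set_lebesgue_integral_def indS ind)
  then have "(LINT x|lebesgue. F1 x) = (LINT x|lebesgue. F2 x)"
    using tr(2)[of F1] tr(2)[of F2] by (simp only:)
  then show "(LINT x:S|lebesgue. \<bar>det (G x)\<bar> * f (g x)) = (LINT x:g ` S|lebesgue. f x)"
    by (simp only: set_lebesgue_integral_def F1_def[abs_def] F2_def[abs_def])
qed

section \<open>Geometry of the anisotropic distance\<close>

lemma has_vector_derivative_quotient:
  fixes f :: "real \<Rightarrow> 'a::euclidean_space"
  assumes "(f has_vector_derivative v) (at 0)"
  shows "((\<lambda>s. (f s - f 0) /\<^sub>R s) \<longlongrightarrow> v) (at 0)"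
proof (rule tendsto_componentwise_iff[THEN iffD2], rule ballI)
  fix b :: 'a assume "b \<in> Basis"
  from has_derivative_inner_left[OF assms[unfolded has_vector_derivative_def], of b]
  have "((\<lambda>s. f s \<bullet> b) has_real_derivative v \<bullet> b) (at 0)"
    unfolding has_field_derivative_def by (rule has_derivative_eq_rhs) (simp add: fun_eq_iff mult.commute)
  then show "((\<lambda>s. ((f s - f 0) /\<^sub>R s) \<bullet> b) \<longlongrightarrow> v \<bullet> b) (at 0)"
    by (simp add: has_field_derivative_iff inner_diff_left divide_inverse mult.commute)
qed

definition graph_point :: "real^'n \<Rightarrow> (real^'n \<Rightarrow> real) \<Rightarrow> real^'n \<Rightarrow> real^'n" where
  "graph_point e \<gamma> w = w - (w \<bullet> e) *\<^sub>R e + \<gamma> w *\<^sub>R e"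

text \<open>The differential of \<open>graph_point e \<gamma>\<close> at w, applied to h.\<close>

definition graph_tangent :: "real^'n \<Rightarrow> (real^'n \<Rightarrow> real) \<Rightarrow> real^'n \<Rightarrow> real^'n \<Rightarrow> real^'n" where
  "graph_tangent e \<gamma> w h = h - (h \<bullet> e) *\<^sub>R e + (grad \<gamma> w \<bullet> h) *\<^sub>R e"

locale finsler_domain = finsler_norm F a for F :: "real^'n \<Rightarrow> real" and a :: real +
  fixes \<Omega> :: "(real^'n) set"
  assumes \<Omega>_open: "open \<Omega>" and \<Omega>_bounded: "bounded \<Omega>" and \<Omega>_nonempty: "\<Omega> \<noteq> {}"
    and \<Omega>_C2: "C_k_boundary 2 \<Omega>"
begin

abbreviation "d \<equiv> aniso_dist F \<Omega>"

lemma frontier_compact: "compact (frontier \<Omega>)"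
  by (rule compact_frontier_bounded[OF \<Omega>_bounded])

lemma frontier_nonempty: "frontier \<Omega> \<noteq> {}"
  using \<Omega>_nonempty \<Omega>_bounded not_bounded_UNIV frontier_not_empty by metis

lemma frontier_disjoint: "x \<in> frontier \<Omega> \<Longrightarrow> x \<notin> \<Omega>"
  using \<Omega>_open by (simp add: frontier_def interior_open)

lemma dist_le: "y \<in> frontier \<Omega> \<Longrightarrow> d x \<le> polar F (x - y)"
  unfolding aniso_dist_def by (rule cINF_lower) (auto intro!: bdd_belowI2[where m=0] polar_nonneg)

lemma dist_attained: obtains y where "y \<in> frontier \<Omega>" "polar F (x - y) = d x"
proof -
  have "continuous_on (frontier \<Omega>) (\<lambda>y. polar F (x - y))"
    by (rule continuous_on_compose2[OF polar_continuous]) (auto intro!: continuous_intros)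
  then obtain y where y: "y \<in> frontier \<Omega>" "\<And>z. z \<in> frontier \<Omega> \<Longrightarrow> polar F (x - y) \<le> polar F (x - z)"
    using continuous_attains_inf[OF frontier_compact frontier_nonempty] by blast
  then have "polar F (x - y) \<le> d x"
    unfolding aniso_dist_def by (intro cINF_greatest frontier_nonempty)
  with dist_le[OF y(1), of x] y(1) that show ?thesis by force
qed

lemma dist_triangle_polar: "d x \<le> d z + polar F (x - z)"
proof -
  obtain y where y: "y \<in> frontier \<Omega>" "polar F (z - y) = d z" by (rule dist_attained)
  have "d x \<le> polar F ((x - z) + (z - y))" using dist_le[OF y(1), of x] by simp
  also have "\<dots> \<le> polar F (x - z) + d z" using polar_subadditive[of "x - z" "z - y"] y(2) by simp
  finally show ?thesis by simp
qed

lemma dist_continuous: "continuous_on UNIV d"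
proof (rule lipschitz_on_continuous_on)
  show "(1 / a)-lipschitz_on UNIV d"
  proof (rule lipschitz_onI)
    fix x z
    show "dist (d x) (d z) \<le> 1 / a * dist x z"
      using dist_triangle_polar[of x z] dist_triangle_polar[of z x] polar_norm[of "x - z"] polar_norm[of "z - x"]
      by (simp add: dist_norm norm_minus_commute abs_le_iff)
  qed (use a_pos in auto)
qed

lemma dist_pos: assumes "x \<in> \<Omega>" shows "0 < d x"
proof -
  obtain y where y: "y \<in> frontier \<Omega>" "polar F (x - y) = d x" by (rule dist_attained)
  then have "x - y \<noteq> 0" using frontier_disjoint assms by auto
  then show ?thesis using polar_pos y(2) by metis
qed

lemma dist_le_inradius: assumes "x \<in> \<Omega>" shows "d x \<le> aniso_inradius F \<Omega>"
  unfolding aniso_inradius_def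
proof (rule cSUP_upper[OF assms])
  obtain y where y: "y \<in> frontier \<Omega>" using frontier_nonempty by blast
  obtain B where B: "\<And>x. x \<in> \<Omega> \<Longrightarrow> norm x \<le> B" using \<Omega>_bounded by (auto simp: bounded_iff)
  show "bdd_above (d ` \<Omega>)"
  proof (rule bdd_aboveI2)
    fix x assume "x \<in> \<Omega>"
    then have "norm (x - y) \<le> B + norm y" using B[of x] norm_triangle_ineq4[of x y] by simp
    then show "d x \<le> (B + norm y) / a"
      using dist_le[OF y, of x] polar_norm[of "x - y"] a_pos by (smt (verit) divide_right_mono)
  qed
qed

text \<open>The segment from x to a point outside \<open>\<Omega>\<close> crosses the boundary, at
  polar distance at most that of its end point.\<close>

lemma polar_ball_subset:
  assumes "x \<in> \<Omega>" "polar F (x - z) < d x" shows "z \<in> \<Omega>"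
proof (rule ccontr)
  assume "z \<notin> \<Omega>"
  then have "closed_segment x z \<inter> frontier \<Omega> \<noteq> {}"
    using assms(1) by (intro connected_Int_frontier connected_segment) auto
  then obtain s where s: "0 \<le> s" "s \<le> 1" "(1 - s) *\<^sub>R x + s *\<^sub>R z \<in> frontier \<Omega>"
    by (auto simp: closed_segment_def)
  have "d x \<le> polar F (x - ((1 - s) *\<^sub>R x + s *\<^sub>R z))" by (rule dist_le[OF s(3)])
  also have "x - ((1 - s) *\<^sub>R x + s *\<^sub>R z) = s *\<^sub>R (x - z)" by (simp add: algebra_simps)
  also have "polar F (s *\<^sub>R (x - z)) \<le> s * polar F (x - z)" by (rule polar_scale_le[OF s(1)])
  also have "\<dots> \<le> polar F (x - z)" using s polar_nonneg by (simp add: mult_left_le_one_le)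
  finally show False using assms(2) by simp
qed

lemma polar_cball_closure:
  assumes "x \<in> \<Omega>" "polar F (x - z) \<le> d x" shows "z \<in> closure \<Omega>"
proof -
  define q where "q n = x + (1 - inverse (real (Suc n))) *\<^sub>R (z - x)" for n
  have "q n \<in> \<Omega>" for n
  proof (rule polar_ball_subset[OF assms(1)])
    have i: "0 \<le> 1 - inverse (real (Suc n))" "1 - inverse (real (Suc n)) < 1" by (auto simp: inverse_le_1_iff)
    have "polar F (x - q n) = polar F ((1 - inverse (real (Suc n))) *\<^sub>R (x - z))"
      by (simp add: q_def algebra_simps)
    also have "\<dots> \<le> (1 - inverse (real (Suc n))) * polar F (x - z)" by (rule polar_scale_le[OF i(1)])
    also have "\<dots> \<le> (1 - inverse (real (Suc n))) * d x" using i assms(2) by (intro mult_left_mono)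
    also have "\<dots> < 1 * d x" using i(2) dist_pos[OF assms(1)] by (rule mult_strict_right_mono)
    finally show "polar F (x - q n) < d x" by simp
  qed
  moreover have "q \<longlonglongrightarrow> x + (1 - 0) *\<^sub>R (z - x)"
    unfolding q_def by (intro tendsto_intros LIMSEQ_inverse_real_of_nat)
  ultimately show ?thesis unfolding closure_sequential by (intro exI[of _ q]) auto
qed

section \<open>Calculus in a boundary chart\<close>

context
  fixes x0 r e \<gamma>
  assumes chart: "boundary_chart \<Omega> x0 r e \<gamma>"
begin

abbreviation (input) "gpt \<equiv> graph_point e \<gamma>"
abbreviation (input) "gtan \<equiv> graph_tangent e \<gamma>"
text \<open>The gradient of the height \<open>x \<bullet> e - \<gamma> x\<close>, hence an inward
  conormal; it is left unnormalised because the gradient of F does not change under positive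
  scaling.\<close>

abbreviation (input) "n w \<equiv> e - grad \<gamma> w"

lemma
  shows ee: "e \<bullet> e = 1" and \<gamma>_C2: "C_k_on 2 UNIV \<gamma>" and \<gamma>_inv: "\<gamma> (w + t *\<^sub>R e) = \<gamma> w"
    and in_\<Omega>: "w \<in> ball x0 r \<Longrightarrow> w \<in> \<Omega> \<longleftrightarrow> \<gamma> w < w \<bullet> e"
  using chart by (auto simp: boundary_chart_def dot_square_norm)

lemma \<gamma>_deriv:
  "(\<gamma> has_derivative (\<lambda>h. grad \<gamma> w \<bullet> h)) (at w)"
  "(grad \<gamma> has_derivative (\<lambda>h. hessian \<gamma> w *v h)) (at w)"
  using C2_derivatives[OF open_UNIV \<gamma>_C2] by auto

lemma grad_\<gamma>_translate: "grad \<gamma> (w + t *\<^sub>R e) = grad \<gamma> w"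
proof -
  have "((\<lambda>u. \<gamma> (u + t *\<^sub>R e)) has_derivative (\<lambda>h. grad \<gamma> (w + t *\<^sub>R e) \<bullet> h)) (at w)"
    by (rule has_derivative_compose[OF _ \<gamma>_deriv(1)]) (auto intro!: derivative_eq_intros)
  then show ?thesis by (intro grad_eqI[symmetric]) (simp add: \<gamma>_inv)
qed

lemma hessian_\<gamma>_translate: "hessian \<gamma> (w + t *\<^sub>R e) = hessian \<gamma> w"
proof -
  have "((\<lambda>u. grad \<gamma> (u + t *\<^sub>R e)) has_derivative (\<lambda>h. hessian \<gamma> (w + t *\<^sub>R e) *v h)) (at w)"
    by (rule has_derivative_compose[OF _ \<gamma>_deriv(2)]) (auto intro!: derivative_eq_intros)
  then have "(grad \<gamma> has_derivative (\<lambda>h. hessian \<gamma> (w + t *\<^sub>R e) *v h)) (at w)"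
    by (simp add: grad_\<gamma>_translate)
  from has_derivative_unique[OF this \<gamma>_deriv(2)] show ?thesis
    by (simp add: matrix_eq fun_eq_iff)
qed

lemma grad_\<gamma>_e: "grad \<gamma> w \<bullet> e = 0" and hessian_\<gamma>_e: "hessian \<gamma> w *v e = 0"
proof -
  have l: "((\<lambda>t. w + t *\<^sub>R e) has_derivative (\<lambda>h. h *\<^sub>R e)) (at 0)" by (auto intro!: derivative_eq_intros)
  have "((\<lambda>t. \<gamma> (w + t *\<^sub>R e)) has_derivative (\<lambda>h. grad \<gamma> w \<bullet> (h *\<^sub>R e))) (at 0)"
    by (rule has_derivative_compose[OF l]) (use \<gamma>_deriv(1)[of w] in simp)
  moreover have "((\<lambda>t. \<gamma> (w + t *\<^sub>R e)) has_derivative (\<lambda>h. 0)) (at 0)" by (simp add: \<gamma>_inv)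
  ultimately have "(\<lambda>h. grad \<gamma> w \<bullet> (h *\<^sub>R e)) = (\<lambda>h. 0)" by (rule has_derivative_unique)
  from fun_cong[OF this, of 1] show "grad \<gamma> w \<bullet> e = 0" by simp
  have "((\<lambda>t. grad \<gamma> (w + t *\<^sub>R e)) has_derivative (\<lambda>h. hessian \<gamma> w *v (h *\<^sub>R e))) (at 0)"
    by (rule has_derivative_compose[OF l]) (use \<gamma>_deriv(2)[of w] in simp)
  moreover have "((\<lambda>t. grad \<gamma> (w + t *\<^sub>R e)) has_derivative (\<lambda>h. 0)) (at 0)" by (simp add: grad_\<gamma>_translate)
  ultimately have "(\<lambda>h. hessian \<gamma> w *v (h *\<^sub>R e)) = (\<lambda>h. 0)" by (rule has_derivative_unique)
  from fun_cong[OF this, of 1] show "hessian \<gamma> w *v e = 0" by simp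
qed

lemma normal_nonzero: "n w \<noteq> 0"
proof -
  have "n w \<bullet> e = 1" by (simp add: inner_diff_left ee grad_\<gamma>_e)
  then show ?thesis by force
qed

lemma height_along:
  fixes c :: "real \<Rightarrow> real^'n"
  assumes "(c has_derivative D) (at s)"
  shows "((\<lambda>s. c s \<bullet> e - \<gamma> (c s)) has_derivative (\<lambda>h. n (c s) \<bullet> D h)) (at s)"
proof -
  have "((\<lambda>s. c s \<bullet> e) has_derivative (\<lambda>h. D h \<bullet> e)) (at s)"
    by (rule has_derivative_inner_left[OF assms])
  moreover have "((\<lambda>s. \<gamma> (c s)) has_derivative (\<lambda>h. grad \<gamma> (c s) \<bullet> D h)) (at s)"
    by (rule has_derivative_compose[OF assms \<gamma>_deriv(1)])
  ultimately have "((\<lambda>s. c s \<bullet> e - \<gamma> (c s)) has_derivative (\<lambda>h. D h \<bullet> e - grad \<gamma> (c s) \<bullet> D h)) (at s)"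
    by (rule has_derivative_diff)
  then show ?thesis by (rule has_derivative_eq_rhs) (simp add: fun_eq_iff inner_diff_left inner_diff_right inner_commute)
qed

lemma graph_point_derivative: "(gpt has_derivative gtan w) (at w)"
  unfolding graph_point_def[abs_def] graph_tangent_def[abs_def]
  by (auto intro!: derivative_eq_intros \<gamma>_deriv(1))

lemma \<gamma>_graph_point: "\<gamma> (gpt w) = \<gamma> w"
proof -
  have "gpt w = w + (\<gamma> w - w \<bullet> e) *\<^sub>R e" by (simp add: graph_point_def algebra_simps)
  then show ?thesis by (simp add: \<gamma>_inv)
qed

lemma graph_point_e: "gpt w \<bullet> e = \<gamma> w"
  by (simp add: graph_point_def inner_add_left inner_diff_left ee)

lemma graph_point_frontier: "gpt w \<in> ball x0 r \<Longrightarrow> gpt w \<in> frontier \<Omega>"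
  using boundary_chart_frontier(1)[OF chart \<Omega>_open] by (simp add: \<gamma>_graph_point graph_point_e)

context
  fixes y
  assumes yball: "y \<in> ball x0 r" and yfr: "y \<in> frontier \<Omega>"
begin

lemma \<gamma>_y: "\<gamma> y = y \<bullet> e"
  using boundary_chart_frontier(1)[OF chart \<Omega>_open yball] yfr by simp

lemma graph_point_y: "gpt y = y"
  by (simp add: graph_point_def \<gamma>_y)

text \<open>The vector v = x - y has the least polar value on the half-space beyond its own level in
  the conormal direction. This forces \<open>d x * F (n y)\<close> to be at most
  \<open>n y \<bullet> v\<close>. The function d(x) F(\<xi>) - \<xi> . v of \<xi>, nonnegative
  everywhere, therefore attains its minimum 0 at the conormal, and its derivative vanishes
  there.\<close>

lemma nearest_point:
  assumes x: "x \<in> \<Omega>" and near: "polar F (x - y) = d x"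
  shows "x - y = d x *\<^sub>R grad F (n y)"
proof -
  define v where "v = x - y"
  have n0: "n y \<noteq> 0" by (rule normal_nonzero)
  \<comment> \<open>To first order y - s w leaves \<open>\<Omega>\<close>, so its polar distance
    from x is at least \<open>d x\<close> for small s. Convexity of the polar function extends this
    from the small displacement s w to w itself.\<close>
  have out: "polar F v \<le> polar F (v + w)" if w: "0 < n y \<bullet> w" for w
  proof -
    define q where "q = (\<lambda>s. y + s *\<^sub>R (- w))"
    have ql: "(q \<longlongrightarrow> y) (at_right 0)" unfolding q_def by (auto intro!: tendsto_eq_intros)
    have "(q has_derivative (\<lambda>h. h *\<^sub>R (- w))) (at 0)" unfolding q_def by (auto intro!: derivative_eq_intros)
    from height_along[OF this]
    have "((\<lambda>s. q s \<bullet> e - \<gamma> (q s)) has_real_derivative - (n y \<bullet> w)) (at 0)"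
      unfolding has_field_derivative_def
      by (rule has_derivative_eq_rhs) (simp add: fun_eq_iff q_def)
    then have "\<exists>\<delta>>0. \<forall>s>0. s < \<delta> \<longrightarrow> q (0 + s) \<bullet> e - \<gamma> (q (0 + s)) < q 0 \<bullet> e - \<gamma> (q 0)"
      using w by (intro DERIV_neg_dec_right) auto
    then have "\<forall>\<^sub>F s in at_right 0. q s \<bullet> e - \<gamma> (q s) < 0"
      unfolding eventually_at_right_field by (simp add: q_def \<gamma>_y)
    moreover have "\<forall>\<^sub>F s in at_right 0. q s \<in> ball x0 r"
      using ql yball by (intro topological_tendstoD) auto
    moreover have "\<forall>\<^sub>F s::real in at_right 0. 0 < s \<and> s < 1"
      unfolding eventually_at_right_field by (intro exI[of _ 1]) auto
    ultimately have "\<forall>\<^sub>F s::real in at_right 0. polar F v \<le> polar F (v + w)"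
    proof eventually_elim
      case (elim s)
      then have "q s \<notin> \<Omega>" using in_\<Omega>[of "q s"] by auto
      then have "d x \<le> polar F (x - q s)" using polar_ball_subset[OF x, of "q s"] by force
      also have "x - q s = (1 - s) *\<^sub>R v + s *\<^sub>R (v + w)" by (simp add: q_def v_def algebra_simps)
      also have "polar F \<dots> \<le> (1 - s) * polar F v + s * polar F (v + w)"
        using elim by (intro order_trans[OF polar_subadditive] add_mono polar_scale_le) auto
      finally have "s * polar F v \<le> s * polar F (v + w)" using near by (simp add: v_def algebra_simps)
      then show ?case using elim by simp
    qed
    then show ?thesis using eventually_happens'[OF trivial_limit_at_right_real] by blast
  qed
  have half: "polar F v \<le> polar F z" if z: "n y \<bullet> v \<le> n y \<bullet> z" for z
  proof (rule LIMSEQ_le_const)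
    have "(\<lambda>k. polar F (z + inverse (real (Suc k)) *\<^sub>R n y)) \<longlonglongrightarrow> polar F (z + 0 *\<^sub>R n y)"
      by (intro continuous_on_tendsto_compose[OF polar_continuous] tendsto_intros LIMSEQ_inverse_real_of_nat) auto
    then show "(\<lambda>k. polar F (z + inverse (real (Suc k)) *\<^sub>R n y)) \<longlonglongrightarrow> polar F z" by simp
    have "polar F v \<le> polar F (z + inverse (real (Suc k)) *\<^sub>R n y)" for k
    proof -
      have "0 < inverse (real (Suc k)) * (n y \<bullet> n y)" using n0 by simp
      then have "0 < n y \<bullet> (z + inverse (real (Suc k)) *\<^sub>R n y - v)"
        using z by (simp add: inner_diff_right inner_add_right)
      from out[OF this] show ?thesis by simp
    qed
    then show "\<exists>N. \<forall>k\<ge>N. polar F v \<le> polar F (z + inverse (real (Suc k)) *\<^sub>R n y)" by blast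
  qed
  have dv: "polar F v = d x" using near by (simp add: v_def)
  have nv: "0 < n y \<bullet> v"
    using half[of 0] dist_pos[OF x] polar_0 dv by force
  \<comment> \<open>Chosen so that, by Euler's identity, \<open>c *\<^sub>R grad F (n y)\<close> has
    the same pairing with the conormal as v.\<close>
  define c where "c = (n y \<bullet> v) / F (n y)"
  have c0: "0 \<le> c" using nv F_pos[OF n0] by (simp add: c_def)
  have "polar F v \<le> polar F (c *\<^sub>R grad F (n y))"
  proof (rule half)
    have "n y \<bullet> (c *\<^sub>R grad F (n y)) = c * F (n y)"
      using grad_F_euler[OF n0] by (simp add: inner_commute)
    then show "n y \<bullet> v \<le> n y \<bullet> (c *\<^sub>R grad F (n y))" using F_pos[OF n0] by (simp add: c_def)
  qed
  also have "\<dots> \<le> c * 1"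
    using polar_scale_le[OF c0] polar_grad_F[OF n0] c0 by (meson mult_left_mono order_trans)
  finally have ge: "d x * F (n y) \<le> n y \<bullet> v" using F_pos[OF n0] dv by (simp add: c_def field_simps)
  define \<phi> where "\<phi> \<xi> = d x * F \<xi> - \<xi> \<bullet> v" for \<xi>
  have "(\<phi> has_derivative (\<lambda>h. d x * (grad F (n y) \<bullet> h) - h \<bullet> v)) (at (n y))"
    unfolding \<phi>_def
    by (rule has_derivative_diff[OF has_derivative_mult_right[OF F_derivatives(1)[OF n0]]
        bounded_linear_imp_has_derivative[OF bounded_linear_inner_left]])
  moreover have "\<phi> (n y) \<le> \<phi> \<xi>" for \<xi>
    using ge polar_ge[of \<xi> v] dv F_0 by (cases "\<xi> = 0") (auto simp: \<phi>_def mult.commute)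
  ultimately have zero: "(\<lambda>h. d x * (grad F (n y) \<bullet> h) - h \<bullet> v) = (\<lambda>h. 0)"
    by (intro differential_zero_maxmin[of "n y" UNIV \<phi>]) auto
  have "(d x *\<^sub>R grad F (n y) - v) \<bullet> h = 0" for h
    using fun_cong[OF zero, of h] by (simp only: inner_diff_left inner_scaleR_left inner_commute[of h v])
  from this[of "d x *\<^sub>R grad F (n y) - v"] show ?thesis by (simp add: v_def)
qed

text \<open>
  The points \<open>z - t\<^sub>1 F\<^sub>\<xi>(n + s \<eta>)\<close> lie on the polar sphere of radius \<open>t\<^sub>1 = d(z)\<close> around \<open>z\<close>, hence in
  the closure of \<open>\<Omega>\<close>. Comparing their height above the graph to second order at \<open>s = 0\<close> gives the
  inequality, which excludes focal points before time \<open>t\<^sub>1\<close>.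
\<close>

lemma inner_ball_curvature:
  assumes z: "z \<in> \<Omega>" and zy: "z - y = t1 *\<^sub>R grad F (n y)" and dz: "d z = t1"
  defines "M \<equiv> hessian F (n y)" and "K \<equiv> hessian \<gamma> y"
  shows "t1 * ((M *v \<eta>) \<bullet> (K *v (M *v \<eta>))) \<le> \<eta> \<bullet> (M *v \<eta>)"
proof (rule ccontr)
  assume neg: "\<not> t1 * ((M *v \<eta>) \<bullet> (K *v (M *v \<eta>))) \<le> \<eta> \<bullet> (M *v \<eta>)"
  have t1: "0 < t1" using dist_pos[OF z] dz by simp
  have n0: "n y \<noteq> 0" by (rule normal_nonzero)
  define \<xi> where "\<xi> = (\<lambda>s. n y + s *\<^sub>R \<eta>)"
  define Q where "Q = (\<lambda>s. hessian F (\<xi> s) *v \<eta>)"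
  define c where "c = (\<lambda>s. z - t1 *\<^sub>R grad F (\<xi> s))"
  define N where "N = (\<lambda>s. n (c s))"
  have \<xi>0: "\<xi> 0 = n y" by (simp add: \<xi>_def)
  have c0: "c 0 = y" using zy by (simp add: c_def \<xi>0 algebra_simps)
  have \<xi>c: "isCont \<xi> 0" unfolding \<xi>_def by (intro continuous_intros)
  have "\<forall>\<^sub>F s in at 0. \<xi> s \<noteq> 0"
    using tendsto_imp_eventually_ne[of \<xi> "\<xi> 0" "at 0" 0] \<xi>c n0 by (simp add: \<xi>0 isCont_def)
  then have ev\<xi>: "\<forall>\<^sub>F s in at_right 0. \<xi> s \<noteq> 0" by (auto simp: eventually_at_split)
  have cd: "(c has_vector_derivative - (t1 *\<^sub>R Q s)) (at s)" if "\<xi> s \<noteq> 0" for s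
    unfolding c_def Q_def \<xi>_def using that
    by (auto intro!: derivative_eq_intros F_ray_derivative(2) simp: \<xi>_def)
  have cc: "(c \<longlongrightarrow> y) (at 0)"
    using has_vector_derivative_continuous[OF cd[of 0]] n0 by (simp add: \<xi>0 c0 continuous_within flip: c0)
  have "(c \<longlongrightarrow> y) (at_right 0)" using cc by (rule filterlim_mono) (auto simp: at_le)
  then have evb: "\<forall>\<^sub>F s in at_right 0. c s \<in> ball x0 r"
    using yball by (intro topological_tendstoD) auto
  \<comment> \<open>\<open>Q s\<close> is orthogonal to \<open>\<xi> s\<close>, which differs from
    the conormal by s \<eta>; the velocity of the curve is thus tangent to the graph at y up to
    order s.\<close>
  have Qn: "Q s \<bullet> n y = - s * (Q s \<bullet> \<eta>)" if "\<xi> s \<noteq> 0" for s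
  proof -
    have "Q s \<bullet> \<xi> s = \<eta> \<bullet> (hessian F (\<xi> s) *v \<xi> s)"
      using hessian_symmetric(1)[OF open_punctured F_C2, of "\<xi> s" \<eta> "\<xi> s"] that
      by (simp add: Q_def inner_commute)
    then have "Q s \<bullet> \<xi> s = 0" by (simp add: hessian_F_radial[OF that])
    then show ?thesis by (simp add: \<xi>_def inner_add_right)
  qed
  define \<psi> where "\<psi> s = c s \<bullet> e - \<gamma> (c s)" for s
  \<comment> \<open>The derivative of the height \<psi> is s t1 b(s). Splitting off the factor s
    leaves b with the limit \<eta> . M \<eta> - t1 (M \<eta>) . K (M \<eta>), negative by the
    assumption to be refuted, so that \<psi> would fall below 0.\<close>
  define b where "b s = Q s \<bullet> \<eta> - Q s \<bullet> ((N s - n y) /\<^sub>R s)" for s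
  have \<psi>d: "(\<psi> has_real_derivative (s * t1 * b s)) (at s)" if s: "\<xi> s \<noteq> 0" "s \<noteq> 0" for s
  proof -
    from height_along[OF cd[OF s(1), unfolded has_vector_derivative_def]]
    have 1: "(\<psi> has_real_derivative - t1 * (Q s \<bullet> N s)) (at s)"
      unfolding has_field_derivative_def \<psi>_def[abs_def]
      by (rule has_derivative_eq_rhs) (simp add: fun_eq_iff N_def inner_commute mult_ac)
    have "s * b s = s * (Q s \<bullet> \<eta>) - Q s \<bullet> (N s - n y)"
      using s(2) by (simp add: b_def right_diff_distrib)
    also have "\<dots> = - (Q s \<bullet> N s)" using Qn[OF s(1)] by (simp add: inner_diff_right)
    finally have "t1 * (s * b s) = t1 * (- (Q s \<bullet> N s))" by simp
    then have "s * t1 * b s = - t1 * (Q s \<bullet> N s)" by (simp add: mult_ac)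
    with 1 show ?thesis by simp
  qed
  have Q0: "Q 0 = M *v \<eta>" by (simp add: Q_def \<xi>0 M_def)
  have Ql: "(Q \<longlongrightarrow> M *v \<eta>) (at 0)"
  proof -
    have "isCont (hessian F) (n y)"
      using C2_continuous(2)[OF open_punctured F_C2] n0 open_punctured
      by (simp add: continuous_on_eq_continuous_at)
    then have "((\<lambda>s. hessian F (\<xi> s)) \<longlongrightarrow> hessian F (n y)) (at 0)"
      using \<xi>c by (intro isCont_tendsto_compose[of _ "hessian F"]) (simp_all add: isCont_def \<xi>0)
    then show ?thesis unfolding Q_def M_def matrix_vector_mult_def
      by (intro tendsto_intros)
  qed
  have Nl: "((\<lambda>s. (N s - n y) /\<^sub>R s) \<longlongrightarrow> t1 *\<^sub>R (K *v (M *v \<eta>))) (at 0)"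
  proof -
    have "((\<lambda>s. grad \<gamma> (c s)) has_derivative (\<lambda>h. hessian \<gamma> (c 0) *v (h *\<^sub>R - (t1 *\<^sub>R Q 0)))) (at 0)"
      by (rule has_derivative_compose[OF cd[of 0, unfolded has_vector_derivative_def] \<gamma>_deriv(2)])
         (simp only: \<xi>0 n0 not_False_eq_True)
    then have "((\<lambda>s. grad \<gamma> (c s)) has_vector_derivative - (t1 *\<^sub>R (K *v (M *v \<eta>)))) (at 0)"
      unfolding has_vector_derivative_def
      by (rule has_derivative_eq_rhs)
         (simp add: fun_eq_iff Q0 c0 K_def matrix_vector_mult_scaleR vec.neg)
    then have "(N has_vector_derivative t1 *\<^sub>R (K *v (M *v \<eta>))) (at 0)"
      unfolding N_def by (auto intro!: derivative_eq_intros)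
    from has_vector_derivative_quotient[OF this] show ?thesis by (simp add: N_def c0)
  qed
  have "(b \<longlongrightarrow> (M *v \<eta>) \<bullet> \<eta> - (M *v \<eta>) \<bullet> (t1 *\<^sub>R (K *v (M *v \<eta>)))) (at 0)"
    unfolding b_def by (intro tendsto_intros Ql Nl)
  then have "(b \<longlongrightarrow> (M *v \<eta>) \<bullet> \<eta> - (M *v \<eta>) \<bullet> (t1 *\<^sub>R (K *v (M *v \<eta>)))) (at_right 0)"
    by (rule filterlim_mono) (auto simp: at_le)
  moreover have "(M *v \<eta>) \<bullet> \<eta> - (M *v \<eta>) \<bullet> (t1 *\<^sub>R (K *v (M *v \<eta>))) < 0"
    using neg by (simp add: inner_commute)
  ultimately have "\<forall>\<^sub>F s in at_right 0. b s < 0" by (rule order_tendstoD)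
  then have "\<forall>\<^sub>F s in at_right 0. b s < 0 \<and> \<xi> s \<noteq> 0 \<and> c s \<in> ball x0 r"
    using ev\<xi> evb by eventually_elim auto
  then obtain \<delta> where \<delta>: "\<delta> > 0" "\<And>s. 0 < s \<Longrightarrow> s < \<delta> \<Longrightarrow> b s < 0 \<and> \<xi> s \<noteq> 0 \<and> c s \<in> ball x0 r"
    unfolding eventually_at_right_field by auto
  define s where "s = \<delta> / 2"
  have s: "0 < s" "s < \<delta>" using \<delta> by (auto simp: s_def)
  have "\<psi> s < \<psi> 0"
  proof (rule DERIV_neg_imp_decreasing_open[OF s(1)])
    show "\<exists>D. (\<psi> has_real_derivative D) (at t) \<and> D < 0" if "0 < t" "t < s" for t
      using \<psi>d[of t] \<delta>(2)[of t] that s t1 by (intro exI[of _ "t * t1 * b t"]) (auto simp: mult_pos_neg)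
    have "isCont c t" if "0 \<le> t" "t \<le> s" for t
      using has_vector_derivative_continuous[OF cd[of t]] \<delta>(2)[of t] n0 that s \<xi>0 by (cases "t = 0") auto
    then have "continuous_on {0..s} c" by (intro continuous_at_imp_continuous_on) auto
    then show "continuous_on {0..s} \<psi>" unfolding \<psi>_def
      by (intro continuous_intros continuous_on_compose2[OF boundary_chart_continuous[OF chart]]) auto
  qed
  moreover have "0 \<le> \<psi> s"
  proof -
    have "polar F (z - c s) \<le> t1 * polar F (grad F (\<xi> s))"
      using polar_scale_le[of t1 "grad F (\<xi> s)"] t1 by (simp add: c_def)
    also have "\<dots> \<le> t1 * 1" using polar_grad_F[of "\<xi> s"] \<delta>(2)[OF s] t1 by (intro mult_left_mono) auto
    finally have "c s \<in> closure \<Omega>" using polar_cball_closure[OF z] dz by simp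
    then show ?thesis
      using boundary_chart_frontier(2)[OF chart \<Omega>_open] \<delta>(2)[OF s] by (simp add: \<psi>_def)
  qed
  moreover have "\<psi> 0 = 0" by (simp add: \<psi>_def c0 \<gamma>_y)
  ultimately show False by simp
qed

text \<open>
  The defining function \<open>g\<close> vanishes along the graph, so two differentiations show that on tangent
  vectors its Hessian is \<open>- c\<close> times that of \<open>\<gamma>\<close>, where \<open>\<nabla>g = c n\<close>. Only tangent vectors matter,
  because \<open>F\<^sub>\<xi>\<^sub>\<xi>(n) n = 0\<close>.
\<close>

lemma mean_curvature_eq:
  "aniso_mean_curvature F \<Omega> y = trace (hessian F (n y) ** hessian \<gamma> y)"
proof -
  define g where "g = (SOME g. C2_defining_function \<Omega> g)"
  have "C2_defining_function \<Omega> g"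
    unfolding g_def by (rule someI_ex[OF ex_C2_defining_function[OF \<Omega>_open \<Omega>_bounded \<Omega>_C2]])
  then obtain V where V: "open V" "closure \<Omega> \<subseteq> V" "C_k_on 2 V g"
    and gpos: "\<And>x. x \<in> \<Omega> \<Longrightarrow> g x > 0" and gz: "\<And>x. x \<in> frontier \<Omega> \<Longrightarrow> g x = 0"
    and gg: "\<And>x. x \<in> frontier \<Omega> \<Longrightarrow> grad g x \<noteq> 0"
    unfolding C2_defining_function_def by blast
  have fV: "frontier \<Omega> \<subseteq> V" using V(2) by (auto simp: frontier_def)
  have gd: "(g has_derivative (\<lambda>h. grad g x \<bullet> h)) (at x)"
    "(grad g has_derivative (\<lambda>h. hessian g x *v h)) (at x)" if "x \<in> frontier \<Omega>" for x
    using C2_derivatives[OF V(1,3), of x] that fV by auto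
  define H where "H = hessian g y"
  define M where "M = hessian F (n y)"
  define K where "K = hessian \<gamma> y"
  define c where "c = grad g y \<bullet> e"
  have contY: "continuous_on UNIV gpt"
    using graph_point_derivative by (intro continuous_at_imp_continuous_on) (auto intro: has_derivative_continuous)
  define W where "W = gpt -` ball x0 r"
  have W: "open W" unfolding W_def using contY by (intro open_vimage open_ball)
  have yW: "y \<in> W" using yball by (simp add: W_def graph_point_y)
  have Wf: "gpt w \<in> frontier \<Omega>" if "w \<in> W" for w using that graph_point_frontier by (simp add: W_def)
  have tang: "grad g (gpt w) \<bullet> gtan w h = 0" if w: "w \<in> W" for w h
  proof -
    have 1: "((\<lambda>w. g (gpt w)) has_derivative (\<lambda>h. grad g (gpt w) \<bullet> gtan w h)) (at w)"
      by (rule has_derivative_compose[OF graph_point_derivative gd(1)[OF Wf[OF w]]])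
    have "((\<lambda>w. 0) has_derivative (\<lambda>h. 0)) (at w)" by simp
    then have "((\<lambda>w. g (gpt w)) has_derivative (\<lambda>h. 0)) (at w)"
      by (rule has_derivative_transform_within_open[OF _ W w]) (simp add: gz Wf)
    from has_derivative_unique[OF 1 this] show ?thesis by (rule fun_cong)
  qed
  have gn: "grad g y = c *\<^sub>R n y"
  proof -
    have "grad g y \<bullet> h = (c *\<^sub>R n y) \<bullet> h" for h
    proof -
      have "grad g y \<bullet> gtan y h = 0" using tang[OF yW, of h] by (simp add: graph_point_y)
      moreover have "grad g y \<bullet> gtan y h = grad g y \<bullet> h - (h \<bullet> e) * c + (grad \<gamma> y \<bullet> h) * c"
        by (simp add: graph_tangent_def inner_add_right inner_diff_right c_def)
      moreover have "(c *\<^sub>R n y) \<bullet> h = (h \<bullet> e) * c - (grad \<gamma> y \<bullet> h) * c"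
        by (simp add: inner_diff_left inner_commute[of e h] right_diff_distrib mult.commute)
      ultimately show ?thesis by linarith
    qed
    then show ?thesis by (intro vector_eq_ldot[THEN iffD1]) (simp add: inner_commute)
  qed
  have c0: "c \<noteq> 0" using gn gg[OF yfr] by auto
  \<comment> \<open>The sign of c comes from g > 0 on the side of the graph to which
    \<open>e\<close> points.\<close>
  have "0 \<le> c"
  proof -
    define q where "q = (\<lambda>t. y + t *\<^sub>R e)"
    have ql: "(q \<longlongrightarrow> y) (at_right 0)" unfolding q_def by (auto intro!: tendsto_eq_intros)
    have "(q has_derivative (\<lambda>h. h *\<^sub>R e)) (at 0)" unfolding q_def by (auto intro!: derivative_eq_intros)
    then have "((\<lambda>t. g (q t)) has_derivative (\<lambda>h. grad g y \<bullet> (h *\<^sub>R e))) (at 0)"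
      by (rule has_derivative_compose) (use gd(1)[OF yfr] in \<open>simp add: q_def\<close>)
    then have "((\<lambda>t. g (q t)) has_real_derivative c) (at 0)"
      unfolding has_field_derivative_def by (rule has_derivative_eq_rhs) (simp add: fun_eq_iff c_def mult.commute)
    then have "((\<lambda>t. g (q t) / t) \<longlongrightarrow> c) (at 0)"
      using gz[OF yfr] by (simp add: has_field_derivative_iff q_def)
    then have lim: "((\<lambda>t. g (q t) / t) \<longlongrightarrow> c) (at_right 0)" by (rule filterlim_mono) (auto simp: at_le)
    have "\<forall>\<^sub>F t in at_right 0. q t \<in> ball x0 r" using ql yball by (intro topological_tendstoD) auto
    then have "\<forall>\<^sub>F t in at_right 0. 0 \<le> g (q t) / t"
      using eventually_at_right_less[of "0::real"]
    proof eventually_elim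
      case (elim t)
      have "\<gamma> (q t) < q t \<bullet> e" using elim by (simp add: q_def \<gamma>_inv inner_add_left ee \<gamma>_y)
      then have "q t \<in> \<Omega>" using in_\<Omega>[OF elim(1)] by simp
      from gpos[OF this] show ?case using elim by simp
    qed
    from tendsto_lowerbound[OF lim this] show ?thesis by simp
  qed
  with c0 have cp: "c > 0" by simp
  \<comment> \<open>Differentiates the identity \<open>tang\<close> once more; the second term
    arises because the tangent vector \<open>gtan w h\<close> itself turns with w.\<close>
  have second: "(H *v gtan y k) \<bullet> gtan y h + c * ((K *v k) \<bullet> h) = 0" for h k
  proof -
    have G: "((\<lambda>w. grad g (gpt w)) has_derivative (\<lambda>k. H *v gtan y k)) (at y)"
      unfolding H_def
      by (rule has_derivative_compose[OF graph_point_derivative]) (use gd(2)[OF yfr] in \<open>simp add: graph_point_y\<close>)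
    have T: "((\<lambda>w. gtan w h) has_derivative (\<lambda>k. ((K *v k) \<bullet> h) *\<^sub>R e)) (at y)"
      unfolding graph_tangent_def K_def
      by (auto intro!: derivative_eq_intros \<gamma>_deriv(2))
    have 1: "((\<lambda>w. grad g (gpt w) \<bullet> gtan w h) has_derivative
        (\<lambda>k. grad g (gpt y) \<bullet> (((K *v k) \<bullet> h) *\<^sub>R e) + (H *v gtan y k) \<bullet> gtan y h)) (at y)"
      by (rule has_derivative_inner[OF G T])
    have "((\<lambda>w. 0) has_derivative (\<lambda>k. 0)) (at y)" by simp
    then have 2: "((\<lambda>w. grad g (gpt w) \<bullet> gtan w h) has_derivative (\<lambda>k. 0)) (at y)"
      by (rule has_derivative_transform_within_open[OF _ W yW]) (simp add: tang)
    from fun_cong[OF has_derivative_unique[OF 1 2], of k]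
    show ?thesis by (simp add: graph_point_y c_def mult.commute)
  qed
  define T where "T = matrix (gtan y)"
  have "linear (gtan y)" by (rule has_derivative_linear[OF graph_point_derivative])
  then have T: "T *v h = gtan y h" for h unfolding T_def by (simp add: matrix_works)
  have n0: "n y \<noteq> 0" by (rule normal_nonzero)
  \<comment> \<open>The range of M is orthogonal to the conormal, and on such vectors T, the
    differential of the graph parametrisation, is the identity.\<close>
  have TM: "T ** M = M"
  proof -
    have "T *v (M *v h) = M *v h" for h
    proof -
      have "(M *v h) \<bullet> n y = (M *v n y) \<bullet> h"
        unfolding M_def by (rule hessian_symmetric(1)[OF open_punctured F_C2]) (use n0 in simp)
      then have "(M *v h) \<bullet> n y = 0" using hessian_F_radial[OF n0] by (simp add: M_def)
      then have "grad \<gamma> y \<bullet> (M *v h) = (M *v h) \<bullet> e" by (simp add: inner_diff_right inner_commute)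
      then show ?thesis by (simp add: T graph_tangent_def)
    qed
    then show ?thesis by (simp add: matrix_eq matrix_vector_mul_assoc[symmetric])
  qed
  have Msym: "transpose M = M" unfolding M_def by (rule hessian_F_symmetric[OF n0])
  have MT: "M ** transpose T = M"
    using arg_cong[OF TM, of transpose] by (simp add: matrix_transpose_mul Msym)
  have THT: "transpose T ** H ** T = (- c) *\<^sub>R K"
  proof -
    have "(transpose T ** H ** T) *v k = ((- c) *\<^sub>R K) *v k" for k
    proof (rule vector_eq_ldot[THEN iffD1], rule allI)
      fix h
      have "h \<bullet> ((transpose T ** H ** T) *v k) = (T *v h) \<bullet> (H *v (T *v k))"
      proof -
        define w where "w = H *v (T *v k)"
        have "(transpose T ** H ** T) *v k = transpose T *v w"
          by (simp only: w_def matrix_vector_mul_assoc matrix_mul_assoc)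
        moreover have "h \<bullet> (transpose T *v w) = (T *v h) \<bullet> w"
          using dot_lmul_matrix[of w T h]
          by (simp only: transpose_matrix_vector inner_commute[of h] inner_commute[of "T *v h"])
        ultimately show ?thesis by (simp only: w_def)
      qed
      also have "\<dots> = h \<bullet> (((- c) *\<^sub>R K) *v k)"
      proof -
        have "h \<bullet> (((- c) *\<^sub>R K) *v k) = (- c) * ((K *v k) \<bullet> h)"
          by (simp only: scaleR_matrix_vector_assoc[symmetric] inner_scaleR_right inner_commute[of h])
        moreover have "(T *v h) \<bullet> (H *v (T *v k)) = (H *v gtan y k) \<bullet> gtan y h"
          by (simp only: T inner_commute[of "gtan y h"])
        ultimately show ?thesis using second[of k h] by linarith
      qed
      finally show "h \<bullet> ((transpose T ** H ** T) *v k) = h \<bullet> (((- c) *\<^sub>R K) *v k)" .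
    qed
    then show ?thesis by (simp add: matrix_eq)
  qed
  have ts: "trace (k *\<^sub>R A) = k * trace A" for k and A :: "real^'n^'n"
    by (simp add: trace_def sum_distrib_left)
  have tMH: "trace (M ** H) = - c * trace (M ** K)"
  proof -
    have "trace (M ** H) = trace ((T ** M) ** (transpose T ** H))"
      by (simp only: TM matrix_mul_assoc MT)
    also have "\<dots> = trace (T ** (M ** transpose T ** H))" by (simp only: matrix_mul_assoc)
    also have "\<dots> = trace (M ** transpose T ** H ** T)" by (rule trace_mul_sym)
    also have "\<dots> = trace (M ** (transpose T ** H ** T))" by (simp only: matrix_mul_assoc)
    also have "\<dots> = trace ((- c) *\<^sub>R (M ** K))"
      unfolding THT by (simp only: matrix_scalar_ac scalar_matrix_assoc)
    finally show ?thesis by (simp only: ts)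
  qed
  have "((\<lambda>x. - grad g x) has_derivative (\<lambda>h. - (H *v h))) (at y)"
    unfolding H_def by (intro has_derivative_minus gd(2)[OF yfr])
  moreover have "(grad F has_derivative (\<lambda>h. ((1 / c) *\<^sub>R M) *v h)) (at (- grad g y))"
  proof -
    have "- grad g y = (- c) *\<^sub>R n y" by (simp add: gn)
    moreover have "(- c) *\<^sub>R n y \<noteq> 0" using c0 n0 by (simp del: scaleR_minus_left)
    ultimately show ?thesis
      using F_derivatives(2)[of "(- c) *\<^sub>R n y"] hessian_F_scale[OF n0, of "- c"] cp
      by (simp only: M_def) simp
  qed
  ultimately have "((\<lambda>x. grad F (- grad g x)) has_derivative (\<lambda>h. ((1 / c) *\<^sub>R M) *v (- (H *v h)))) (at y)"
    by (rule has_derivative_compose)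
  moreover have "((1 / c) *\<^sub>R M) *v (- (H *v h)) = ((- 1 / c) *\<^sub>R (M ** H)) *v h" for h
    by (simp only: scaleR_matrix_vector_assoc[symmetric] matrix_vector_mul_assoc[symmetric] vec.neg) simp
  ultimately have "jacobian (\<lambda>x. grad F (- grad g x)) (at y) = (- 1 / c) *\<^sub>R (M ** H)"
    by (intro jacobian_eqI) simp
  then have "aniso_mean_curvature F \<Omega> y = (- 1 / c) * trace (M ** H)"
    by (simp only: aniso_mean_curvature_def Let_def g_def[symmetric] divergence_def ts)
  then show ?thesis using tMH cp by (simp add: M_def K_def)
qed

end

end

end

section \<open>The ray map and its Jacobian\<close>

text \<open>For a unit vector \<open>e\<close>, the orthogonal projection onto the hyperplane
  orthogonal to \<open>e\<close>.\<close>

definition vertical_projection :: "real^'n \<Rightarrow> real^'n^'n" where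
  "vertical_projection e = mat 1 - (\<chi> i j. e $ i * e $ j)"

context finsler_domain
begin

context
  fixes x0 r e \<gamma> y t1
  assumes chart: "boundary_chart \<Omega> x0 r e \<gamma>" and yball: "y \<in> ball x0 r" and yfr: "y \<in> frontier \<Omega>"
    and t1: "0 < t1" and z\<Omega>: "y + t1 *\<^sub>R grad F (e - grad \<gamma> y) \<in> \<Omega>"
    and dz: "d (y + t1 *\<^sub>R grad F (e - grad \<gamma> y)) = t1"
begin

text \<open>Moving on from time t to time t1 gains at most t1 - t in polar distance, and the
  distance at time t is at most t. As it is t1 at the end, equality holds all along.\<close>

lemma ray_point:
  assumes t: "0 < t" "t \<le> t1"
  shows "y + t *\<^sub>R grad F (e - grad \<gamma> y) \<in> \<Omega>" "d (y + t *\<^sub>R grad F (e - grad \<gamma> y)) = t"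
proof -
  define \<nu> where "\<nu> = grad F (e - grad \<gamma> y)"
  have p: "polar F (s *\<^sub>R \<nu>) \<le> s" if "0 \<le> s" for s
    using polar_scale_le[OF that, of \<nu>] mult_left_mono[OF polar_grad_F[OF normal_nonzero[OF chart, of y]] that]
    by (simp only: \<nu>_def mult_1_right)
  have e: "(y + t1 *\<^sub>R \<nu>) - (y + t *\<^sub>R \<nu>) = (t1 - t) *\<^sub>R \<nu>" by (simp add: algebra_simps)
  have le: "polar F ((y + t1 *\<^sub>R \<nu>) - (y + t *\<^sub>R \<nu>)) \<le> t1 - t" unfolding e using t by (intro p) auto
  show "y + t *\<^sub>R grad F (e - grad \<gamma> y) \<in> \<Omega>"
    using polar_ball_subset[OF z\<Omega>, of "y + t *\<^sub>R \<nu>"] le t dz by (simp add: \<nu>_def)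
  have "t1 \<le> d (y + t *\<^sub>R \<nu>) + (t1 - t)"
    using dist_triangle_polar[of "y + t1 *\<^sub>R \<nu>" "y + t *\<^sub>R \<nu>"] le dz by (simp add: \<nu>_def)
  moreover have "d (y + t *\<^sub>R \<nu>) \<le> t"
    using dist_le[OF yfr, of "y + t *\<^sub>R \<nu>"] p[of t] t by simp
  ultimately show "d (y + t *\<^sub>R grad F (e - grad \<gamma> y)) = t" by (simp add: \<nu>_def)
qed

text \<open>A second nearest point y2 of x would also be nearest to the later point z = y + t1
  \<nu>. The formula of \<open>nearest_point\<close> at y2, used for x and for z, gives z - x the
  direction belonging to y2, so both feet have the same \<nu> and coincide.\<close>

lemma ray_unique_foot:
  assumes t: "0 < t" "t < t1" and y2: "y2 \<in> frontier \<Omega>"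
    and near: "polar F (y + t *\<^sub>R grad F (e - grad \<gamma> y) - y2) \<le> t"
  shows "y2 = y"
proof -
  define \<nu> where "\<nu> = grad F (e - grad \<gamma> y)"
  define x where "x = y + t *\<^sub>R \<nu>"
  define z where "z = y + t1 *\<^sub>R \<nu>"
  have x: "x \<in> \<Omega>" "d x = t" using ray_point[of t] t by (simp_all add: x_def \<nu>_def)
  have z: "z \<in> \<Omega>" "d z = t1" using z\<Omega> dz by (simp_all add: z_def \<nu>_def)
  have nx: "polar F (x - y2) = d x" using near dist_le[OF y2, of x] x by (simp add: x_def \<nu>_def)
  have zx: "z - x = (t1 - t) *\<^sub>R \<nu>" by (simp add: x_def z_def algebra_simps)
  have "polar F \<nu> \<le> 1" unfolding \<nu>_def by (rule polar_grad_F[OF normal_nonzero[OF chart, of y]])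
  have "polar F (z - x) \<le> t1 - t"
  proof -
    have t0: "0 \<le> t1 - t" using t by simp
    show ?thesis unfolding zx
      using polar_scale_le[OF t0, of \<nu>] mult_left_mono[OF \<open>polar F \<nu> \<le> 1\<close> t0] by simp
  qed
  then have "polar F (z - y2) \<le> t1" using polar_subadditive[of "z - x" "x - y2"] nx x by simp
  then have nz: "polar F (z - y2) = d z" using dist_le[OF y2, of z] z by simp
  obtain r2 e2 \<gamma>2 where c2: "boundary_chart \<Omega> y2 r2 e2 \<gamma>2" using ex_boundary_chart[OF \<Omega>_C2 y2] by blast
  then have b2: "y2 \<in> ball y2 r2" by (simp add: boundary_chart_def)
  define \<nu>2 where "\<nu>2 = grad F (e2 - grad \<gamma>2 y2)"
  have 1: "x - y2 = t *\<^sub>R \<nu>2" using nearest_point[OF c2 b2 y2 x(1) nx] x by (simp add: \<nu>2_def)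
  have 2: "z - y2 = t1 *\<^sub>R \<nu>2" using nearest_point[OF c2 b2 y2 z(1) nz] z by (simp add: \<nu>2_def)
  have "(t1 - t) *\<^sub>R \<nu> = (t1 - t) *\<^sub>R \<nu>2" using 1 2 zx by (simp add: algebra_simps)
  then have "\<nu> = \<nu>2" using t by simp
  then show ?thesis using 1 by (simp add: x_def)
qed

end

definition ray_map :: "real^'n \<Rightarrow> (real^'n \<Rightarrow> real) \<Rightarrow> real^'n \<Rightarrow> real^'n" where
  "ray_map e \<gamma> w = graph_point e \<gamma> w + (w \<bullet> e) *\<^sub>R grad F (e - grad \<gamma> w)"

text \<open>The Jacobian of the ray map at time 0. As a function of w it is constant along
  \<open>e\<close>, which makes it a common factor of the Jacobians on one ray.\<close>

definition tangent_matrix :: "real^'n \<Rightarrow> (real^'n \<Rightarrow> real) \<Rightarrow> real^'n \<Rightarrow> real^'n^'n" where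
  "tangent_matrix e \<gamma> w = matrix (\<lambda>h. graph_tangent e \<gamma> w h + (h \<bullet> e) *\<^sub>R grad F (e - grad \<gamma> w))"

definition ray_jacobian :: "real^'n \<Rightarrow> (real^'n \<Rightarrow> real) \<Rightarrow> real^'n \<Rightarrow> real^'n^'n" where
  "ray_jacobian e \<gamma> w =
    tangent_matrix e \<gamma> w - (w \<bullet> e) *\<^sub>R (hessian F (e - grad \<gamma> w) ** hessian \<gamma> w)"

context
  fixes x0 r e \<gamma>
  assumes chart: "boundary_chart \<Omega> x0 r e \<gamma>"
begin

abbreviation (input) "foot \<equiv> graph_point e \<gamma>"
abbreviation (input) "conormal w \<equiv> e - grad \<gamma> w"
abbreviation (input) "\<Psi> \<equiv> ray_map e \<gamma>"
abbreviation (input) "L\<^sub>0 \<equiv> tangent_matrix e \<gamma>"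
abbreviation (input) "J\<^sub>\<Psi> \<equiv> ray_jacobian e \<gamma>"

lemmas cee = ee[OF chart]
lemmas conormal_nonzero = normal_nonzero[OF chart]

lemma foot_translate: "foot (w + t *\<^sub>R e) = foot w"
  by (simp add: graph_point_def \<gamma>_inv[OF chart] inner_add_left cee algebra_simps)

lemma ray_map_translate: "\<Psi> (w + t *\<^sub>R e) = \<Psi> w + t *\<^sub>R grad F (conormal w)"
  by (simp add: ray_map_def foot_translate grad_\<gamma>_translate[OF chart] inner_add_left cee algebra_simps)

lemma foot_eq: "foot w = w + (\<gamma> w - w \<bullet> e) *\<^sub>R e"
  by (simp add: graph_point_def algebra_simps)

lemma conormal_foot: "grad \<gamma> (foot w) = grad \<gamma> w" "hessian \<gamma> (foot w) = hessian \<gamma> w"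
  unfolding foot_eq by (rule grad_\<gamma>_translate[OF chart] hessian_\<gamma>_translate[OF chart])+

lemma foot_inj:
  assumes "foot v = foot w" "v \<bullet> e = w \<bullet> e" shows "v = w"
proof -
  have "\<gamma> v = \<gamma> w" using assms(1) graph_point_e[OF chart] by metis
  then show ?thesis using assms by (simp add: foot_eq)
qed

lemma tangent_matrix_mult:
  "L\<^sub>0 w *v h = graph_tangent e \<gamma> w h + (h \<bullet> e) *\<^sub>R grad F (conormal w)"
proof -
  have "linear (\<lambda>h. graph_tangent e \<gamma> w h + (h \<bullet> e) *\<^sub>R grad F (conormal w))"
    by (simp add: linear_iff graph_tangent_def inner_add_left inner_add_right algebra_simps)
  then show ?thesis unfolding tangent_matrix_def by (simp add: matrix_works)
qed

lemma ray_map_derivative: "(\<Psi> has_derivative (\<lambda>h. J\<^sub>\<Psi> w *v h)) (at w)"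
proof -
  have 1: "(foot has_derivative graph_tangent e \<gamma> w) (at w)" by (rule graph_point_derivative[OF chart])
  have "((\<lambda>w. conormal w) has_derivative (\<lambda>h. 0 - hessian \<gamma> w *v h)) (at w)"
    by (intro has_derivative_diff has_derivative_const \<gamma>_deriv(2)[OF chart])
  from has_derivative_compose[OF this F_derivatives(2)[OF conormal_nonzero]]
  have 2: "((\<lambda>w. grad F (conormal w)) has_derivative (\<lambda>h. hessian F (conormal w) *v (0 - hessian \<gamma> w *v h))) (at w)" .
  have 3: "((\<lambda>w. w \<bullet> e) has_derivative (\<lambda>h. h \<bullet> e)) (at w)"
    by (rule bounded_linear_imp_has_derivative[OF bounded_linear_inner_left])
  have "(\<Psi> has_derivative (\<lambda>h. graph_tangent e \<gamma> w h + ((w \<bullet> e) *\<^sub>R (hessian F (conormal w) *v (0 - hessian \<gamma> w *v h)) +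
      (h \<bullet> e) *\<^sub>R grad F (conormal w)))) (at w)"
    unfolding ray_map_def[abs_def] by (rule has_derivative_add[OF 1 has_derivative_scaleR[OF 3 2]])
  then show ?thesis
  proof (rule has_derivative_eq_rhs, intro ext)
    fix h
    have "hessian F (conormal w) *v (0 - hessian \<gamma> w *v h) = - ((hessian F (conormal w) ** hessian \<gamma> w) *v h)"
      by (simp add: vec.neg matrix_vector_mul_assoc)
    then show "graph_tangent e \<gamma> w h + ((w \<bullet> e) *\<^sub>R (hessian F (conormal w) *v (0 - hessian \<gamma> w *v h)) +
      (h \<bullet> e) *\<^sub>R grad F (conormal w)) = J\<^sub>\<Psi> w *v h"
      by (simp add: ray_jacobian_def matrix_vector_mult_diff_rdistrib tangent_matrix_mult
          scaleR_matrix_vector_assoc[symmetric])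
  qed
qed

lemma vertical_projection_mult: "(vertical_projection e) *v h = h - (h \<bullet> e) *\<^sub>R e"
proof -
  have "(\<chi> i j. e $ i * e $ j) *v h = (h \<bullet> e) *\<^sub>R e"
    by (simp add: vec_eq_iff matrix_vector_mult_def inner_vec_def sum_distrib_right sum_distrib_left mult_ac)
  then show ?thesis by (simp add: vertical_projection_def matrix_vector_mult_diff_rdistrib)
qed

lemma transpose_vertical_projection: "transpose (vertical_projection e) = (vertical_projection e)"
  by (auto simp: vertical_projection_def transpose_def vec_eq_iff mat_def mult.commute)

text \<open>The range of M is tangent to the graph, hence its vectors are determined by their
  horizontal parts: L P M = M for L = \<open>tangent_matrix e \<gamma> w\<close>. Since P K = K, the
  matrix M may be replaced by P M P, which is again symmetric and positive semidefinite, and L comes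
  out as a left factor.\<close>

lemma ray_jacobian_factor:
  defines "P \<equiv> (vertical_projection e)"
  shows "J\<^sub>\<Psi> w = L\<^sub>0 w **
    (mat 1 - (w \<bullet> e) *\<^sub>R ((P ** hessian F (conormal w) ** P) ** hessian \<gamma> w))"
    and "P ** hessian \<gamma> w = hessian \<gamma> w" "hessian \<gamma> w ** P = hessian \<gamma> w"
proof -
  define M where "M = hessian F (conormal w)"
  define K where "K = hessian \<gamma> w"
  have Ksym: "(K *v v) \<bullet> u = (K *v u) \<bullet> v" for u v
    unfolding K_def by (rule hessian_symmetric(1)[OF open_UNIV \<gamma>_C2[OF chart]]) simp
  have Ke: "K *v e = 0" unfolding K_def by (rule hessian_\<gamma>_e[OF chart])
  have eK: "(K *v v) \<bullet> e = 0" for v using Ksym[of v e] Ke by simp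
  have PK: "P ** K = K"
    unfolding matrix_eq by (simp add: matrix_vector_mul_assoc[symmetric] P_def vertical_projection_mult eK)
  have KP: "K ** P = K"
    unfolding matrix_eq
    by (simp add: matrix_vector_mul_assoc[symmetric] P_def vertical_projection_mult matrix_vector_mult_diff_distrib
        matrix_vector_mult_scaleR Ke)
  show "P ** hessian \<gamma> w = hessian \<gamma> w" "hessian \<gamma> w ** P = hessian \<gamma> w"
    using PK KP by (simp_all add: K_def)
  have LPM: "L\<^sub>0 w ** P ** M = M"
  proof -
    have "L\<^sub>0 w *v (P *v (M *v h)) = M *v h" for h
    proof -
      have "(M *v h) \<bullet> conormal w = (M *v conormal w) \<bullet> h"
        unfolding M_def by (rule hessian_symmetric(1)[OF open_punctured F_C2]) (use conormal_nonzero in simp)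
      then have "(M *v h) \<bullet> conormal w = 0" using hessian_F_radial[OF conormal_nonzero] by (simp add: M_def)
      then have g: "grad \<gamma> w \<bullet> (M *v h) = (M *v h) \<bullet> e" by (simp add: inner_diff_right inner_commute)
      have e0: "(P *v (M *v h)) \<bullet> e = 0"
        by (simp add: P_def vertical_projection_mult inner_diff_left cee)
      have "grad \<gamma> w \<bullet> (P *v (M *v h)) = (M *v h) \<bullet> e"
        by (simp add: P_def vertical_projection_mult inner_diff_right grad_\<gamma>_e[OF chart] g)
      then show ?thesis using e0
        by (simp add: tangent_matrix_mult graph_tangent_def) (simp add: P_def vertical_projection_mult)
    qed
    then show ?thesis unfolding matrix_eq by (simp add: matrix_vector_mul_assoc[symmetric])
  qed
  have "L\<^sub>0 w ** (mat 1 - (w \<bullet> e) *\<^sub>R ((P ** M ** P) ** K))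
      = L\<^sub>0 w - (w \<bullet> e) *\<^sub>R (L\<^sub>0 w ** P ** M ** (P ** K))"
    by (simp only: matrix_sub_ldistrib matrix_mul_rid matrix_scalar_ac scalar_matrix_assoc[symmetric] matrix_mul_assoc)
  then show "J\<^sub>\<Psi> w = L\<^sub>0 w **
    (mat 1 - (w \<bullet> e) *\<^sub>R ((P ** hessian F (conormal w) ** P) ** hessian \<gamma> w))"
    by (simp only: LPM PK ray_jacobian_def M_def[symmetric] K_def[symmetric])
qed

lemma tangent_matrix_translate: "L\<^sub>0 (w + t *\<^sub>R e) = L\<^sub>0 w"
  unfolding tangent_matrix_def graph_tangent_def grad_\<gamma>_translate[OF chart] ..

text \<open>The left factor \<open>tangent_matrix\<close> is common to both times. To the rest
  \<open>det_one_minus_antimono\<close> applies; the bound on the eigenvalues comes from the polar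
  ball of radius t1 about the point at time t1, which is later than
  \<open>w \<bullet> e\<close>.\<close>

lemma ray_jacobian_antimono:
  assumes w: "foot w \<in> ball x0 r" "foot w \<in> frontier \<Omega>" and curv: "0 \<le> aniso_mean_curvature F \<Omega> (foot w)"
    and t1: "w \<bullet> e < t1" "foot w + t1 *\<^sub>R grad F (conormal w) \<in> \<Omega>"
      "d (foot w + t1 *\<^sub>R grad F (conormal w)) = t1"
    and s: "0 \<le> s" "s \<le> w \<bullet> e"
  shows "\<bar>det (J\<^sub>\<Psi> w)\<bar> \<le> \<bar>det (J\<^sub>\<Psi> (w + (- s) *\<^sub>R e))\<bar>"
proof -
  define P where "P = (vertical_projection e)"
  define M where "M = hessian F (conormal w)"
  define K where "K = hessian \<gamma> w"
  define M' where "M' = P ** M ** P"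
  have PK: "P ** K = K" "K ** P = K" using ray_jacobian_factor(2,3) by (simp_all add: P_def K_def)
  have Pt: "transpose P = P" unfolding P_def by (rule transpose_vertical_projection)
  have Mt: "transpose M = M" unfolding M_def by (rule hessian_F_symmetric[OF conormal_nonzero])
  have Kt: "transpose K = K" unfolding K_def by (rule hessian_symmetric(2)[OF open_UNIV \<gamma>_C2[OF chart]]) simp
  have inP: "(P *v u) \<bullet> v = u \<bullet> (P *v v)" for u v
    using dot_lmul_matrix[of u P v] transpose_matrix_vector[of P u] by (simp only: Pt)
  have M'v: "M' *v v = P *v (M *v (P *v v))" for v by (simp add: M'_def matrix_vector_mul_assoc matrix_mul_assoc)
  have 1: "transpose M' = M'" by (simp add: M'_def matrix_transpose_mul Pt Mt matrix_mul_assoc)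
  have vM'v: "v \<bullet> (M' *v v) = (P *v v) \<bullet> (M *v (P *v v))" for v unfolding M'v by (simp only: inP[symmetric])
  have 2: "0 \<le> v \<bullet> (M' *v v)" for v
    unfolding vM'v M_def by (rule hessian_F_psd[OF conormal_nonzero])
  have z: "foot w + t1 *\<^sub>R grad F (e - grad \<gamma> (foot w)) - foot w = t1 *\<^sub>R grad F (e - grad \<gamma> (foot w))" by simp
  have inner0: "t1 * ((M *v u) \<bullet> (K *v (M *v u))) \<le> u \<bullet> (M *v u)" for u
    using inner_ball_curvature[OF chart w(1,2) _ z, of u] t1
    by (simp add: conormal_foot M_def K_def)
  have 3: "t1 * ((M' *v v) \<bullet> (K *v (M' *v v))) \<le> v \<bullet> (M' *v v)" for v
  proof -
    have "(M' *v v) \<bullet> (K *v (M' *v v)) = (M *v (P *v v)) \<bullet> ((P ** (K ** P)) *v (M *v (P *v v)))"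
    proof -
      have "(P *v u) \<bullet> (K *v (P *v u)) = u \<bullet> (P *v (K *v (P *v u)))" for u by (rule inP)
      moreover have "P *v (K *v (P *v u)) = (P ** (K ** P)) *v u" for u
        by (simp only: matrix_vector_mul_assoc matrix_mul_assoc)
      ultimately show ?thesis unfolding M'v by (simp only:)
    qed
    also have "P ** (K ** P) = K" by (simp only: PK)
    finally show ?thesis using inner0[of "P *v v"] by (simp only: vM'v)
  qed
  have "trace (M' ** K) = trace (P ** (M ** P ** K))" by (simp only: M'_def matrix_mul_assoc)
  also have "\<dots> = trace (M ** P ** K ** P)" by (rule trace_mul_sym)
  also have "M ** P ** K ** P = M ** (P ** (K ** P))" by (simp only: matrix_mul_assoc)
  also have "P ** (K ** P) = K" by (simp only: PK)
  also have "trace (M ** K) = aniso_mean_curvature F \<Omega> (foot w)"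
    using mean_curvature_eq[OF chart w] by (simp only: conormal_foot M_def K_def)
  finally have 4: "0 \<le> trace (M' ** K)" using curv by simp
  have e1: "(w + (- s) *\<^sub>R e) \<bullet> e = w \<bullet> e - s" by (simp add: inner_diff_left cee)
  have j: "det (J\<^sub>\<Psi> w) = det (L\<^sub>0 w) * det (mat 1 - (w \<bullet> e) *\<^sub>R (M' ** K))"
    unfolding ray_jacobian_factor(1)[of w] by (simp only: det_mul M'_def P_def M_def K_def)
  have js: "det (J\<^sub>\<Psi> (w + (- s) *\<^sub>R e)) = det (L\<^sub>0 w) * det (mat 1 - (w \<bullet> e - s) *\<^sub>R (M' ** K))"
    unfolding ray_jacobian_factor(1)[of "w + (- s) *\<^sub>R e"] e1 tangent_matrix_translate
      grad_\<gamma>_translate[OF chart] hessian_\<gamma>_translate[OF chart]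
    by (simp only: det_mul M'_def P_def M_def K_def)
  have "0 < det (mat 1 - (w \<bullet> e) *\<^sub>R (M' ** K))"
    "det (mat 1 - (w \<bullet> e) *\<^sub>R (M' ** K)) \<le> det (mat 1 - (w \<bullet> e - s) *\<^sub>R (M' ** K))"
    using det_one_minus_antimono[OF 1 2 Kt 3 4, of "w \<bullet> e - s" "w \<bullet> e"] s t1(1) by auto
  then show ?thesis unfolding j js abs_mult by (intro mult_left_mono) auto
qed

end

end

text \<open>The set has at most one point on each line parallel to e. Its translates by e/(n+1) are
  pairwise disjoint, have equal measure and lie in a common ball, so that measure is 0.\<close>

lemma negligible_disjoint_translates:
  fixes E :: "'a::euclidean_space set"
  assumes "E \<in> sets borel" "bounded E"
    and disj: "\<And>w s. 0 < s \<Longrightarrow> w \<in> E \<Longrightarrow> w + s *\<^sub>R e \<notin> E"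
  shows "negligible E"
proof -
  define T where "T n = (\<lambda>w. inverse (real (Suc n)) *\<^sub>R e + w) ` E" for n
  have Em: "E \<in> lmeasurable" using bounded_set_imp_lmeasurable[OF assms(2)] assms(1) by simp
  have Tm: "T n \<in> lmeasurable" "measure lebesgue (T n) = measure lebesgue E" for n
    unfolding T_def using Em by (simp_all add: measurable_translation measure_translation)
  have dT: "disjoint_family T"
  proof -
    have "False" if mn: "m < n" and x: "x \<in> T m" "x \<in> T n" for m n x
    proof -
      obtain v w where vw: "v \<in> E" "w \<in> E" "x = inverse (real (Suc m)) *\<^sub>R e + v" "x = inverse (real (Suc n)) *\<^sub>R e + w"
        using x by (auto simp: T_def)
      have "w = v + (inverse (real (Suc m)) - inverse (real (Suc n))) *\<^sub>R e"
        using vw by (simp add: algebra_simps)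
      moreover have "0 < inverse (real (Suc m)) - inverse (real (Suc n))" using mn by simp
      ultimately show False using disj vw by blast
    qed
    then show ?thesis unfolding disjoint_family_on_def by (metis disjoint_iff linorder_neqE_nat)
  qed
  obtain B where B: "\<And>w. w \<in> E \<Longrightarrow> norm w \<le> B" using assms(2) by (auto simp: bounded_iff)
  define C where "C = measure lebesgue (cball (0::'a) (B + norm e))"
  have sub: "T n \<subseteq> cball 0 (B + norm e)" for n
  proof
    fix x assume "x \<in> T n"
    then obtain w where w: "w \<in> E" "x = inverse (real (Suc n)) *\<^sub>R e + w" by (auto simp: T_def)
    have "norm (inverse (real (Suc n)) *\<^sub>R e) \<le> 1 * norm e"
      unfolding norm_scaleR by (intro mult_right_mono) (auto simp: inverse_le_1_iff)
    then show "x \<in> cball 0 (B + norm e)"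
      using w B[of w] norm_triangle_ineq[of "inverse (real (Suc n)) *\<^sub>R e" w] by simp
  qed
  have "real N * measure lebesgue E \<le> C" for N
  proof -
    have "(\<Sum>n<N. measure lebesgue (T n)) = measure lebesgue (\<Union>n<N. T n)"
      using dT Tm(1) by (intro measure_UNION'[symmetric]) (auto simp: disjoint_family_on_def pairwise_def disjnt_def)
    also have "\<dots> \<le> C" unfolding C_def
      by (rule measure_mono_fmeasurable) (use sub Tm(1) in auto)
    finally show ?thesis by (simp add: Tm(2))
  qed
  then have "measure lebesgue E \<le> 0"
    by (metis not_le reals_Archimedean3)
  then have "measure lebesgue E = 0" by (simp add: measure_le_0_iff)
  then show ?thesis using Em by (simp add: negligible_iff_measure)
qed

context finsler_domain
begin

text \<open>Foot points in S together with the times at which their rays realise the distance to the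
  boundary.\<close>

definition ray_set :: "real^'n \<Rightarrow> (real^'n \<Rightarrow> real) \<Rightarrow> (real^'n) set \<Rightarrow> (real^'n) set" where
  "ray_set e \<gamma> S = {w. graph_point e \<gamma> w \<in> S \<and> 0 < w \<bullet> e \<and> ray_map e \<gamma> w \<in> \<Omega> \<and> d (ray_map e \<gamma> w) = w \<bullet> e}"

text \<open>Rays without their last point: the ray still realises the distance at some later time.
  What \<open>ray_set\<close> has in addition are the parameters of the cut points.\<close>

definition open_ray_set :: "real^'n \<Rightarrow> (real^'n \<Rightarrow> real) \<Rightarrow> (real^'n) set \<Rightarrow> (real^'n) set" where
  "open_ray_set e \<gamma> S = {w \<in> ray_set e \<gamma> S. \<exists>s>0. w + s *\<^sub>R e \<in> ray_set e \<gamma> S}"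

context
  fixes x0 r e \<gamma> S
  assumes chart: "boundary_chart \<Omega> x0 r e \<gamma>"
    and S: "S \<subseteq> ball x0 r" "S \<subseteq> frontier \<Omega>" "S \<in> sets borel"
begin

abbreviation (input) "\<Phi> \<equiv> ray_map e \<gamma>"
abbreviation (input) "ft \<equiv> graph_point e \<gamma>"
abbreviation (input) "\<A> \<equiv> ray_set e \<gamma> S"
abbreviation (input) "\<U> \<equiv> open_ray_set e \<gamma> S"
abbreviation (input) "\<nu> w \<equiv> grad F (e - grad \<gamma> w)"

lemma ray_map_eq: "\<Phi> w = ft w + (w \<bullet> e) *\<^sub>R \<nu> w"
  by (simp add: ray_map_def)

lemma ray_set_facts:
  assumes "w \<in> \<A>"
  shows "ft w \<in> ball x0 r" "ft w \<in> frontier \<Omega>" "0 < w \<bullet> e"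
    "ft w + (w \<bullet> e) *\<^sub>R grad F (e - grad \<gamma> (ft w)) \<in> \<Omega>"
    "d (ft w + (w \<bullet> e) *\<^sub>R grad F (e - grad \<gamma> (ft w))) = w \<bullet> e"
  using assms S unfolding conormal_foot(1)[OF chart]
  by (auto simp: ray_set_def ray_map_eq)

lemma shift_e: "(w + t *\<^sub>R e) \<bullet> e = w \<bullet> e + t"
  by (simp add: inner_add_left cee[OF chart])

lemma ray_set_down:
  assumes w: "w \<in> \<A>" and t: "0 < w \<bullet> e + t" "t \<le> 0"
  shows "w + t *\<^sub>R e \<in> \<A>"
proof -
  note f = ray_set_facts[OF w]
  have eq: "\<Phi> (w + t *\<^sub>R e) = ft w + (w \<bullet> e + t) *\<^sub>R grad F (e - grad \<gamma> (ft w))"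
    using ray_map_translate[OF chart, of w t]
    by (simp add: conormal_foot(1)[OF chart] ray_map_eq[of w] scaleR_add_left add.assoc)
  have "ft (w + t *\<^sub>R e) \<in> S" using w by (simp add: foot_translate[OF chart] ray_set_def)
  then show ?thesis
    using ray_point[OF chart f(1,2,3,4,5), of "w \<bullet> e + t"] t
    by (simp add: ray_set_def eq shift_e)
qed

lemma open_ray_set_down:
  assumes w: "w \<in> \<U>" and t: "0 < w \<bullet> e + t" "t \<le> 0"
  shows "w + t *\<^sub>R e \<in> \<U>"
proof (cases "t = 0")
  case False
  have "w + t *\<^sub>R e \<in> \<A>" "(w + t *\<^sub>R e) + (- t) *\<^sub>R e \<in> \<A>"
    using w ray_set_down[OF _ t] by (auto simp: open_ray_set_def)
  then show ?thesis unfolding open_ray_set_def using False t(2)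
    by (intro CollectI conjI exI[of _ "- t"]) auto
qed (use w in simp)

lemma open_ray_set_extends:
  assumes "w \<in> \<U>"
  shows "\<exists>t1>w \<bullet> e. ft w + t1 *\<^sub>R \<nu> w \<in> \<Omega> \<and> d (ft w + t1 *\<^sub>R \<nu> w) = t1"
proof -
  obtain s where s: "0 < s" "w + s *\<^sub>R e \<in> \<A>" using assms by (auto simp: open_ray_set_def)
  note f = ray_set_facts[OF s(2), unfolded foot_translate[OF chart] conormal_foot(1)[OF chart] shift_e]
  show ?thesis using f(4,5) s(1) by (intro exI[of _ "w \<bullet> e + s"]) auto
qed

lemma open_ray_set_subset: "\<U> \<subseteq> \<A>" by (auto simp: open_ray_set_def)

lemma open_ray_unique_foot:
  assumes w: "w \<in> \<U>" and y2: "y2 \<in> frontier \<Omega>" "polar F (\<Phi> w - y2) \<le> w \<bullet> e"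
  shows "y2 = ft w"
proof -
  have wA: "w \<in> \<A>" using w open_ray_set_subset by blast
  note f = ray_set_facts[OF wA]
  obtain t1 where t1: "w \<bullet> e < t1" "ft w + t1 *\<^sub>R \<nu> w \<in> \<Omega>" "d (ft w + t1 *\<^sub>R \<nu> w) = t1"
    using open_ray_set_extends[OF w] by blast
  have "0 < t1" using t1(1) f(3) by linarith
  show ?thesis
    by (rule ray_unique_foot[OF chart f(1,2) \<open>0 < t1\<close> _ _ f(3) t1(1) y2(1)])
       (use t1 y2 in \<open>simp_all add: conormal_foot(1)[OF chart] ray_map_eq\<close>)
qed

lemma foot_near:
  assumes "w \<in> \<A>" shows "polar F (\<Phi> w - ft w) \<le> w \<bullet> e"
proof -
  note f = ray_set_facts[OF assms]
  have "polar F ((w \<bullet> e) *\<^sub>R \<nu> w) \<le> (w \<bullet> e) * polar F (\<nu> w)" using f(3) by (intro polar_scale_le) simp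
  also have "\<dots> \<le> (w \<bullet> e) * 1"
    using f(3) by (intro mult_left_mono polar_grad_F conormal_nonzero[OF chart]) auto
  finally show ?thesis by (simp add: ray_map_eq)
qed

text \<open>The time is recovered as the distance of the image and the foot as its unique nearest
  boundary point.\<close>

lemma ray_map_inj: "inj_on \<Phi> \<U>"
proof (rule inj_onI)
  fix v w assume vw: "v \<in> \<U>" "w \<in> \<U>" "\<Phi> v = \<Phi> w"
  have vA: "v \<in> \<A>" "w \<in> \<A>" using vw open_ray_set_subset by auto
  have t: "v \<bullet> e = w \<bullet> e" using vA vw(3) by (simp add: ray_set_def)
  have "ft w = ft v"
    by (rule open_ray_unique_foot[OF vw(1) ray_set_facts(2)[OF vA(2)]])
       (use foot_near[OF vA(2)] vw(3) t in simp)
  then show "v = w" using foot_inj[OF chart] t by metis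
qed

lemma ray_map_continuous: "continuous_on UNIV \<Phi>"
  using ray_map_derivative[OF chart] by (intro continuous_at_imp_continuous_on) (auto intro: has_derivative_continuous)

lemma ray_set_borel: "\<A> \<in> sets borel"
proof -
  have ftc: "continuous_on UNIV ft"
    using graph_point_derivative[OF chart] by (intro continuous_at_imp_continuous_on) (auto intro: has_derivative_continuous)
  have "\<A> = ft -` S \<inter> {w. 0 < w \<bullet> e} \<inter> \<Phi> -` \<Omega> \<inter> {w. d (\<Phi> w) = w \<bullet> e}"
    by (auto simp: ray_set_def)
  moreover have "ft -` S \<in> sets borel"
    using measurable_sets[OF borel_measurable_continuous_onI[OF ftc] S(3)] by simp
  moreover have "open {w. 0 < w \<bullet> e}" by (intro open_Collect_less continuous_intros)
  moreover have "open (\<Phi> -` \<Omega>)" using ray_map_continuous \<Omega>_open by (intro open_vimage)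
  moreover have "closed {w. d (\<Phi> w) = w \<bullet> e}"
    by (intro closed_Collect_eq continuous_intros continuous_on_compose2[OF dist_continuous ray_map_continuous]) auto
  ultimately show ?thesis by (auto intro!: sets.Int)
qed

text \<open>Membership in \<open>ray_set\<close> is inherited by earlier positive times, so the
  existence of a later time can be tested at the increments 1/(n+1), which is a countable
  union.\<close>

lemma open_ray_set_borel: "\<U> \<in> sets borel"
proof -
  have "\<U> = \<A> \<inter> (\<Union>n. (\<lambda>w. w + inverse (real (Suc n)) *\<^sub>R e) -` \<A>)"
  proof (intro equalityI subsetI)
    fix w assume w: "w \<in> \<U>"
    then obtain s where s: "0 < s" "w + s *\<^sub>R e \<in> \<A>" by (auto simp: open_ray_set_def)
    obtain n where n: "inverse (real (Suc n)) < s" using reals_Archimedean[OF s(1)] by blast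
    have wA: "w \<in> \<A>" using w open_ray_set_subset by blast
    have "(w + s *\<^sub>R e) + (inverse (real (Suc n)) - s) *\<^sub>R e \<in> \<A>"
    proof (rule ray_set_down[OF s(2)])
      have "0 < inverse (real (Suc n))" by simp
      then show "0 < (w + s *\<^sub>R e) \<bullet> e + (inverse (real (Suc n)) - s)"
        using ray_set_facts(3)[OF wA] unfolding shift_e by linarith
    qed (use n in simp)
    then have "w + inverse (real (Suc n)) *\<^sub>R e \<in> \<A>" by (simp add: algebra_simps)
    then show "w \<in> \<A> \<inter> (\<Union>n. (\<lambda>w. w + inverse (real (Suc n)) *\<^sub>R e) -` \<A>)" using wA by blast
  next
    fix w assume "w \<in> \<A> \<inter> (\<Union>n. (\<lambda>w. w + inverse (real (Suc n)) *\<^sub>R e) -` \<A>)"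
    then obtain n where "w \<in> \<A>" "w + inverse (real (Suc n)) *\<^sub>R e \<in> \<A>" by auto
    then show "w \<in> \<U>" unfolding open_ray_set_def by (intro CollectI conjI exI[of _ "inverse (real (Suc n))"]) auto
  qed
  moreover have "(\<lambda>w. w + s *\<^sub>R e) -` \<A> \<in> sets borel" for s
    using measurable_sets[of "\<lambda>w. w + s *\<^sub>R e" borel borel \<A>] ray_set_borel
    by (simp add: borel_measurable_continuous_onI continuous_intros)
  ultimately show ?thesis using ray_set_borel by auto
qed

lemma ray_set_bounded: "bounded \<A>"
proof -
  obtain B where B: "\<And>y. y \<in> frontier \<Omega> \<Longrightarrow> norm y \<le> B"
    using compact_imp_bounded[OF frontier_compact] by (auto simp: bounded_iff)
  have ne: "norm e = 1" using cee[OF chart] by (simp add: norm_eq_sqrt_inner)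
  have "norm w \<le> 2 * B + aniso_inradius F \<Omega>" if w: "w \<in> \<A>" for w
  proof -
    note f = ray_set_facts[OF w]
    have le: "w \<bullet> e \<le> aniso_inradius F \<Omega>" using dist_le_inradius[OF f(4)] f(5) by simp
    have eqw: "ft w - (ft w \<bullet> e) *\<^sub>R e + (w \<bullet> e) *\<^sub>R e = w"
      unfolding graph_point_e[OF chart] by (simp add: foot_eq[OF chart] algebra_simps)
    have "norm w \<le> norm (ft w) + norm ((ft w \<bullet> e) *\<^sub>R e) + norm ((w \<bullet> e) *\<^sub>R e)"
      using norm_triangle_ineq[of "ft w - (ft w \<bullet> e) *\<^sub>R e" "(w \<bullet> e) *\<^sub>R e"]
        norm_triangle_ineq4[of "ft w" "(ft w \<bullet> e) *\<^sub>R e"] unfolding eqw by linarith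
    also have "\<dots> \<le> B + B + aniso_inradius F \<Omega>"
    proof -
      have "\<bar>ft w \<bullet> e\<bar> \<le> norm (ft w)" using Cauchy_Schwarz_ineq2[of "ft w" e] ne by simp
      then show ?thesis using B[OF f(2)] f(3) le ne by simp
    qed
    finally show ?thesis by simp
  qed
  then show ?thesis unfolding bounded_iff by blast
qed

text \<open>No vertical line contains two such parameters, as the earlier one would not be last on
  its ray; differentiable maps of R^N into itself preserve null sets.\<close>

lemma cut_points_negligible: "negligible (\<Phi> ` (\<A> - \<U>))"
proof -
  have "negligible (\<A> - \<U>)"
  proof (rule negligible_disjoint_translates)
    show "\<A> - \<U> \<in> sets borel" using ray_set_borel open_ray_set_borel by auto
    show "bounded (\<A> - \<U>)" using ray_set_bounded by (rule bounded_subset) auto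
    show "w + s *\<^sub>R e \<notin> \<A> - \<U>" if "0 < s" "w \<in> \<A> - \<U>" for w s
      using that by (auto simp: open_ray_set_def)
  qed
  moreover have "\<Phi> differentiable_on (\<A> - \<U>)"
    using ray_map_derivative[OF chart] unfolding differentiable_on_def differentiable_def
    by (meson has_derivative_at_withinI)
  ultimately show ?thesis by (intro negligible_differentiable_image_negligible) auto
qed

lemma ray_map_covers:
  assumes x: "x \<in> \<Omega>" and y: "y \<in> S" and near: "polar F (x - y) = d x"
  shows "x \<in> \<Phi> ` \<A>"
proof -
  \<comment> \<open>The point on the vertical line through y whose component along \<open>e\<close>
    is the required time.\<close>
  define w where "w = y + (d x - y \<bullet> e) *\<^sub>R e"
  have yb: "y \<in> ball x0 r" "y \<in> frontier \<Omega>" using S y by auto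
  have fw: "ft w = y" unfolding w_def foot_translate[OF chart] by (rule graph_point_y[OF chart yb])
  have we: "w \<bullet> e = d x" by (simp add: w_def shift_e)
  have g: "grad \<gamma> w = grad \<gamma> y" unfolding w_def by (rule grad_\<gamma>_translate[OF chart])
  have "\<Phi> w = x" using nearest_point[OF chart yb x near] by (simp add: ray_map_eq fw we g) (metis add_diff_cancel_left' add_diff_eq)
  then show ?thesis using x y fw we dist_pos[OF x] by (intro image_eqI[of _ _ w]) (auto simp: ray_set_def)
qed

lemma ray_image_subset: "\<Phi> ` \<U> \<subseteq> \<Omega>"
  using open_ray_set_subset by (auto simp: ray_set_def)

lemma ray_image_lebesgue: "\<Phi> ` \<U> \<in> sets lebesgue"
proof (rule differentiable_image_in_sets_lebesgue)
  show "\<U> \<in> sets lebesgue" using open_ray_set_borel by (simp add: sets_completionI_sets)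
  show "\<Phi> differentiable_on \<U>"
    using ray_map_derivative[OF chart] unfolding differentiable_on_def differentiable_def
    by (meson has_derivative_at_withinI)
qed simp

end

end

section \<open>The energy inequality along rays\<close>

lemma DERIV_abs_powr:
  assumes "1 < p"
  shows "((\<lambda>x::real. \<bar>x\<bar> powr p) has_real_derivative p * \<bar>x\<bar> powr (p - 1) * sgn x) (at x)"
proof -
  consider "x > 0" | "x < 0" | "x = 0" by linarith
  then show ?thesis
  proof cases
    case 1
    have "((\<lambda>x. x powr p) has_real_derivative p * \<bar>x\<bar> powr (p - 1) * sgn x) (at x)"
      using has_real_derivative_powr[OF 1, of p] 1 by simp
    then show ?thesis
      by (rule has_field_derivative_transform_within_open[where S="{0<..}"]) (use 1 in auto)
  next
    case 2
    have m: "- x > 0" using 2 by simp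
    have "((\<lambda>x. (- x) powr p) has_real_derivative p * (- x) powr (p - 1) * - 1) (at x)"
      by (rule DERIV_chain2[where f="\<lambda>z. z powr p" and g=uminus, OF has_real_derivative_powr[OF m]])
         (auto intro!: derivative_eq_intros)
    then have "((\<lambda>x. (- x) powr p) has_real_derivative p * \<bar>x\<bar> powr (p - 1) * sgn x) (at x)"
      using 2 by simp
    then show ?thesis
      by (rule has_field_derivative_transform_within_open[where S="{..<0}"]) (use 2 in auto)
  next
    case 3
    have "((\<lambda>h::real. \<bar>h\<bar> powr (p - 1)) \<longlongrightarrow> 0) (at 0)"
      by (rule tendsto_powr'[where a=0 and b="p - 1", THEN tendsto_eq_rhs]) (use assms in \<open>auto intro!: tendsto_eq_intros\<close>)
    then have "((\<lambda>h::real. \<bar>\<bar>h\<bar> powr p / h\<bar>) \<longlongrightarrow> 0) (at 0)"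
    proof (rule Lim_transform_eventually)
      have "\<forall>\<^sub>F h::real in at 0. h \<noteq> 0" by (simp add: eventually_neq_at_within)
      then show "\<forall>\<^sub>F h::real in at 0. \<bar>h\<bar> powr (p - 1) = \<bar>\<bar>h\<bar> powr p / h\<bar>"
        by eventually_elim (simp add: powr_diff)
    qed
    then have "((\<lambda>h::real. \<bar>h\<bar> powr p / h) \<longlongrightarrow> 0) (at 0)" by (rule tendsto_rabs_zero_cancel)
    then show ?thesis using 3 assms by (simp add: DERIV_def)
  qed
qed

text \<open>Young's inequality with exponents p and p/(p-1), scaled by p so that the last term is
  exactly the nonlinear term of the Riccati equation times x^p.\<close>

lemma young_powr:
  fixes x y k :: real
  assumes "1 < p" "0 \<le> x" "0 \<le> y" "0 \<le> k"
  shows "p * x powr (p - 1) * y * k \<le> y powr p + (p - 1) * (x powr p * k powr (p / (p - 1)))"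
proof -
  have q: "1 < p / (p - 1)" "1 / p + 1 / (p / (p - 1)) = 1" using assms by (simp_all add: field_simps)
  have "y * (x powr (p - 1) * k) \<le> y powr p / p + (x powr (p - 1) * k) powr (p / (p - 1)) / (p / (p - 1))"
    using assms q by (intro Youngs_inequality) auto
  also have "(x powr (p - 1) * k) powr (p / (p - 1)) = x powr p * k powr (p / (p - 1))"
    using assms by (simp add: powr_mult powr_powr)
  finally have "p * (y * (x powr (p - 1) * k)) \<le> p * (y powr p / p + x powr p * k powr (p / (p - 1)) / (p / (p - 1)))"
    using assms by (intro mult_left_mono) auto
  moreover have "p * (Y / p + X / (p / (p - 1))) = Y + (p - 1) * X" for X Y
    using assms(1) by (simp add: distrib_left)
  ultimately have "p * (y * (x powr (p - 1) * k)) \<le> y powr p + (p - 1) * (x powr p * k powr (p / (p - 1)))"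
    by (simp only:)
  then show ?thesis by (simp only: mult_ac)
qed

context finsler_norm
begin

lemma grad_F_bound: "\<exists>C>0. \<forall>\<xi>. \<xi> \<noteq> 0 \<longrightarrow> norm (grad F \<xi>) \<le> C"
proof -
  obtain C where C: "0 \<le> C" "\<And>\<xi>. F \<xi> \<le> C * norm \<xi>" using F_upper by blast
  have "norm (grad F \<xi>) \<le> C + 1" if "\<xi> \<noteq> 0" for \<xi>
  proof -
    have "(norm (grad F \<xi>))\<^sup>2 \<le> C * norm (grad F \<xi>)"
      using grad_F_supports[OF that, of "grad F \<xi>"] C(2)[of "grad F \<xi>"] by (simp add: dot_square_norm)
    then have "norm (grad F \<xi>) \<le> C" using C(1)
      by (cases "grad F \<xi> = 0") (auto simp: power2_eq_square)
    then show ?thesis by simp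
  qed
  then show ?thesis using C(1) by (intro exI[of _ "C + 1"]) auto
qed

lemma F_minus: "F (- \<xi>) = F \<xi>"
  using F_homogeneous[of "-1" \<xi>] by simp

text \<open>Picone's inequality on a ray. The summand
  \<open>- (p - 1) * k \<tau> powr (p / (p - 1))\<close> of the Riccati equation cancels the last
  term of \<open>young_powr\<close>; what remains is the energy density minus c^p
  |\<phi>|^p.\<close>

lemma ray_energy_derivative:
  fixes \<phi> :: "real^'n \<Rightarrow> real"
  assumes p: "1 < p" and \<phi>: "C_k_on (Suc 0) UNIV \<phi>" and \<xi>: "\<xi> \<noteq> 0"
    and k: "0 < k \<tau>" "(k has_real_derivative - (c powr p) - (p - 1) * k \<tau> powr (p / (p - 1))) (at \<tau>)"
  defines "\<nu> \<equiv> grad F \<xi>"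
  shows "\<exists>D. ((\<lambda>\<tau>. \<bar>\<phi> (y + \<tau> *\<^sub>R \<nu>)\<bar> powr p * k \<tau>) has_real_derivative D) (at \<tau>) \<and>
     D \<le> F (grad \<phi> (y + \<tau> *\<^sub>R \<nu>)) powr p - c powr p * \<bar>\<phi> (y + \<tau> *\<^sub>R \<nu>)\<bar> powr p"
proof -
  define x where "x = y + \<tau> *\<^sub>R \<nu>"
  define v where "v = grad \<phi> x \<bullet> \<nu>"
  have "((\<lambda>\<tau>. y + \<tau> *\<^sub>R \<nu>) has_derivative (\<lambda>h. h *\<^sub>R \<nu>)) (at \<tau>)" by (auto intro!: derivative_eq_intros)
  from has_derivative_compose[OF this C1_facts(3)[OF \<phi>]]
  have "((\<lambda>\<tau>. \<phi> (y + \<tau> *\<^sub>R \<nu>)) has_real_derivative v) (at \<tau>)"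
    unfolding has_field_derivative_def by (rule has_derivative_eq_rhs) (simp add: fun_eq_iff v_def x_def mult.commute)
  from DERIV_chain2[where g="\<lambda>\<tau>. \<phi> (y + \<tau> *\<^sub>R \<nu>)" and f="\<lambda>x. \<bar>x\<bar> powr p", OF DERIV_abs_powr[OF p] this]
  have "((\<lambda>\<tau>. \<bar>\<phi> (y + \<tau> *\<^sub>R \<nu>)\<bar> powr p) has_real_derivative p * \<bar>\<phi> x\<bar> powr (p - 1) * sgn (\<phi> x) * v) (at \<tau>)"
    by (simp only: x_def)
  from DERIV_mult'[OF this k(2)]
  have D: "((\<lambda>\<tau>. \<bar>\<phi> (y + \<tau> *\<^sub>R \<nu>)\<bar> powr p * k \<tau>) has_real_derivative
      \<bar>\<phi> x\<bar> powr p * (- (c powr p) - (p - 1) * k \<tau> powr (p / (p - 1))) + p * \<bar>\<phi> x\<bar> powr (p - 1) * sgn (\<phi> x) * v * k \<tau>) (at \<tau>)"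
    by (simp only: x_def)
  \<comment> \<open>Both signs of v are bounded because F is even.\<close>
  have sv: "sgn (\<phi> x) * v \<le> F (grad \<phi> x)"
  proof -
    have "v \<le> F (grad \<phi> x)" "- v \<le> F (grad \<phi> x)"
      using grad_F_supports[OF \<xi>, of "grad \<phi> x"] grad_F_supports[OF \<xi>, of "- grad \<phi> x"]
      by (simp_all add: v_def \<nu>_def inner_commute F_minus)
    then show ?thesis using F_nonneg[of "grad \<phi> x"] by (auto simp: sgn_if)
  qed
  have "p * \<bar>\<phi> x\<bar> powr (p - 1) * sgn (\<phi> x) * v * k \<tau> = (p * \<bar>\<phi> x\<bar> powr (p - 1) * k \<tau>) * (sgn (\<phi> x) * v)"
    by (simp only: mult_ac)
  also have "\<dots> \<le> (p * \<bar>\<phi> x\<bar> powr (p - 1) * k \<tau>) * F (grad \<phi> x)"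
    using p k(1) by (intro mult_left_mono sv) auto
  also have "\<dots> = p * \<bar>\<phi> x\<bar> powr (p - 1) * F (grad \<phi> x) * k \<tau>" by (simp only: mult_ac)
  also have "\<dots> \<le> F (grad \<phi> x) powr p + (p - 1) * (\<bar>\<phi> x\<bar> powr p * k \<tau> powr (p / (p - 1)))"
    by (rule young_powr[OF p]) (use F_nonneg k in auto)
  finally have "\<bar>\<phi> x\<bar> powr p * (- (c powr p) - (p - 1) * k \<tau> powr (p / (p - 1))) + p * \<bar>\<phi> x\<bar> powr (p - 1) * sgn (\<phi> x) * v * k \<tau>
     \<le> F (grad \<phi> x) powr p - c powr p * \<bar>\<phi> x\<bar> powr p" by (simp add: algebra_simps)
  with D show ?thesis unfolding x_def by blast
qed

end

context finsler_domain
begin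

definition energy_gap :: "real \<Rightarrow> real \<Rightarrow> (real^'n \<Rightarrow> real) \<Rightarrow> real^'n \<Rightarrow> real" where
  "energy_gap p c \<phi> x = F (grad \<phi> x) powr p - c powr p * \<bar>\<phi> x\<bar> powr p"

context
  fixes p c R' :: real and k :: "real \<Rightarrow> real" and \<phi> :: "real^'n \<Rightarrow> real"
  assumes p: "1 < p" and R': "aniso_inradius F \<Omega> < R'"
    and k: "\<And>t. 0 < t \<Longrightarrow> t < R' \<Longrightarrow> 0 < k t"
      "\<And>t. 0 < t \<Longrightarrow> t < R' \<Longrightarrow> (k has_real_derivative - (c powr p) - (p - 1) * k t powr (p / (p - 1))) (at t)"
    and \<phi>: "test_function \<Omega> \<phi>"
    and curv: "\<And>y. y \<in> frontier \<Omega> \<Longrightarrow> 0 \<le> aniso_mean_curvature F \<Omega> y"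
begin

abbreviation (input) "gap \<equiv> energy_gap p c \<phi>"

lemma energy_terms_continuous:
  "continuous_on UNIV (\<lambda>x. F (grad \<phi> x) powr p)" "continuous_on UNIV (\<lambda>x. \<bar>\<phi> x\<bar> powr p)"
proof -
  note t = test_function_facts[OF \<phi>]
  have "continuous_on UNIV (\<lambda>x. F (grad \<phi> x))"
    by (rule continuous_on_compose2[OF F_continuous t(3)]) auto
  then show "continuous_on UNIV (\<lambda>x. F (grad \<phi> x) powr p)"
    using p F_nonneg by (intro continuous_on_powr' continuous_on_const) auto
  show "continuous_on UNIV (\<lambda>x. \<bar>\<phi> x\<bar> powr p)"
    using p t(2) by (intro continuous_on_powr' continuous_on_const continuous_on_rabs) auto
qed

lemma energy_gap_continuous: "continuous_on UNIV gap"
  unfolding energy_gap_def[abs_def]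
  by (intro continuous_on_diff continuous_on_mult continuous_on_const energy_terms_continuous)

lemma test_support:
  obtains K \<delta> where "compact K" "K \<subseteq> \<Omega>" "0 < \<delta>" "\<And>x. x \<in> K \<Longrightarrow> \<delta> \<le> d x"
    "\<And>x. x \<notin> K \<Longrightarrow> \<phi> x = 0" "\<And>x. x \<notin> K \<Longrightarrow> grad \<phi> x = 0"
proof -
  obtain K where K: "compact K" "K \<subseteq> \<Omega>" "\<And>x. x \<notin> K \<Longrightarrow> \<phi> x = 0" "\<And>x. x \<notin> K \<Longrightarrow> grad \<phi> x = 0"
    using test_function_facts(4)[OF \<phi>] by blast
  have "\<exists>\<delta>>0. \<forall>x\<in>K. \<delta> \<le> d x"
  proof (cases "K = {}")
    case False
    obtain x where "x \<in> K" "\<And>y. y \<in> K \<Longrightarrow> d x \<le> d y"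
      using continuous_attains_inf[OF K(1) False continuous_on_subset[OF dist_continuous]] by blast
    then show ?thesis using dist_pos K(2) by blast
  qed (auto intro: zero_less_one)
  then show ?thesis using that K by blast
qed

text \<open>Nothing is known about k outside (0, R'), but \<phi> vanishes off a compact subset K of
  \<open>\<Omega>\<close>: on \<open>\<Omega>\<close> the distance takes values in (0, R'), on the
  complement of K the function is 0, and these two open sets cover the space.\<close>

lemma weighted_test_function:
  defines "f \<equiv> \<lambda>x. \<bar>\<phi> x\<bar> powr p * k (d x)"
  shows "continuous_on UNIV f" "0 \<le> f x"
proof -
  obtain K \<delta> where K: "compact K" "K \<subseteq> \<Omega>" "0 < \<delta>" "\<And>x. x \<in> K \<Longrightarrow> \<delta> \<le> d x"
    "\<And>x. x \<notin> K \<Longrightarrow> \<phi> x = 0" by (rule test_support) blast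
  have r: "0 < d x" "d x < R'" if "x \<in> \<Omega>" for x
    using dist_pos[OF that] dist_le_inradius[OF that] R' by auto
  show "0 \<le> f x"
    using k(1)[OF r, of x] K by (cases "x \<in> K") (auto simp: f_def less_imp_le subset_iff)
  have "continuous_on \<Omega> f" unfolding f_def
  proof (intro continuous_on_mult continuous_on_subset[OF energy_terms_continuous(2)])
    have "continuous_on {0<..<R'} k"
      using DERIV_isCont[OF k(2)] by (intro continuous_at_imp_continuous_on) auto
    then show "continuous_on \<Omega> (\<lambda>x. k (d x))"
      by (rule continuous_on_compose2[OF _ continuous_on_subset[OF dist_continuous]]) (use r in auto)
  qed auto
  moreover have "continuous_on (- K) f"
  proof -
    have "continuous_on (- K) (\<lambda>x. 0 :: real)" by simp
    then show ?thesis by (rule continuous_on_eq) (simp add: f_def K(5))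
  qed
  ultimately have "continuous_on (\<Omega> \<union> - K) f"
    using \<Omega>_open K(1) by (intro continuous_on_open_Un) (auto simp: compact_imp_closed)
  moreover have "\<Omega> \<union> - K = UNIV" using K(2) by auto
  ultimately show "continuous_on UNIV f" by simp
qed

context
  fixes x0 r e \<gamma> S
  assumes chart: "boundary_chart \<Omega> x0 r e \<gamma>"
    and S: "S \<subseteq> ball x0 r" "S \<subseteq> frontier \<Omega>" "S \<in> sets borel"
begin

abbreviation (input) "RM \<equiv> ray_map e \<gamma>"
abbreviation (input) "OR \<equiv> open_ray_set e \<gamma> S"
abbreviation (input) "jac w \<equiv> \<bar>det (ray_jacobian e \<gamma> w)\<bar>"
abbreviation (input) "wt x \<equiv> \<bar>\<phi> x\<bar> powr p * k (d x)"

text \<open>One step length s serves all rays at once: the gap is uniformly continuous on the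
  closure of \<open>\<Omega>\<close>, so its value at the intermediate point of the mean value
  theorem may be replaced by that at the end point, at the price of \<epsilon>.\<close>

lemma ray_difference_bound:
  assumes "0 < \<epsilon>"
  shows "\<exists>s>0. \<forall>w\<in>OR. wt (RM w) - indicator OR (w + (- s) *\<^sub>R e) * wt (RM (w + (- s) *\<^sub>R e))
     \<le> s * (gap (RM w) + \<epsilon>)"
proof -
  obtain K \<delta> where K: "compact K" "K \<subseteq> \<Omega>" "0 < \<delta>" "\<And>x. x \<in> K \<Longrightarrow> \<delta> \<le> d x"
    "\<And>x. x \<notin> K \<Longrightarrow> \<phi> x = 0" "\<And>x. x \<notin> K \<Longrightarrow> grad \<phi> x = 0" by (rule test_support) blast
  obtain C where C: "0 < C" "\<And>\<xi>. \<xi> \<noteq> 0 \<Longrightarrow> norm (grad F \<xi>) \<le> C" using grad_F_bound by blast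
  have "uniformly_continuous_on (closure \<Omega>) gap"
    by (intro compact_uniformly_continuous continuous_on_subset[OF energy_gap_continuous]) (use \<Omega>_bounded in auto)
  then obtain \<eta> where \<eta>: "0 < \<eta>" "\<And>x z. x \<in> closure \<Omega> \<Longrightarrow> z \<in> closure \<Omega> \<Longrightarrow> dist z x < \<eta> \<Longrightarrow> dist (gap z) (gap x) < \<epsilon>"
    using assms unfolding uniformly_continuous_on_def by metis
  \<comment> \<open>Below \<delta>, so that points at distance at most s from the boundary lie
    outside the support; and so small that a piece of ray of duration s, whose Euclidean speed is at
    most C, is shorter than \<eta>.\<close>
  define s where "s = min (\<delta> / 2) (\<eta> / (2 * C))"
  have s: "0 < s" "s < \<delta>" "s * C < \<eta>"
  proof -
    show "0 < s" "s < \<delta>" using K(3) \<eta>(1) C(1) by (auto simp: s_def)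
    have "s * C \<le> \<eta> / (2 * C) * C" using C(1) by (intro mult_right_mono) (auto simp: s_def)
    also have "\<dots> < \<eta>" using C(1) \<eta>(1) by simp
    finally show "s * C < \<eta>" .
  qed
  have "wt (RM w) - indicator OR (w + (- s) *\<^sub>R e) * wt (RM (w + (- s) *\<^sub>R e)) \<le> s * (gap (RM w) + \<epsilon>)"
    if w: "w \<in> OR" for w
  proof -
    define t where "t = w \<bullet> e"
    define \<xi> where "\<xi> = e - grad \<gamma> w"
    have \<xi>0: "\<xi> \<noteq> 0" unfolding \<xi>_def by (rule conormal_nonzero[OF chart])
    have wA: "w \<in> ray_set e \<gamma> S" using w open_ray_set_subset[OF chart S] by blast
    have t0: "0 < t" using ray_set_facts(3)[OF chart S wA] by (simp add: t_def)
    have RMw: "RM w \<in> \<Omega>" "d (RM w) = t" using wA by (auto simp: ray_set_def t_def)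
    have tR: "t < R'" using dist_le_inradius[OF RMw(1)] RMw(2) R' by simp
    show ?thesis
    proof (cases "t \<le> s")
      case True
      \<comment> \<open>The translate has left the ray, and the point itself lies outside the
        support: the claim is \<open>0 \<le> s * \<epsilon>\<close>.\<close>
      have "w + (- s) *\<^sub>R e \<notin> OR"
      proof
        assume "w + (- s) *\<^sub>R e \<in> OR"
        then have "w + (- s) *\<^sub>R e \<in> ray_set e \<gamma> S" using open_ray_set_subset[OF chart S] by blast
        from ray_set_facts(3)[OF chart S this] True show False
          unfolding shift_e[OF chart S] t_def by simp
      qed
      moreover have "RM w \<notin> K" using K(4)[of "RM w"] RMw True s by auto
      ultimately show ?thesis using K(5,6)[of "RM w"] s assms p F_0 by (simp add: energy_gap_def)
    next
      case False
      define y where "y = graph_point e \<gamma> w"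
      define \<nu> where "\<nu> = grad F \<xi>"
      have pt: "y + \<tau> *\<^sub>R \<nu> \<in> \<Omega> \<and> d (y + \<tau> *\<^sub>R \<nu>) = \<tau> \<and> w + (\<tau> - t) *\<^sub>R e \<in> OR \<and> RM (w + (\<tau> - t) *\<^sub>R e) = y + \<tau> *\<^sub>R \<nu>"
        if \<tau>: "0 < \<tau>" "\<tau> \<le> t" for \<tau>
      proof -
        have in_OR: "w + (\<tau> - t) *\<^sub>R e \<in> OR"
          by (rule open_ray_set_down[OF chart S w]) (use \<tau> in \<open>auto simp: t_def\<close>)
        then have in_A: "w + (\<tau> - t) *\<^sub>R e \<in> ray_set e \<gamma> S" using open_ray_set_subset[OF chart S] by blast
        have eq: "RM (w + (\<tau> - t) *\<^sub>R e) = y + \<tau> *\<^sub>R \<nu>"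
          unfolding ray_map_translate[OF chart]
          by (simp add: ray_map_def y_def \<nu>_def \<xi>_def t_def scaleR_diff_left)
        have "(w + (\<tau> - t) *\<^sub>R e) \<bullet> e = \<tau>" unfolding shift_e[OF chart S] by (simp add: t_def)
        then show ?thesis using in_OR in_A eq unfolding ray_set_def by auto
      qed
      define g where "g \<tau> = \<bar>\<phi> (y + \<tau> *\<^sub>R \<nu>)\<bar> powr p * k \<tau>" for \<tau>
      have gd: "\<exists>D. (g has_real_derivative D) (at \<tau>) \<and> D \<le> gap (y + \<tau> *\<^sub>R \<nu>)" if \<tau>: "0 < \<tau>" "\<tau> \<le> t" for \<tau>
        unfolding g_def \<nu>_def energy_gap_def
        by (rule ray_energy_derivative[OF p test_function_facts(1)[OF \<phi>] \<xi>0 k]) (use \<tau> tR in auto)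
      have ts: "0 < t - s" "t - s < t" using False s by auto
      have "\<exists>\<tau>. t - s < \<tau> \<and> \<tau> < t \<and> g t - g (t - s) \<le> s * gap (y + \<tau> *\<^sub>R \<nu>)"
      proof -
        obtain D where D: "\<And>\<tau>. 0 < \<tau> \<Longrightarrow> \<tau> \<le> t \<Longrightarrow> (g has_real_derivative D \<tau>) (at \<tau>) \<and> D \<tau> \<le> gap (y + \<tau> *\<^sub>R \<nu>)"
          using gd by metis
        obtain \<tau> where "t - s < \<tau>" "\<tau> < t" "g t - g (t - s) = (t - (t - s)) * D \<tau>"
          using MVT2[OF ts(2), of g D] D ts by force
        then show ?thesis using D[of \<tau>] ts s by (intro exI[of _ \<tau>]) (auto intro!: mult_left_mono)
      qed
      then obtain \<tau> where \<tau>: "t - s < \<tau>" "\<tau> < t" "g t - g (t - s) \<le> s * gap (y + \<tau> *\<^sub>R \<nu>)" by blast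
      have RMe: "RM w = y + t *\<^sub>R \<nu>" using pt[of t] t0 by simp
      have "dist (y + \<tau> *\<^sub>R \<nu>) (RM w) = \<bar>\<tau> - t\<bar> * norm \<nu>"
        unfolding RMe by (simp add: dist_norm flip: scaleR_diff_left)
      also have "\<dots> \<le> s * C" using \<tau> s C(2)[OF \<xi>0] by (intro mult_mono) (auto simp: \<nu>_def)
      finally have "dist (y + \<tau> *\<^sub>R \<nu>) (RM w) < \<eta>" using s(3) by simp
      moreover have "y + \<tau> *\<^sub>R \<nu> \<in> closure \<Omega>" "RM w \<in> closure \<Omega>"
        using pt[of \<tau>] \<tau> ts RMw(1) closure_subset by auto
      ultimately have "dist (gap (y + \<tau> *\<^sub>R \<nu>)) (gap (RM w)) < \<epsilon>" by (intro \<eta>(2))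
      then have "gap (y + \<tau> *\<^sub>R \<nu>) \<le> gap (RM w) + \<epsilon>" by (simp add: dist_real_def)
      then have "g t - g (t - s) \<le> s * (gap (RM w) + \<epsilon>)"
        using \<tau>(3) s(1) by (meson mult_left_mono less_imp_le order_trans)
      moreover have "wt (RM w) = g t" using RMw(2) RMe by (simp add: g_def)
      moreover have "indicator OR (w + (- s) *\<^sub>R e) * wt (RM (w + (- s) *\<^sub>R e)) = g (t - s)"
        using pt[of "t - s"] ts s by (simp add: g_def)
      ultimately show ?thesis by simp
    qed
  qed
  with s(1) show ?thesis by blast
qed

lemma chart_jacobian_antimono:
  assumes "w \<in> OR" "w + (- s) *\<^sub>R e \<in> OR" "0 < s"
  shows "jac w \<le> jac (w + (- s) *\<^sub>R e)"
proof -
  have wA: "w \<in> ray_set e \<gamma> S" "w + (- s) *\<^sub>R e \<in> ray_set e \<gamma> S"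
    using assms open_ray_set_subset[OF chart S] by auto
  note f = ray_set_facts[OF chart S wA(1)]
  obtain t1 where t1: "w \<bullet> e < t1" "graph_point e \<gamma> w + t1 *\<^sub>R grad F (e - grad \<gamma> w) \<in> \<Omega>"
    "d (graph_point e \<gamma> w + t1 *\<^sub>R grad F (e - grad \<gamma> w)) = t1"
    using open_ray_set_extends[OF chart S assms(1)] by blast
  have "s \<le> w \<bullet> e" using ray_set_facts(3)[OF chart S wA(2)] unfolding shift_e[OF chart S] by simp
  then show ?thesis
    using ray_jacobian_antimono[OF chart f(1,2) curv[OF f(2)] t1] assms(3) by simp
qed

text \<open>
  Translation by \<open>- s e\<close> moves a ray into itself and, by monotonicity of the Jacobian, does not
  increase the integral of the weight. Dividing the resulting difference by \<open>s\<close> replaces Fubini and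
  integration by parts along the rays.
\<close>

lemma chart_energy_inequality: "0 \<le> (LINT x:RM ` OR|lebesgue. gap x)"
proof -
  have ORb: "OR \<in> sets borel" by (rule open_ray_set_borel[OF chart S])
  then have ORl: "OR \<in> sets lebesgue" by (simp add: sets_completionI_sets)
  define X where "X = RM ` OR"
  have Xl: "X \<in> sets lebesgue" unfolding X_def by (rule ray_image_lebesgue[OF chart S])
  have X\<Omega>: "X \<subseteq> \<Omega>" unfolding X_def by (rule ray_image_subset[OF chart S])
  obtain K \<delta> where K: "compact K" "\<And>x. x \<notin> K \<Longrightarrow> \<phi> x = 0" "\<And>x. x \<notin> K \<Longrightarrow> grad \<phi> x = 0" by (rule test_support) blast
  have sX: "set_integrable lebesgue X f" if "continuous_on UNIV f" "\<And>x. x \<notin> K \<Longrightarrow> f x = 0" for f :: "real^'n \<Rightarrow> real"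
    unfolding set_integrable_def
    by (intro integrable_mult_indicator Xl integrable_continuous_compact_support[OF that(1) K(1) that(2)])
  have gX: "set_integrable lebesgue X gap"
    by (rule sX[OF energy_gap_continuous]) (use K p F_0 in \<open>simp add: energy_gap_def\<close>)
  have wX: "set_integrable lebesgue X (\<lambda>x. wt x)"
    by (rule sX[OF weighted_test_function(1)]) (use K p in simp)
  have oX: "set_integrable lebesgue X (\<lambda>x. 1 :: real)"
    using integrable_indicator_bounded[OF Xl bounded_subset[OF \<Omega>_bounded X\<Omega>]] by (simp add: set_integrable_def)
  note cv = change_of_variables_finite[OF ORl has_derivative_at_withinI[OF ray_map_derivative[OF chart]]
      ray_map_inj[OF chart S], folded X_def]
  define W where "W w = indicator OR w * (jac w * wt (RM w))" for w
  have Wi: "integrable lebesgue W" using cv(1)[OF wX] by (simp add: set_integrable_def W_def[abs_def])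
  have W0: "0 \<le> W w" for w unfolding W_def
    by (rule mult_nonneg_nonneg[OF _ mult_nonneg_nonneg[OF _ weighted_test_function(2)]]) auto
  \<comment> \<open>Measurability of the Jacobian is read off from the change of variables for the
    constant 1, which is integrable on the bounded set X.\<close>
  have jm: "(\<lambda>w. indicator OR w * jac w) \<in> borel_measurable lebesgue"
    using cv(1)[OF oX] borel_measurable_integrable by (auto simp: set_integrable_def)
  have "- \<epsilon> * (LINT x:X|lebesgue. 1) \<le> (LINT x:X|lebesgue. gap x)" if \<epsilon>: "0 < \<epsilon>" for \<epsilon>
  proof -
    obtain s where s: "0 < s" and bd: "\<And>w. w \<in> OR \<Longrightarrow> wt (RM w) - indicator OR (w + (- s) *\<^sub>R e) * wt (RM (w + (- s) *\<^sub>R e))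
       \<le> s * (gap (RM w) + \<epsilon>)" using ray_difference_bound[OF \<epsilon>] by blast
    define b where "b w = indicator OR (w + (- s) *\<^sub>R e) * wt (RM (w + (- s) *\<^sub>R e))" for w
    \<comment> \<open>The translated weight with the Jacobian of the original point. By monotonicity
      of the Jacobian it lies below the translate of W, while W - m is the Jacobian times the
      difference estimated in \<open>bd\<close>.\<close>
    define m where "m w = indicator OR w * jac w * b w" for w
    have tr: "integrable lebesgue (\<lambda>w. W ((- s) *\<^sub>R e + w))" "(LINT w|lebesgue. W ((- s) *\<^sub>R e + w)) = (LINT w|lebesgue. W w)"
      by (rule integral_lebesgue_translation[OF Wi])+
    have b0: "0 \<le> b w" for w unfolding b_def by (rule mult_nonneg_nonneg[OF _ weighted_test_function(2)]) simp
    have m0: "0 \<le> m w" for w unfolding m_def using b0 by simp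
    have mW: "m w \<le> W ((- s) *\<^sub>R e + w)" for w
    proof (cases "w \<in> OR \<and> w + (- s) *\<^sub>R e \<in> OR")
      case True
      then have "jac w * wt (RM (w + (- s) *\<^sub>R e)) \<le> jac (w + (- s) *\<^sub>R e) * wt (RM (w + (- s) *\<^sub>R e))"
        by (intro mult_right_mono[OF chart_jacobian_antimono weighted_test_function(2)] s) auto
      then show ?thesis using True by (simp add: m_def b_def W_def add.commute)
    next
      case False
      then have "m w = 0" by (auto simp: m_def b_def)
      then show ?thesis using W0 by simp
    qed
    have bm: "b \<in> borel_measurable lebesgue"
    proof -
      have i: "(\<lambda>w. indicator OR w * wt (RM w)) \<in> borel_measurable borel"
      proof (rule borel_measurable_times)
        show "indicator OR \<in> borel_measurable borel" using ORb by (rule borel_measurable_indicator)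
        show "(\<lambda>w. wt (RM w)) \<in> borel_measurable borel"
          by (intro borel_measurable_continuous_onI continuous_on_compose2[OF weighted_test_function(1) ray_map_continuous[OF chart S]]) auto
      qed
      have "(\<lambda>w. w + (- s) *\<^sub>R e) \<in> borel_measurable borel"
        by (intro borel_measurable_continuous_onI continuous_intros)
      from measurable_compose[OF this i] show ?thesis unfolding b_def[abs_def] by (simp add: measurable_completion)
    qed
    have mi: "integrable lebesgue m"
    proof (rule Bochner_Integration.integrable_bound[OF tr(1)])
      show "m \<in> borel_measurable lebesgue" unfolding m_def[abs_def] by (rule borel_measurable_times[OF jm bm])
      show "AE w in lebesgue. norm (m w) \<le> norm (W ((- s) *\<^sub>R e + w))" using m0 mW W0 by simp
    qed
    have "(LINT w|lebesgue. m w) \<le> (LINT w|lebesgue. W w)"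
      using integral_mono[OF mi tr(1) mW] tr(2) by simp
    then have "0 \<le> (LINT w|lebesgue. W w - m w)" using Wi mi by simp
    also have "\<dots> \<le> (LINT w|lebesgue. s * (indicator OR w *\<^sub>R (jac w * gap (RM w))) + s * \<epsilon> * (indicator OR w *\<^sub>R (jac w * 1)))"
    proof (rule integral_mono)
      show "integrable lebesgue (\<lambda>w. W w - m w)" using Wi mi by simp
      show "integrable lebesgue (\<lambda>w. s * (indicator OR w *\<^sub>R (jac w * gap (RM w))) + s * \<epsilon> * (indicator OR w *\<^sub>R (jac w * 1)))"
        using cv(1)[OF gX] cv(1)[OF oX] unfolding set_integrable_def
        by (intro Bochner_Integration.integrable_add integrable_mult_right)
      fix w
      show "W w - m w \<le> s * (indicator OR w *\<^sub>R (jac w * gap (RM w))) + s * \<epsilon> * (indicator OR w *\<^sub>R (jac w * 1))"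
      proof (cases "w \<in> OR")
        case True
        have "jac w * (wt (RM w) - b w) \<le> jac w * (s * (gap (RM w) + \<epsilon>))"
          using bd[OF True] unfolding b_def by (intro mult_left_mono) auto
        then show ?thesis using True by (simp add: W_def m_def algebra_simps)
      qed (simp add: W_def m_def)
    qed
    also have "\<dots> = s * (LINT w:OR|lebesgue. jac w * gap (RM w)) + s * \<epsilon> * (LINT w:OR|lebesgue. jac w * 1)"
      using cv(1)[OF gX] cv(1)[OF oX] unfolding set_integrable_def set_lebesgue_integral_def
      by (subst Bochner_Integration.integral_add) (auto intro!: integrable_mult_right)
    also have "\<dots> = s * ((LINT x:X|lebesgue. gap x) + \<epsilon> * (LINT x:X|lebesgue. 1))"
      unfolding cv(2)[OF gX] cv(2)[OF oX] by (simp add: algebra_simps)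
    finally show ?thesis using s by (simp add: zero_le_mult_iff)
  qed
  then have "(LINT x:X|lebesgue. gap x) \<ge> 0"
  proof -
    assume H: "\<And>\<epsilon>. 0 < \<epsilon> \<Longrightarrow> - \<epsilon> * (LINT x:X|lebesgue. 1) \<le> (LINT x:X|lebesgue. gap x)"
    have "((\<lambda>\<epsilon>. - \<epsilon> * (LINT x:X|lebesgue. 1 :: real)) \<longlongrightarrow> - 0 * (LINT x:X|lebesgue. 1)) (at_right 0)"
      by (intro tendsto_intros)
    then show ?thesis
      by (rule tendsto_upperbound[THEN order_trans[rotated]])
         (use H in \<open>auto simp: eventually_at_right_field intro: exI[of _ 1]\<close>)
  qed
  then show ?thesis by (simp add: X_def)
qed

end

text \<open>Each boundary point is assigned to one of finitely many charts. The ray images of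
  different pieces are disjoint, since a point before its cut point has only one nearest boundary
  point, and together with the null set of cut points they exhaust \<open>\<Omega>\<close>; the
  chart inequalities add up.\<close>

lemma energy_gap_integral_nonneg: "0 \<le> (LINT x:\<Omega>|lebesgue. gap x)"
proof -
  have "\<exists>r e \<gamma>. boundary_chart \<Omega> x r e \<gamma>" if "x \<in> frontier \<Omega>" for x
    by (rule ex_boundary_chart[OF \<Omega>_C2 that])
  then obtain r e \<gamma> where ch: "\<And>x. x \<in> frontier \<Omega> \<Longrightarrow> boundary_chart \<Omega> x (r x) (e x) (\<gamma> x)" by metis
  have rp: "0 < r x" if "x \<in> frontier \<Omega>" for x using ch[OF that] by (simp add: boundary_chart_def)
  obtain D where D: "D \<subseteq> frontier \<Omega>" "finite D" "frontier \<Omega> \<subseteq> (\<Union>x\<in>D. ball x (r x))"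
  proof (rule compactE_image[OF frontier_compact, of "frontier \<Omega>" "\<lambda>x. ball x (r x)"])
    show "frontier \<Omega> \<subseteq> (\<Union>x\<in>frontier \<Omega>. ball x (r x))" using rp by fastforce
  qed (simp, blast)
  obtain g and N :: nat where g: "bij_betw g {..<N} D"
    using ex_bij_betw_nat_finite[OF D(2)] by (auto simp: atLeast0LessThan)
  have gD: "g i \<in> D" if "i < N" for i using g that by (auto simp: bij_betw_def)
  have gf: "g i \<in> frontier \<Omega>" if "i < N" for i using gD[OF that] D(1) by blast
  define S where "S i = frontier \<Omega> \<inter> ball (g i) (r (g i)) - (\<Union>j<i. ball (g j) (r (g j)))" for i
  have S: "S i \<subseteq> ball (g i) (r (g i))" "S i \<subseteq> frontier \<Omega>" "S i \<in> sets borel" for i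
    unfolding S_def using frontier_closed[of \<Omega>] by auto
  have dS: "S i \<inter> S j = {}" if "i < j" for i j using that by (auto simp: S_def)
  have cS: "\<exists>i<N. y \<in> S i" if y: "y \<in> frontier \<Omega>" for y
  proof -
    define Q where "Q i \<longleftrightarrow> i < N \<and> y \<in> ball (g i) (r (g i))" for i
    obtain x where "x \<in> D" "y \<in> ball x (r x)" using D(3) y by blast
    moreover obtain i where "i < N" "x = g i" using \<open>x \<in> D\<close> g by (auto simp: bij_betw_def)
    ultimately have "Q i" by (simp add: Q_def)
    then obtain i0 where L: "Q i0" "\<And>j. j < i0 \<Longrightarrow> \<not> Q j"
      using exists_least_iff[of Q] by blast
    have "y \<notin> ball (g j) (r (g j))" if "j < i0" for j
      using L(2)[OF that] L(1) that unfolding Q_def by linarith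
    then have "y \<in> S i0" using L(1) y unfolding S_def Q_def by blast
    then show ?thesis using L(1) unfolding Q_def by blast
  qed
  define X where "X i = ray_map (e (g i)) (\<gamma> (g i)) ` open_ray_set (e (g i)) (\<gamma> (g i)) (S i)" for i
  define Y where "Y i = ray_map (e (g i)) (\<gamma> (g i)) `
      (ray_set (e (g i)) (\<gamma> (g i)) (S i) - open_ray_set (e (g i)) (\<gamma> (g i)) (S i))" for i
  have XL: "X i \<in> sets lebesgue" "X i \<subseteq> \<Omega>" "negligible (Y i)" "0 \<le> (LINT x:X i|lebesgue. gap x)" if i: "i < N" for i
    unfolding X_def Y_def
    by (rule ray_image_lebesgue[OF ch[OF gf[OF i]] S] ray_image_subset[OF ch[OF gf[OF i]] S]
        cut_points_negligible[OF ch[OF gf[OF i]] S] chart_energy_inequality[OF ch[OF gf[OF i]] S])+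
  have disj: "X i \<inter> X j = {}" if ij: "i < N" "j < N" "i < j" for i j
  proof (rule ccontr)
    assume "X i \<inter> X j \<noteq> {}"
    then obtain v w where v: "v \<in> open_ray_set (e (g i)) (\<gamma> (g i)) (S i)"
      and w: "w \<in> open_ray_set (e (g j)) (\<gamma> (g j)) (S j)"
      and eq: "ray_map (e (g i)) (\<gamma> (g i)) v = ray_map (e (g j)) (\<gamma> (g j)) w"
      unfolding X_def by blast
    have vA: "v \<in> ray_set (e (g i)) (\<gamma> (g i)) (S i)"
      using v open_ray_set_subset[OF ch[OF gf[OF ij(1)]] S] by blast
    have wA: "w \<in> ray_set (e (g j)) (\<gamma> (g j)) (S j)"
      using w open_ray_set_subset[OF ch[OF gf[OF ij(2)]] S] by blast
    have t: "v \<bullet> e (g i) = w \<bullet> e (g j)" using vA wA eq by (simp add: ray_set_def)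
    have "graph_point (e (g j)) (\<gamma> (g j)) w = graph_point (e (g i)) (\<gamma> (g i)) v"
    proof (rule open_ray_unique_foot[OF ch[OF gf[OF ij(1)]] S v])
      show "graph_point (e (g j)) (\<gamma> (g j)) w \<in> frontier \<Omega>"
        by (rule ray_set_facts(2)[OF ch[OF gf[OF ij(2)]] S wA])
      show "polar F (ray_map (e (g i)) (\<gamma> (g i)) v - graph_point (e (g j)) (\<gamma> (g j)) w) \<le> v \<bullet> e (g i)"
        unfolding eq t by (rule foot_near[OF ch[OF gf[OF ij(2)]] S wA])
    qed
    moreover have "graph_point (e (g j)) (\<gamma> (g j)) w \<in> S j" "graph_point (e (g i)) (\<gamma> (g i)) v \<in> S i"
      using vA wA by (auto simp: ray_set_def)
    ultimately show False using dS[OF ij(3)] by auto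
  qed
  have cover: "\<Omega> - (\<Union>i<N. X i) \<subseteq> (\<Union>i<N. Y i)"
  proof
    fix x assume x: "x \<in> \<Omega> - (\<Union>i<N. X i)"
    obtain y where y: "y \<in> frontier \<Omega>" "polar F (x - y) = d x" by (rule dist_attained)
    obtain i where i: "i < N" "y \<in> S i" using cS[OF y(1)] by blast
    have "x \<in> ray_map (e (g i)) (\<gamma> (g i)) ` ray_set (e (g i)) (\<gamma> (g i)) (S i)"
      by (rule ray_map_covers[OF ch[OF gf[OF i(1)]] S _ i(2) y(2)]) (use x in blast)
    then have "x \<in> Y i" using x i(1) unfolding X_def Y_def by blast
    then show "x \<in> (\<Union>i<N. Y i)" using i(1) by blast
  qed
  have neg: "negligible (\<Union>i<N. Y i)" using XL(3) by (intro negligible_Union) auto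
  obtain K \<delta> where K: "compact K" "\<And>x. x \<notin> K \<Longrightarrow> \<phi> x = 0" "\<And>x. x \<notin> K \<Longrightarrow> grad \<phi> x = 0" by (rule test_support) blast
  have gi: "integrable lebesgue gap"
    by (rule integrable_continuous_compact_support[OF energy_gap_continuous K(1)])
       (use K p F_0 in \<open>simp add: energy_gap_def\<close>)
  have "(LINT x:\<Omega>|lebesgue. gap x) = (LINT x:(\<Union>i<N. X i)|lebesgue. gap x)"
    unfolding set_lebesgue_integral_def
  proof (rule integral_cong_AE)
    have "AE x in lebesgue. x \<notin> (\<Union>i<N. Y i)"
      using neg by (intro AE_not_in) (simp add: negligible_iff_null_sets)
    then show "AE x in lebesgue. indicat_real \<Omega> x *\<^sub>R gap x = indicat_real (\<Union>i<N. X i) x *\<^sub>R gap x"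
    proof eventually_elim
      case (elim x)
      then have "x \<in> \<Omega> \<longleftrightarrow> x \<in> (\<Union>i<N. X i)" using cover XL(2) by blast
      then show ?case by (simp add: indicator_def)
    qed
    have m: "\<Omega> \<in> sets lebesgue" "(\<Union>i<N. X i) \<in> sets lebesgue"
      using \<Omega>_open XL(1) by (auto intro!: sets.finite_UN)
    show "(\<lambda>x. indicat_real \<Omega> x *\<^sub>R gap x) \<in> borel_measurable lebesgue"
      "(\<lambda>x. indicat_real (\<Union>i<N. X i) x *\<^sub>R gap x) \<in> borel_measurable lebesgue"
      by (rule borel_measurable_scaleR[OF borel_measurable_indicator[OF m(1)] borel_measurable_integrable[OF gi]]
          borel_measurable_scaleR[OF borel_measurable_indicator[OF m(2)] borel_measurable_integrable[OF gi]])+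
  qed
  also have "\<dots> = (\<Sum>i<N. LINT x:X i|lebesgue. gap x)"
  proof (rule set_integral_finite_Union)
    show "disjoint_family_on X {..<N}"
      unfolding disjoint_family_on_def
    proof (intro ballI impI)
      fix i j assume ij: "i \<in> {..<N}" "j \<in> {..<N}" "i \<noteq> j"
      then consider "i < j" | "j < i" by linarith
      then show "X i \<inter> X j = {}"
        by cases (use disj[of i j] disj[of j i] ij in \<open>simp_all add: Int_commute\<close>)
    qed
    show "set_integrable lebesgue (X i) gap" if "i \<in> {..<N}" for i
      unfolding set_integrable_def using that XL(1) by (intro integrable_mult_indicator gi) auto
  qed (use XL(1) in auto)
  also have "\<dots> \<ge> 0" using XL(4) by (intro sum_nonneg) auto
  finally show ?thesis .
qed

lemma test_function_eigenvalue_bound: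
  "c powr p * (LINT x:\<Omega>|lebesgue. \<bar>\<phi> x\<bar> powr p) \<le> (LINT x:\<Omega>|lebesgue. F (grad \<phi> x) powr p)"
proof -
  obtain K \<delta> where K: "compact K" "\<And>x. x \<notin> K \<Longrightarrow> \<phi> x = 0" "\<And>x. x \<notin> K \<Longrightarrow> grad \<phi> x = 0" by (rule test_support) blast
  have i1: "set_integrable lebesgue \<Omega> (\<lambda>x. F (grad \<phi> x) powr p)"
    unfolding set_integrable_def using \<Omega>_open K p F_0
    by (intro integrable_mult_indicator integrable_continuous_compact_support[OF energy_terms_continuous(1) K(1)]) auto
  have i2: "set_integrable lebesgue \<Omega> (\<lambda>x. \<bar>\<phi> x\<bar> powr p)"
    unfolding set_integrable_def using \<Omega>_open K p
    by (intro integrable_mult_indicator integrable_continuous_compact_support[OF energy_terms_continuous(2) K(1)]) auto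
  show ?thesis
    using energy_gap_integral_nonneg i1 i2 unfolding energy_gap_def
    by (simp add: set_integral_diff)
qed

end

end


theorem theorem5p1:
  fixes F :: "real^'n \<Rightarrow> real" and \<Omega> :: "(real^'n) set" and p a \<beta> :: real
  assumes "1 < p"
    and "\<forall>\<xi>. 0 \<le> F \<xi>"
    and "convex_on UNIV F"
    and "\<forall>t \<xi>. F (t *\<^sub>R \<xi>) = \<bar>t\<bar> * F \<xi>"
    and "0 < a" and "\<forall>\<xi>. a * norm \<xi> \<le> F \<xi>"
    and "0 < \<beta>" and "\<beta> \<le> 1" and "C_k_holder_on 3 \<beta> (UNIV - {0}) F"
    and "\<forall>\<xi>. \<xi> \<noteq> 0 \<longrightarrow> pos_def (hessian (\<lambda>\<eta>. F \<eta> powr p) \<xi>)"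
    and "2 \<le> CARD('n)"
    and "\<Omega> \<noteq> {}" and "open \<Omega>" and "connected \<Omega>" and "bounded \<Omega>"
    and "C_k_boundary 2 \<Omega>"
    and "\<forall>x\<in>frontier \<Omega>. 0 \<le> aniso_mean_curvature F \<Omega> x"
  shows "first_eigenvalue F p \<Omega> \<ge> (pi_p p / 2) powr p * (1 / aniso_inradius F \<Omega> powr p)"
proof -
  interpret finsler_domain F a \<Omega>
    using assms C_k_holder_3_imp_C2[OF assms(9)] by unfold_locales auto
  define R where "R = aniso_inradius F \<Omega>"
  have R: "0 < R"
    using assms(12) dist_pos dist_le_inradius unfolding R_def by (metis all_not_in_conv order_less_le_trans)
  have p0: "0 < p" using assms(1) by simp
  obtain C where C: "0 \<le> C" "\<And>\<xi>. F \<xi> \<le> C * norm \<xi>" using F_upper by blast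
  have pi0: "0 \<le> pi_p p" unfolding pi_p_def set_lebesgue_integral_def
    by (intro mult_nonneg_nonneg integral_nonneg_AE AE_I2) auto
  show ?thesis unfolding first_eigenvalue_def R_def[symmetric]
  proof (rule cInf_greatest)
    show "{(LINT x:\<Omega>|lebesgue. F (G x) powr p) / (LINT x:\<Omega>|lebesgue. \<bar>u x\<bar> powr p) | u G.
            u \<in> W0_1p p \<Omega> \<and> has_weak_gradient \<Omega> u G \<and> \<not> (AE x in lebesgue. x \<in> \<Omega> \<longrightarrow> u x = 0)} \<noteq> {}"
      using rayleigh_set_nonempty[OF assms(13,12) p0] by blast
    fix q assume "q \<in> {(LINT x:\<Omega>|lebesgue. F (G x) powr p) / (LINT x:\<Omega>|lebesgue. \<bar>u x\<bar> powr p) | u G.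
            u \<in> W0_1p p \<Omega> \<and> has_weak_gradient \<Omega> u G \<and> \<not> (AE x in lebesgue. x \<in> \<Omega> \<longrightarrow> u x = 0)}"
    then obtain u G where u: "u \<in> W0_1p p \<Omega>" "has_weak_gradient \<Omega> u G" "\<not> (AE x in lebesgue. x \<in> \<Omega> \<longrightarrow> u x = 0)"
      and q: "q = (LINT x:\<Omega>|lebesgue. F (G x) powr p) / (LINT x:\<Omega>|lebesgue. \<bar>u x\<bar> powr p)" by blast
    show "(pi_p p / 2) powr p * (1 / R powr p) \<le> q"
    \<comment> \<open>The value of the integral \<open>pi_p\<close> is never computed. Should it be
      0, the bound is 0 and holds because Rayleigh quotients are nonnegative; otherwise the
      integrand is integrable and its p-sine function exists.\<close>
    proof (cases "pi_p p = 0")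
      case True
      have "0 \<le> q" unfolding q set_lebesgue_integral_def
        by (intro divide_nonneg_nonneg integral_nonneg_AE AE_I2) auto
      then show ?thesis using True by simp
    next
      case False
      then have pi: "0 < pi_p p" using pi0 by simp
      have bound: "(pi_p p / 2 / R') powr p \<le> q" if R': "R < R'" for R'
      proof -
        define c where "c = pi_p p / 2 / R'"
        have "0 < R'" using R R' by simp
        obtain k where k: "\<And>t. 0 < t \<Longrightarrow> t < R' \<Longrightarrow> 0 < k t"
          "\<And>t. 0 < t \<Longrightarrow> t < R' \<Longrightarrow> (k has_real_derivative - (c powr p) - (p - 1) * k t powr (p / (p - 1))) (at t)"
          by (rule pi_p_riccati[OF assms(1) \<open>0 < R'\<close> c_def pi]) blast
        show ?thesis unfolding q c_def[symmetric]
        proof (rule rayleigh_quotient_bound[OF assms(1,13) _ C(1) F_continuous F_nonneg F_subadditive C(2) _ u])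
          fix \<phi> assume \<phi>: "test_function \<Omega> \<phi>"
          show "c powr p * (LINT x:\<Omega>|lebesgue. \<bar>\<phi> x\<bar> powr p) \<le> (LINT x:\<Omega>|lebesgue. F (grad \<phi> x) powr p)"
            by (rule test_function_eigenvalue_bound[OF assms(1) R'[unfolded R_def] k \<phi>])
               (use assms(17) in auto)
        qed simp
      qed
      \<comment> \<open>The bound holds for every R' > R; continuity of its left side at R > 0 gives
        it for R itself.\<close>
      have "((\<lambda>R'. (pi_p p / 2 / R') powr p) \<longlongrightarrow> (pi_p p / 2 / R) powr p) (at_right R)"
        using R pi by (intro tendsto_intros) auto
      moreover have "\<forall>\<^sub>F R' in at_right R. (pi_p p / 2 / R') powr p \<le> q"
        using eventually_at_right_less[of R] by eventually_elim (rule bound)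
      ultimately have "(pi_p p / 2 / R) powr p \<le> q" by (rule tendsto_upperbound) simp
      then show ?thesis using pi R by (simp add: powr_divide powr_mult)
    qed
  qed
qed

end
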